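(* For every symmetric monoidal category $\mathscr{C}$, the category $\mathbf{Atemp}_{\mathscr{C}}$ of atemporal learners is compact closed.
   Context: $\mathscr{C}$ has tensor $\otimes$, unit $I$ and symmetry $s$; associators and unitors are suppressed in formulas. A learner from $(A,A')$ to $(B,B')$ is an element of the coend $\int^{P, Q : \mathscr{C}} \mathscr{C}(P \otimes A, Q \otimes B) \times \mathscr{C}(Q \otimes B', P \otimes A')$. Concretely, it is an equivalence class $(f \mid g)$ of a choice of parameter objects $P, Q$ and morphisms $f : P \otimes A \to Q \otimes B$, $g : Q \otimes B' \to P \otimes A'$, under the equivalence relation generated by $((q \otimes B) \circ f \circ (p \otimes A) \mid g) \sim (f \mid (p \otimes A') \circ g \circ (q \otimes B'))$ for all $p : P \to P'$, $q : Q \to Q'$, $f : P' \otimes A \to Q \otimes B$, $g : Q' \otimes B' \to P \otimes A'$. The collection of learners between two objects is allowed to be large when $\mathscr{C}$ is not small. The category $\mathbf{Learn}_{\mathscr{C}}$ has objects the pairs $(A,A')$ of objects of $\mathscr{C}$ and morphisms the learners. The identity on $(A,A')$ is $(\mathrm{id}_{I \otimes A} \mid \mathrm{id}_{I \otimes A'})$. The composite of $(l_1 \mid r_1) : (A, A') \to (B, B')$ (parameters $P_1,Q_1$) followed by $(l_2 \mid r_2) : (B, B') \to (C, C')$ (parameters $P_2,Q_2$) has parameters $P_2 \otimes P_1$ and $Q_1 \otimes Q_2$ and is represented by $(Q_1 \otimes l_2)\circ(s_{P_2,Q_1} \otimes B)\circ(P_2 \otimes l_1)$ and $(P_2 \otimes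 r_1)\circ(s_{Q_1,P_2} \otimes B')\circ(Q_1 \otimes r_2)$. $\mathbf{Learn}_{\mathscr{C}}$ is symmetric monoidal with unit $(I,I)$, $(A, A') \otimes (B, B') := (A \otimes B, B' \otimes A')$, and, for $(l_i \mid r_i) : (A_i,A_i') \to (B_i,B_i')$ with parameters $P_i,Q_i$ ($i\in\{L,R\}$), $(l_L \mid r_L) \otimes (l_R \mid r_R)$ having parameters $P_L \otimes P_R$ and $Q_R \otimes Q_L$ and represented by $l_L \otimes l_R$ and $r_R \otimes r_L$ pre- and post-composed with the evident permutations of tensor factors, giving maps $P_L \otimes P_R \otimes A_L \otimes A_R \to Q_R \otimes Q_L \otimes B_L \otimes B_R$ and $Q_R \otimes Q_L \otimes B_R' \otimes B_L' \to P_L \otimes P_R \otimes A_R' \otimes A_L'$. There is a functor $\iota : \mathscr{C} \times \mathscr{C}^{\mathrm{op}} \to \mathbf{Learn}_{\mathscr{C}}$, the identity on objects, sending $f : A \to B$ and $g : B' \to A'$ to $(I \otimes f \mid I \otimes g) : (A,A') \to (B,B')$; the structure isomorphisms of $\mathbf{Learn}_{\mathscr{C}}$ are the images under $\iota$ of those of $\mathscr{C} \times \mathscr{C}^{\mathrm{op}}$ (with tensor reversed in the second factor). There is a strict involution $(-)^* : \mathbf{Learn}_{\mathscr{C}} \to \mathbf{Learn}_{\mathscr{C}}^{\mathrm{op}}$ with $(A,A')^* = (A',A)$, $(l \mid r)^* = (r \mid l)$ and $(X \otimes Y)^* = Y^* \otimes X^*$. The cup $\eta_{(A,A')} : (I,I)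 \to (A,A') \otimes (A,A')^* = (A \otimes A', A \otimes A')$ is the learner with $P := A \otimes A'$, $Q := I$ and the coherence isomorphisms $(A \otimes A') \otimes I \to I \otimes (A \otimes A')$ and $I \otimes (A \otimes A') \to (A \otimes A') \otimes I$. The cap $\varepsilon_{(A,A')} : (A,A')^* \otimes (A,A') = (A' \otimes A, A' \otimes A) \to (I,I)$ is the learner with $P := I$, $Q := A' \otimes A$ and the coherence isomorphisms $I \otimes (A' \otimes A) \to (A' \otimes A) \otimes I$ and $(A' \otimes A) \otimes I \to I \otimes (A' \otimes A)$. The category $\mathbf{Atemp}_{\mathscr{C}}$ of atemporal learners is the quotient of $\mathbf{Learn}_{\mathscr{C}}$ (by the smallest congruence on morphisms compatible with composition and tensor, so that it inherits the symmetric monoidal structure) obtained by identifying, for every object $X = (A,A')$, the snake composite $$X \xrightarrow{\eta_X \otimes X} (X \otimes X^* ) \otimes X \cong X \otimes (X^* \otimes X) \xrightarrow{X \otimes \varepsilon_X} X$$ with the identity morphism of $X$. A symmetric monoidal category is compact closed if every object has a monoidal dual. *)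

theory Defs
  imports Main
begin

section \<open>Symmetric monoidal categories\<close>

text \<open>
  Categories are given by carrier sets of objects and arrows. Composition is written in
  applicative order, so \<open>g \<cdot> f\<close> is defined when \<open>Dom g = Cod f\<close>.
\<close>

record ('o, 'm) smc =
  Obj :: "'o set"
  Arr :: "'m set"
  Dom :: "'m \<Rightarrow> 'o"
  Cod :: "'m \<Rightarrow> 'o"
  Ident :: "'o \<Rightarrow> 'm"
  Comp :: "'m \<Rightarrow> 'm \<Rightarrow> 'm" (infixr "\<cdot>\<index>" 55)
  TensorObj :: "'o \<Rightarrow> 'o \<Rightarrow> 'o" (infix "\<otimes>\<index>" 70)
  TensorArr :: "'m \<Rightarrow> 'm \<Rightarrow> 'm" (infix "\<boxtimes>\<index>" 70)
  Unit :: 'o ("\<one>\<index>")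
  Associator :: "'o \<Rightarrow> 'o \<Rightarrow> 'o \<Rightarrow> 'm" ("\<a>\<index>")
  LeftUnitor :: "'o \<Rightarrow> 'm" ("\<l>\<index>")
  RightUnitor :: "'o \<Rightarrow> 'm" ("\<r>\<index>")
  Symmetry :: "'o \<Rightarrow> 'o \<Rightarrow> 'm" ("\<s>\<index>")

definition Hom :: "('o, 'm) smc \<Rightarrow> 'o \<Rightarrow> 'o \<Rightarrow> 'm set" where
  "Hom C A B = {f \<in> Arr C. Dom C f = A \<and> Cod C f = B}"

definition inverse_arrs :: "('o, 'm) smc \<Rightarrow> 'm \<Rightarrow> 'm \<Rightarrow> bool" where
  "inverse_arrs C f g \<longleftrightarrow>
     f \<in> Arr C \<and> g \<in> Hom C (Cod C f) (Dom C f) \<and>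
     g \<cdot>\<^bsub>C\<^esub> f = Ident C (Dom C f) \<and> f \<cdot>\<^bsub>C\<^esub> g = Ident C (Cod C f)"

definition iso_arr :: "('o, 'm) smc \<Rightarrow> 'm \<Rightarrow> bool" where
  "iso_arr C f \<longleftrightarrow> (\<exists>g. inverse_arrs C f g)"

definition inverse_arr :: "('o, 'm) smc \<Rightarrow> 'm \<Rightarrow> 'm" ("inv\<index> _" [81] 80) where
  "inv\<^bsub>C\<^esub> f = (THE g. inverse_arrs C f g)"

locale category =
  fixes C :: "('o, 'm) smc" (structure)
  assumes Dom_in [simp]: "f \<in> Arr C \<Longrightarrow> Dom C f \<in> Obj C"
    and Cod_in [simp]: "f \<in> Arr C \<Longrightarrow> Cod C f \<in> Obj C"
    and Ident_in: "A \<in> Obj C \<Longrightarrow> Ident C A \<in> Hom C A A"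
    and Comp_in: "\<lbrakk>f \<in> Hom C A B; g \<in> Hom C B D\<rbrakk> \<Longrightarrow> g \<cdot> f \<in> Hom C A D"
    and Comp_Ident: "f \<in> Hom C A B \<Longrightarrow> f \<cdot> Ident C A = f"
    and Ident_Comp: "f \<in> Hom C A B \<Longrightarrow> Ident C B \<cdot> f = f"
    and Comp_assoc: "\<lbrakk>f \<in> Hom C A B; g \<in> Hom C B D; h \<in> Hom C D E\<rbrakk>
      \<Longrightarrow> (h \<cdot> g) \<cdot> f = h \<cdot> (g \<cdot> f)"

locale monoidal_category = category C for C :: "('o, 'm) smc" (structure) +
  assumes TensorObj_in: "\<lbrakk>A \<in> Obj C; B \<in> Obj C\<rbrakk> \<Longrightarrow> A \<otimes> B \<in> Obj C"
    and TensorArr_in: "\<lbrakk>f \<in> Hom C A B; g \<in> Hom C A' B'\<rbrakk>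
      \<Longrightarrow> f \<boxtimes> g \<in> Hom C (A \<otimes> A') (B \<otimes> B')"
    and TensorArr_Ident: "\<lbrakk>A \<in> Obj C; B \<in> Obj C\<rbrakk>
      \<Longrightarrow> Ident C A \<boxtimes> Ident C B = Ident C (A \<otimes> B)"
    and TensorArr_Comp:
      "\<lbrakk>f \<in> Hom C A B; g \<in> Hom C B D; f' \<in> Hom C A' B'; g' \<in> Hom C B' D'\<rbrakk>
      \<Longrightarrow> (g \<cdot> f) \<boxtimes> (g' \<cdot> f') = (g \<boxtimes> g') \<cdot> (f \<boxtimes> f')"
    and Unit_in: "\<one> \<in> Obj C"
    and Associator_in: "\<lbrakk>A \<in> Obj C; B \<in> Obj C; D \<in> Obj C\<rbrakk>
      \<Longrightarrow> \<a> A B D \<in> Hom C ((A \<otimes> B) \<otimes> D) (A \<otimes> (B \<otimes> D))"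
    and Associator_iso: "\<lbrakk>A \<in> Obj C; B \<in> Obj C; D \<in> Obj C\<rbrakk> \<Longrightarrow> iso_arr C (\<a> A B D)"
    and Associator_natural:
      "\<lbrakk>f \<in> Hom C A A'; g \<in> Hom C B B'; h \<in> Hom C D D'\<rbrakk>
      \<Longrightarrow> \<a> A' B' D' \<cdot> ((f \<boxtimes> g) \<boxtimes> h) = (f \<boxtimes> (g \<boxtimes> h)) \<cdot> \<a> A B D"
    and LeftUnitor_in: "A \<in> Obj C \<Longrightarrow> \<l> A \<in> Hom C (\<one> \<otimes> A) A"
    and LeftUnitor_iso: "A \<in> Obj C \<Longrightarrow> iso_arr C (\<l> A)"
    and LeftUnitor_natural: "f \<in> Hom C A B \<Longrightarrow> \<l> B \<cdot> (Ident C \<one> \<boxtimes> f) = f \<cdot> \<l> A"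
    and RightUnitor_in: "A \<in> Obj C \<Longrightarrow> \<r> A \<in> Hom C (A \<otimes> \<one>) A"
    and RightUnitor_iso: "A \<in> Obj C \<Longrightarrow> iso_arr C (\<r> A)"
    and RightUnitor_natural: "f \<in> Hom C A B \<Longrightarrow> \<r> B \<cdot> (f \<boxtimes> Ident C \<one>) = f \<cdot> \<r> A"
    and pentagon: "\<lbrakk>A \<in> Obj C; B \<in> Obj C; D \<in> Obj C; E \<in> Obj C\<rbrakk>
      \<Longrightarrow> (Ident C A \<boxtimes> \<a> B D E) \<cdot> \<a> A (B \<otimes> D) E \<cdot> (\<a> A B D \<boxtimes> Ident C E) =
          \<a> A B (D \<otimes> E) \<cdot> \<a> (A \<otimes> B) D E"
    and triangle: "\<lbrakk>A \<in> Obj C; B \<in> Obj C\<rbrakk>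
      \<Longrightarrow> (Ident C A \<boxtimes> \<l> B) \<cdot> \<a> A \<one> B = \<r> A \<boxtimes> Ident C B"

locale symmetric_monoidal_category =
  monoidal_category C for C :: "('o, 'm) smc" (structure) +
  assumes Symmetry_in: "\<lbrakk>A \<in> Obj C; B \<in> Obj C\<rbrakk> \<Longrightarrow> \<s> A B \<in> Hom C (A \<otimes> B) (B \<otimes> A)"
    and Symmetry_natural: "\<lbrakk>f \<in> Hom C A A'; g \<in> Hom C B B'\<rbrakk>
      \<Longrightarrow> \<s> A' B' \<cdot> (f \<boxtimes> g) = (g \<boxtimes> f) \<cdot> \<s> A B"
    and Symmetry_involutive: "\<lbrakk>A \<in> Obj C; B \<in> Obj C\<rbrakk>
      \<Longrightarrow> \<s> B A \<cdot> \<s> A B = Ident C (A \<otimes> B)"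
    and Symmetry_Unit: "A \<in> Obj C \<Longrightarrow> \<l> A \<cdot> \<s> A \<one> = \<r> A"
    and hexagon: "\<lbrakk>A \<in> Obj C; B \<in> Obj C; D \<in> Obj C\<rbrakk>
      \<Longrightarrow> \<a> B D A \<cdot> \<s> A (B \<otimes> D) \<cdot> \<a> A B D =
          (Ident C B \<boxtimes> \<s> A D) \<cdot> \<a> B A D \<cdot> (\<s> A B \<boxtimes> Ident C D)"


section \<open>Duals and compact closure\<close>

text \<open>The two composites \<open>X \<rightarrow> X\<close> and \<open>Y \<rightarrow> Y\<close> associated with
  \<open>\<eta> : \<one> \<rightarrow> X \<otimes> Y\<close> and \<open>\<epsilon> : Y \<otimes> X \<rightarrow> \<one>\<close>.\<close>

definition snake :: "('o, 'm) smc \<Rightarrow> 'o \<Rightarrow> 'o \<Rightarrow> 'm \<Rightarrow> 'm \<Rightarrow> 'm" where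
  "snake C X Y \<eta> \<epsilon> =
     \<r>\<^bsub>C\<^esub> X \<cdot>\<^bsub>C\<^esub> (Ident C X \<boxtimes>\<^bsub>C\<^esub> \<epsilon>) \<cdot>\<^bsub>C\<^esub> \<a>\<^bsub>C\<^esub> X Y X
       \<cdot>\<^bsub>C\<^esub> (\<eta> \<boxtimes>\<^bsub>C\<^esub> Ident C X) \<cdot>\<^bsub>C\<^esub> inv\<^bsub>C\<^esub> (\<l>\<^bsub>C\<^esub> X)"

definition cosnake :: "('o, 'm) smc \<Rightarrow> 'o \<Rightarrow> 'o \<Rightarrow> 'm \<Rightarrow> 'm \<Rightarrow> 'm" where
  "cosnake C X Y \<eta> \<epsilon> =
     \<l>\<^bsub>C\<^esub> Y \<cdot>\<^bsub>C\<^esub> (\<epsilon> \<boxtimes>\<^bsub>C\<^esub> Ident C Y) \<cdot>\<^bsub>C\<^esub> inv\<^bsub>C\<^esub> (\<a>\<^bsub>C\<^esub> Y X Y)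
       \<cdot>\<^bsub>C\<^esub> (Ident C Y \<boxtimes>\<^bsub>C\<^esub> \<eta>) \<cdot>\<^bsub>C\<^esub> inv\<^bsub>C\<^esub> (\<r>\<^bsub>C\<^esub> Y)"

definition monoidal_dual :: "('o, 'm) smc \<Rightarrow> 'o \<Rightarrow> 'o \<Rightarrow> bool" where
  "monoidal_dual C X Y \<longleftrightarrow>
     (\<exists>\<eta> \<epsilon>. \<eta> \<in> Hom C \<one>\<^bsub>C\<^esub> (X \<otimes>\<^bsub>C\<^esub> Y) \<and> \<epsilon> \<in> Hom C (Y \<otimes>\<^bsub>C\<^esub> X) \<one>\<^bsub>C\<^esub> \<and>
        snake C X Y \<eta> \<epsilon> = Ident C X \<and> cosnake C X Y \<eta> \<epsilon> = Ident C Y)"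

locale compact_closed_category =
  symmetric_monoidal_category C for C :: "('o, 'm) smc" (structure) +
  assumes has_dual: "X \<in> Obj C \<Longrightarrow> \<exists>Y \<in> Obj C. monoidal_dual C X Y"


section \<open>Learners\<close>

text \<open>A representative \<open>(P, Q, f, g)\<close> of a learner, before the coend quotient.\<close>

type_synonym ('o, 'm) presentation = "'o \<times> 'o \<times> 'm \<times> 'm"

text \<open>A learner carries its domain and codomain, as these cannot be recovered from the
  (co)domains \<open>P \<otimes> A\<close> and \<open>Q \<otimes> B\<close> of its components.\<close>

type_synonym ('o, 'm) learner =
  "('o \<times> 'o) \<times> ('o \<times> 'o) \<times> ('o, 'm) presentation set"

context
  fixes C :: "('o, 'm) smc" (structure)
begin

definition presentations ::
    "'o \<times> 'o \<Rightarrow> 'o \<times> 'o \<Rightarrow> ('o, 'm) presentation set" where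
  "presentations = (\<lambda>(A, A') (B, B').
     {(P, Q, f, g). P \<in> Obj C \<and> Q \<in> Obj C \<and>
        f \<in> Hom C (P \<otimes> A) (Q \<otimes> B) \<and> g \<in> Hom C (Q \<otimes> B') (P \<otimes> A')})"

inductive learner_eq ::
    "'o \<times> 'o \<Rightarrow> 'o \<times> 'o \<Rightarrow> ('o, 'm) presentation \<Rightarrow> ('o, 'm) presentation \<Rightarrow> bool"
  for X Y where
  slide: "\<lbrakk>X = (A, A'); Y = (B, B');
      A \<in> Obj C; A' \<in> Obj C; B \<in> Obj C; B' \<in> Obj C;
      P \<in> Obj C; P' \<in> Obj C; Q \<in> Obj C; Q' \<in> Obj C;
      p \<in> Hom C P P'; q \<in> Hom C Q Q';
      f \<in> Hom C (P' \<otimes> A) (Q \<otimes> B); g \<in> Hom C (Q' \<otimes> B') (P \<otimes> A')\<rbrakk>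
    \<Longrightarrow> learner_eq X Y
          (P, Q', (q \<boxtimes> Ident C B) \<cdot> f \<cdot> (p \<boxtimes> Ident C A), g)
          (P', Q, f, (p \<boxtimes> Ident C A') \<cdot> g \<cdot> (q \<boxtimes> Ident C B'))"
| refl: "x \<in> presentations X Y \<Longrightarrow> learner_eq X Y x x"
| sym: "learner_eq X Y x y \<Longrightarrow> learner_eq X Y y x"
| trans: "\<lbrakk>learner_eq X Y x y; learner_eq X Y y z\<rbrakk> \<Longrightarrow> learner_eq X Y x z"

definition learner_class ::
    "'o \<times> 'o \<Rightarrow> 'o \<times> 'o \<Rightarrow> ('o, 'm) presentation \<Rightarrow> ('o, 'm) presentation set" where
  "learner_class X Y x = {y. learner_eq X Y x y}"

definition learner_of ::
    "'o \<times> 'o \<Rightarrow> 'o \<times> 'o \<Rightarrow> ('o, 'm) presentation \<Rightarrow> ('o, 'm) learner" where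
  "learner_of X Y x = (X, Y, learner_class X Y x)"

definition learners :: "('o, 'm) learner set" where
  "learners = {learner_of X Y x | X Y x.
     X \<in> Obj C \<times> Obj C \<and> Y \<in> Obj C \<times> Obj C \<and> x \<in> presentations X Y}"

definition learner_id :: "'o \<times> 'o \<Rightarrow> ('o, 'm) learner" where
  "learner_id = (\<lambda>(A, A'). learner_of (A, A') (A, A')
     (\<one>, \<one>, Ident C (\<one> \<otimes> A), Ident C (\<one> \<otimes> A')))"


subsection \<open>Composition\<close>

text \<open>
  For \<open>u : R \<otimes> A \<rightarrow> S \<otimes> B\<close> and \<open>v : T \<otimes> B \<rightarrow> U \<otimes> D\<close>, the arrow
  \<open>(S \<otimes> v) \<cdot> (s \<otimes> B) \<cdot> (T \<otimes> u) : (T \<otimes> R) \<otimes> A \<rightarrow> (S \<otimes> U) \<otimes> D\<close>, with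
  \<open>s : T \<otimes> S \<rightarrow> S \<otimes> T\<close> the symmetry.  Both components of a composite learner have this form.
\<close>

definition param_comp ::
    "'o \<Rightarrow> 'o \<Rightarrow> 'o \<Rightarrow> 'o \<Rightarrow> 'o \<Rightarrow> 'o \<Rightarrow> 'o \<Rightarrow> 'm \<Rightarrow> 'm \<Rightarrow> 'm" where
  "param_comp R S T U A B D u v =
     inv (\<a> S U D) \<cdot> (Ident C S \<boxtimes> v) \<cdot> \<a> S T B \<cdot> (\<s> T S \<boxtimes> Ident C B)
       \<cdot> inv (\<a> T S B) \<cdot> (Ident C T \<boxtimes> u) \<cdot> \<a> T R A"

text \<open>
  In the definitions below, an operation on classes is the union of the classes obtained from all
  representatives, which is the class of any one of them.
\<close>

text \<open>Arguments in applicative order: the second learner comes first.\<close>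

definition learner_comp ::
    "('o, 'm) learner \<Rightarrow> ('o, 'm) learner \<Rightarrow> ('o, 'm) learner" where
  "learner_comp = (\<lambda>(_, (D, D'), c\<^sub>2) ((A, A'), (B, B'), c\<^sub>1).
     ((A, A'), (D, D'),
      \<Union>(P\<^sub>1, Q\<^sub>1, l\<^sub>1, r\<^sub>1) \<in> c\<^sub>1. \<Union>(P\<^sub>2, Q\<^sub>2, l\<^sub>2, r\<^sub>2) \<in> c\<^sub>2.
        learner_class (A, A') (D, D')
          (P\<^sub>2 \<otimes> P\<^sub>1, Q\<^sub>1 \<otimes> Q\<^sub>2,
           param_comp P\<^sub>1 Q\<^sub>1 P\<^sub>2 Q\<^sub>2 A B D l\<^sub>1 l\<^sub>2,
           param_comp Q\<^sub>2 P\<^sub>2 Q\<^sub>1 P\<^sub>1 D' B' A' r\<^sub>2 r\<^sub>1)))"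


subsection \<open>Tensor product\<close>

text \<open>The canonical \<open>(A \<otimes> B) \<otimes> (D \<otimes> E) \<rightarrow> (A \<otimes> D) \<otimes> (B \<otimes> E)\<close>.\<close>

definition interchange :: "'o \<Rightarrow> 'o \<Rightarrow> 'o \<Rightarrow> 'o \<Rightarrow> 'm" where
  "interchange A B D E =
     inv (\<a> A D (B \<otimes> E)) \<cdot> (Ident C A \<boxtimes> \<a> D B E) \<cdot> (Ident C A \<boxtimes> (\<s> B D \<boxtimes> Ident C E))
       \<cdot> (Ident C A \<boxtimes> inv (\<a> B D E)) \<cdot> \<a> A B (D \<otimes> E)"

text \<open>
  For \<open>u : R \<otimes> A \<rightarrow> S \<otimes> B\<close> and \<open>v : T \<otimes> D \<rightarrow> U \<otimes> E\<close>, the arrow \<open>u \<otimes> v\<close> with its factors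
  permuted to \<open>(R \<otimes> T) \<otimes> (A \<otimes> D) \<rightarrow> (U \<otimes> S) \<otimes> (B \<otimes> E)\<close>.
\<close>

definition param_tensor ::
    "'o \<Rightarrow> 'o \<Rightarrow> 'o \<Rightarrow> 'o \<Rightarrow> 'o \<Rightarrow> 'o \<Rightarrow> 'o \<Rightarrow> 'o \<Rightarrow> 'm \<Rightarrow> 'm \<Rightarrow> 'm" where
  "param_tensor R S T U A B D E u v =
     (\<s> S U \<boxtimes> Ident C (B \<otimes> E)) \<cdot> interchange S B U E \<cdot> (u \<boxtimes> v) \<cdot> interchange R T A D"

definition learner_tensor_obj :: "'o \<times> 'o \<Rightarrow> 'o \<times> 'o \<Rightarrow> 'o \<times> 'o" where
  "learner_tensor_obj = (\<lambda>(A, A') (B, B'). (A \<otimes> B, B' \<otimes> A'))"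

definition learner_tensor ::
    "('o, 'm) learner \<Rightarrow> ('o, 'm) learner \<Rightarrow> ('o, 'm) learner" where
  "learner_tensor = (\<lambda>((A, A'), (B, B'), c) ((D, D'), (E, E'), d).
     (let X = learner_tensor_obj (A, A') (D, D'); Y = learner_tensor_obj (B, B') (E, E') in
      (X, Y,
       \<Union>(P\<^sub>L, Q\<^sub>L, l\<^sub>L, r\<^sub>L) \<in> c. \<Union>(P\<^sub>R, Q\<^sub>R, l\<^sub>R, r\<^sub>R) \<in> d.
         learner_class X Y
           (P\<^sub>L \<otimes> P\<^sub>R, Q\<^sub>R \<otimes> Q\<^sub>L,
            param_tensor P\<^sub>L Q\<^sub>L P\<^sub>R Q\<^sub>R A B D E l\<^sub>L l\<^sub>R,
            param_tensor Q\<^sub>R P\<^sub>R Q\<^sub>L P\<^sub>L E' D' B' A' r\<^sub>R r\<^sub>L))))"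


subsection \<open>The symmetric monoidal category of learners\<close>

text \<open>The action on arrows of \<open>\<iota> : C \<times> C\<^sup>o\<^sup>p \<rightarrow> Learn\<close>, for \<open>f : A \<rightarrow> B\<close> and
  \<open>g : B' \<rightarrow> A'\<close>.\<close>

definition learner_iota :: "'m \<Rightarrow> 'm \<Rightarrow> ('o, 'm) learner" where
  "learner_iota f g = learner_of (Dom C f, Cod C g) (Cod C f, Dom C g)
     (\<one>, \<one>, Ident C \<one> \<boxtimes> f, Ident C \<one> \<boxtimes> g)"

text \<open>As the tensor is reversed in the second factor, the second component of the associator is
  again an associator, and the left and right unitors are interchanged.\<close>

definition Learn :: "('o \<times> 'o, ('o, 'm) learner) smc" where
  "Learn =
     \<lparr>Obj = Obj C \<times> Obj C,
      Arr = learners,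
      Dom = (\<lambda>(X, _, _). X),
      Cod = (\<lambda>(_, Y, _). Y),
      Ident = learner_id,
      Comp = learner_comp,
      TensorObj = learner_tensor_obj,
      TensorArr = learner_tensor,
      Unit = (\<one>, \<one>),
      Associator = (\<lambda>(A, A') (B, B') (D, D'). learner_iota (\<a> A B D) (\<a> D' B' A')),
      LeftUnitor = (\<lambda>(A, A'). learner_iota (\<l> A) (inv (\<r> A'))),
      RightUnitor = (\<lambda>(A, A'). learner_iota (\<r> A) (inv (\<l> A'))),
      Symmetry = (\<lambda>(A, A') (B, B'). learner_iota (\<s> A B) (\<s> A' B'))\<rparr>"

definition learner_dual :: "'o \<times> 'o \<Rightarrow> 'o \<times> 'o" where
  "learner_dual = (\<lambda>(A, A'). (A', A))"

definition learner_cup :: "'o \<times> 'o \<Rightarrow> ('o, 'm) learner" where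
  "learner_cup = (\<lambda>(A, A'). learner_of (\<one>, \<one>) (A \<otimes> A', A \<otimes> A')
     (A \<otimes> A', \<one>,
      inv (\<l> (A \<otimes> A')) \<cdot> \<r> (A \<otimes> A'),
      inv (\<r> (A \<otimes> A')) \<cdot> \<l> (A \<otimes> A')))"

definition learner_cap :: "'o \<times> 'o \<Rightarrow> ('o, 'm) learner" where
  "learner_cap = (\<lambda>(A, A'). learner_of (A' \<otimes> A, A' \<otimes> A) (\<one>, \<one>)
     (\<one>, A' \<otimes> A,
      inv (\<r> (A' \<otimes> A)) \<cdot> \<l> (A' \<otimes> A),
      inv (\<l> (A' \<otimes> A)) \<cdot> \<r> (A' \<otimes> A)))"

end


section \<open>Atemporal learners\<close>

text \<open>The smallest monoidal congruence identifying all snakes with identities.\<close>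

inductive atemporal_eq ::
    "('o, 'm) smc \<Rightarrow> ('o, 'm) learner \<Rightarrow> ('o, 'm) learner \<Rightarrow> bool"
  for C where
  snake: "X \<in> Obj (Learn C) \<Longrightarrow> atemporal_eq C
    (snake (Learn C) X (learner_dual X) (learner_cup C X) (learner_cap C X))
    (Ident (Learn C) X)"
| refl: "\<phi> \<in> Arr (Learn C) \<Longrightarrow> atemporal_eq C \<phi> \<phi>"
| sym: "atemporal_eq C \<phi> \<psi> \<Longrightarrow> atemporal_eq C \<psi> \<phi>"
| trans: "\<lbrakk>atemporal_eq C \<phi> \<psi>; atemporal_eq C \<psi> \<chi>\<rbrakk> \<Longrightarrow> atemporal_eq C \<phi> \<chi>"
| comp: "\<lbrakk>atemporal_eq C \<phi> \<phi>'; atemporal_eq C \<psi> \<psi>'; Dom (Learn C) \<psi> = Cod (Learn C) \<phi>\<rbrakk>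
    \<Longrightarrow> atemporal_eq C (\<psi> \<cdot>\<^bsub>Learn C\<^esub> \<phi>) (\<psi>' \<cdot>\<^bsub>Learn C\<^esub> \<phi>')"
| tensor: "\<lbrakk>atemporal_eq C \<phi> \<phi>'; atemporal_eq C \<psi> \<psi>'\<rbrakk>
    \<Longrightarrow> atemporal_eq C (\<phi> \<boxtimes>\<^bsub>Learn C\<^esub> \<psi>) (\<phi>' \<boxtimes>\<^bsub>Learn C\<^esub> \<psi>')"

text \<open>
  The quotient of \<open>D\<close> by a relation on parallel arrows that is a congruence for composition and
  tensor. All members of a class have the same domain and codomain.
\<close>

definition quotient_smc :: "('o, 'm) smc \<Rightarrow> ('m \<Rightarrow> 'm \<Rightarrow> bool) \<Rightarrow> ('o, 'm set) smc" where
  "quotient_smc D E =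
     \<lparr>Obj = Obj D,
      Arr = Arr D // {(f, g). E f g},
      Dom = (\<lambda>F. the_elem (Dom D ` F)),
      Cod = (\<lambda>F. the_elem (Cod D ` F)),
      Ident = (\<lambda>A. Collect (E (Ident D A))),
      Comp = (\<lambda>G F. \<Union>g \<in> G. \<Union>f \<in> F. Collect (E (g \<cdot>\<^bsub>D\<^esub> f))),
      TensorObj = TensorObj D,
      TensorArr = (\<lambda>F G. \<Union>f \<in> F. \<Union>g \<in> G. Collect (E (f \<boxtimes>\<^bsub>D\<^esub> g))),
      Unit = Unit D,
      Associator = (\<lambda>A B F. Collect (E (\<a>\<^bsub>D\<^esub> A B F))),
      LeftUnitor = (\<lambda>A. Collect (E (\<l>\<^bsub>D\<^esub> A))),
      RightUnitor = (\<lambda>A. Collect (E (\<r>\<^bsub>D\<^esub> A))),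
      Symmetry = (\<lambda>A B. Collect (E (\<s>\<^bsub>D\<^esub> A B)))\<rparr>"

definition Atemp :: "('o, 'm) smc \<Rightarrow> ('o \<times> 'o, ('o, 'm) learner set) smc" where
  "Atemp C = quotient_smc (Learn C) (atemporal_eq C)"

end

theory Submission
  imports Defs
begin

text \<open>
  Only one of the two equations of a duality between \<open>X\<close> and \<open>X\<^sup>*\<close> has been imposed on atemporal
  learners, the one for the snake of \<open>\<eta>\<^sub>X\<close> and \<open>\<epsilon>\<^sub>X\<close>, but it has been imposed for all objects, hence also for
  \<open>X\<^sup>*\<close>. This is enough. Since the parameters of a learner may be slid along the symmetry of \<open>C\<close>, the
  cup and the cap of \<open>X\<^sup>*\<close> are the cup and the cap of \<open>X\<close> followed, respectively preceded, by the symmetry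
  of \<open>X\<close> and \<open>X\<^sup>*\<close> (\<open>learner_cup_dual\<close>, \<open>learner_cap_dual\<close>). In every symmetric monoidal category such a
  twist turns the cosnake of a cup and a cap into the snake of the twisted ones (\<open>cosnake_eq_snake\<close>). So the
  cosnake of \<open>X\<close> is, already in the category of learners, the snake of \<open>X\<^sup>*\<close>, which is identified with the
  identity of \<open>X\<^sup>*\<close>.

  What takes space is that learners form a symmetric monoidal category, in the presence of associators
  and unitors. Three ideas keep this manageable.

  The two components of a learner are maps of the same form \<open>u : R \<otimes> A \<rightarrow> S \<otimes> B\<close>, with parameters
  \<open>R\<close> and \<open>S\<close>, and all operations treat them alike, with the order of composition and the order of the
  tensor factors reversed. A law of learners is therefore one equation between parametrised maps,
  used twice. It has to hold only up to isomorphisms of the parameters, because the relation that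
  defines learners absorbs those (\<open>learner_eq_iso\<close>).

  For these equations, composition is written with right-nested tensor products and the exchange
  \<open>A \<otimes> (B \<otimes> D) \<rightarrow> B \<otimes> (A \<otimes> D)\<close> of two leading factors. The hexagon then enters mainly
  through the rules by which exchanges pass associators (\<open>exch_assoc_left\<close>, \<open>exch_assoc_right\<close>,
  \<open>exch_whisker\<close>), and composition is associative because an exchange can be moved past a map
  (\<open>param_comp_assoc\<close>).

  Finally, the tensor product is not treated directly. It is the composite of a right whiskering and
  a left whiskering, and left whiskering is right whiskering conjugated by symmetries. As the
  structure isomorphisms come from the symmetric monoidal category \<open>C \<times> C\<^sup>o\<^sup>p\<close> by an identity-on-objects
  functor, all axioms about the tensor product follow from functoriality, naturality, associativity
  and the unit law of right whiskering, together with the commutation of left and right whiskering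
  (locale \<open>central_action\<close>). For learners that commutation is \<open>param_interchange\<close>.
\<close>

section \<open>Categories and isomorphisms\<close>

lemma Hom_iff [simp]: "f \<in> Hom C A B \<longleftrightarrow> f \<in> Arr C \<and> Dom C f = A \<and> Cod C f = B"
  by (simp add: Hom_def)

context category
begin

lemma Ident_simps [simp]:
  assumes "A \<in> Obj C"
  shows "Ident C A \<in> Arr C" "Dom C (Ident C A) = A" "Cod C (Ident C A) = A"
  using Ident_in[OF assms] by simp_all

lemma Comp_simps [simp]:
  assumes "f \<in> Arr C" "g \<in> Arr C" "Dom C g = Cod C f"
  shows "g \<cdot> f \<in> Arr C" "Dom C (g \<cdot> f) = Dom C f" "Cod C (g \<cdot> f) = Cod C g"
  using Comp_in[of f "Dom C f" "Cod C f" g "Cod C g"] assms by simp_all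

lemma Comp_assoc' [simp]:
  assumes "f \<in> Arr C" "g \<in> Arr C" "h \<in> Arr C" "Dom C g = Cod C f" "Dom C h = Cod C g"
  shows "(h \<cdot> g) \<cdot> f = h \<cdot> (g \<cdot> f)"
  using Comp_assoc[of f "Dom C f" "Cod C f" g "Cod C g" h "Cod C h"] assms by simp

lemma Comp_Ident' [simp]: "\<lbrakk>f \<in> Arr C; Dom C f = A\<rbrakk> \<Longrightarrow> f \<cdot> Ident C A = f"
  using Comp_Ident[of f A "Cod C f"] by simp

lemma Ident_Comp' [simp]: "\<lbrakk>f \<in> Arr C; Cod C f = A\<rbrakk> \<Longrightarrow> Ident C A \<cdot> f = f"
  using Ident_Comp[of f "Dom C f" A] by simp

text \<open>Composites are kept nested to the right. An equation about \<open>g \<cdot> f\<close> then applies at the front of a longer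
  composite only in this form.\<close>

lemma Comp_rewrite:
  assumes "g \<cdot> f = k" "f \<in> Arr C" "g \<in> Arr C" "Dom C g = Cod C f" "x \<in> Arr C" "Cod C x = Dom C f"
  shows "g \<cdot> (f \<cdot> x) = k \<cdot> x"
  using assms Comp_assoc'[of x f g] by simp

lemma inverse_arrs_unique:
  assumes "inverse_arrs C f g" "inverse_arrs C f h"
  shows "g = h"
proof -
  have "g = g \<cdot> (f \<cdot> h)" using assms by (simp add: inverse_arrs_def)
  also have "\<dots> = (g \<cdot> f) \<cdot> h"
    using assms by (subst Comp_assoc') (auto simp: inverse_arrs_def)
  also have "\<dots> = h" using assms by (simp add: inverse_arrs_def)
  finally show ?thesis .
qed

lemma inv_eqI: "inverse_arrs C f g \<Longrightarrow> inv f = g"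
  unfolding inverse_arr_def by (blast intro: the_equality inverse_arrs_unique)

lemma inverse_arrs_inv: "iso_arr C f \<Longrightarrow> inverse_arrs C f (inv f)"
  unfolding iso_arr_def using inv_eqI by auto

lemma iso_arr_Arr: "iso_arr C f \<Longrightarrow> f \<in> Arr C"
  by (auto simp: iso_arr_def inverse_arrs_def)

lemma inv_simps [simp]:
  assumes "iso_arr C f"
  shows "inv f \<in> Arr C" "Dom C (inv f) = Cod C f" "Cod C (inv f) = Dom C f"
    "inv f \<cdot> f = Ident C (Dom C f)" "f \<cdot> inv f = Ident C (Cod C f)"
  using inverse_arrs_inv[OF assms] by (auto simp: inverse_arrs_def)

lemma inv_cancel [simp]:
  assumes "iso_arr C f" "x \<in> Arr C"
  shows "Cod C x = Dom C f \<Longrightarrow> inv f \<cdot> (f \<cdot> x) = x"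
    and "Cod C x = Cod C f \<Longrightarrow> f \<cdot> (inv f \<cdot> x) = x"
  using Comp_rewrite[of "inv f" f _ x, OF HOL.refl] Comp_rewrite[of f "inv f" _ x, OF HOL.refl] assms iso_arr_Arr[of f] by simp_all

lemma inverse_arrs_sym: "inverse_arrs C f g \<Longrightarrow> inverse_arrs C g f"
  by (auto simp: inverse_arrs_def)

lemma iso_arr_inv [simp]: "iso_arr C f \<Longrightarrow> iso_arr C (inv f)"
  using inverse_arrs_sym[OF inverse_arrs_inv[of f]] by (auto simp: iso_arr_def simp del: inv_simps)

lemma inv_inv [simp]: "iso_arr C f \<Longrightarrow> inv (inv f) = f"
  by (rule inv_eqI[OF inverse_arrs_sym[OF inverse_arrs_inv]])

lemma iso_arr_Ident [simp]: "A \<in> Obj C \<Longrightarrow> iso_arr C (Ident C A)"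
  unfolding iso_arr_def inverse_arrs_def by (rule exI[of _ "Ident C A"]) simp

lemma inv_Ident [simp]: "A \<in> Obj C \<Longrightarrow> inv (Ident C A) = Ident C A"
  by (rule inv_eqI) (simp add: inverse_arrs_def)

lemma iso_epi:
  assumes "f \<cdot> h = g \<cdot> h" "iso_arr C h" "f \<in> Arr C" "g \<in> Arr C" "Dom C f = Cod C h" "Dom C g = Cod C h"
  shows "f = g"
proof -
  have "f = (f \<cdot> h) \<cdot> inv h" using assms(2-) iso_arr_Arr[of h] by simp
  also have "\<dots> = g" unfolding assms(1) using assms(2-) iso_arr_Arr[of h] by simp
  finally show ?thesis .
qed

lemma iso_mono:
  assumes "h \<cdot> f = h \<cdot> g" "iso_arr C h" "f \<in> Arr C" "g \<in> Arr C" "Cod C f = Dom C h" "Cod C g = Dom C h"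
  shows "f = g"
proof -
  have "f = inv h \<cdot> (h \<cdot> f)" using assms(2-) by simp
  also have "\<dots> = g" unfolding assms(1) using assms(2-) by simp
  finally show ?thesis .
qed

lemma iso_arr_Comp [simp]:
  assumes "iso_arr C f" "iso_arr C g" "Dom C g = Cod C f"
  shows "iso_arr C (g \<cdot> f)" "inv (g \<cdot> f) = inv f \<cdot> inv g"
proof -
  have "inverse_arrs C (g \<cdot> f) (inv f \<cdot> inv g)"
    using assms iso_arr_Arr[of f] iso_arr_Arr[of g] by (simp add: inverse_arrs_def)
  then show "iso_arr C (g \<cdot> f)" "inv (g \<cdot> f) = inv f \<cdot> inv g"
    by (auto simp: iso_arr_def inv_eqI)
qed

end

section \<open>Monoidal categories\<close>

context monoidal_category
begin

abbreviation whisker_left (infixr "\<lhd>" 72) where "A \<lhd> f \<equiv> Ident C A \<boxtimes> f"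

abbreviation whisker_right (infixl "\<rhd>" 71) where "f \<rhd> A \<equiv> f \<boxtimes> Ident C A"

declare TensorObj_in [simp] Unit_in [simp] Associator_iso [simp] LeftUnitor_iso [simp]
  RightUnitor_iso [simp]

lemma TensorArr_simps [simp]:
  assumes "f \<in> Arr C" "g \<in> Arr C"
  shows "f \<boxtimes> g \<in> Arr C" "Dom C (f \<boxtimes> g) = Dom C f \<otimes> Dom C g"
    "Cod C (f \<boxtimes> g) = Cod C f \<otimes> Cod C g"
  using TensorArr_in[of f "Dom C f" "Cod C f" g "Dom C g" "Cod C g"] assms by simp_all

lemma Associator_simps [simp]:
  assumes "A \<in> Obj C" "B \<in> Obj C" "D \<in> Obj C"
  shows "\<a> A B D \<in> Arr C" "Dom C (\<a> A B D) = (A \<otimes> B) \<otimes> D"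
    "Cod C (\<a> A B D) = A \<otimes> (B \<otimes> D)"
  using Associator_in[OF assms] by simp_all

lemma Unitor_simps [simp]:
  assumes "A \<in> Obj C"
  shows "\<l> A \<in> Arr C" "Dom C (\<l> A) = \<one> \<otimes> A" "Cod C (\<l> A) = A"
    "\<r> A \<in> Arr C" "Dom C (\<r> A) = A \<otimes> \<one>" "Cod C (\<r> A) = A"
  using LeftUnitor_in[OF assms] RightUnitor_in[OF assms] by simp_all

lemma TensorArr_Ident' [simp]:
  "\<lbrakk>A \<in> Obj C; B \<in> Obj C\<rbrakk> \<Longrightarrow> A \<lhd> Ident C B = Ident C (A \<otimes> B)"
  by (rule TensorArr_Ident)

lemma Tensor_Comp:
  assumes "f \<in> Arr C" "g \<in> Arr C" "Dom C g = Cod C f"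
    "f' \<in> Arr C" "g' \<in> Arr C" "Dom C g' = Cod C f'"
  shows "(g \<boxtimes> g') \<cdot> (f \<boxtimes> f') = (g \<cdot> f) \<boxtimes> (g' \<cdot> f')"
  using TensorArr_Comp[of f "Dom C f" "Cod C f" g "Cod C g" f' "Dom C f'" "Cod C f'" g' "Cod C g'"]
    assms by simp

lemma Tensor_Comp_assoc:
  assumes "f \<in> Arr C" "g \<in> Arr C" "Dom C g = Cod C f"
    "f' \<in> Arr C" "g' \<in> Arr C" "Dom C g' = Cod C f'"
    "x \<in> Arr C" "Cod C x = Dom C f \<otimes> Dom C f'"
  shows "(g \<boxtimes> g') \<cdot> (f \<boxtimes> f') \<cdot> x = ((g \<cdot> f) \<boxtimes> (g' \<cdot> f')) \<cdot> x"
  using assms by (simp add: Comp_rewrite[OF Tensor_Comp])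

lemma whisker_left_Comp [simp]:
  assumes "A \<in> Obj C" "f \<in> Arr C" "g \<in> Arr C" "Dom C g = Cod C f"
  shows "A \<lhd> (g \<cdot> f) = (A \<lhd> g) \<cdot> (A \<lhd> f)"
  using assms by (simp add: Tensor_Comp)

lemma whisker_right_Comp [simp]:
  assumes "A \<in> Obj C" "f \<in> Arr C" "g \<in> Arr C" "Dom C g = Cod C f"
  shows "(g \<cdot> f) \<rhd> A = (g \<rhd> A) \<cdot> (f \<rhd> A)"
  using assms by (simp add: Tensor_Comp)

lemma iso_arr_Tensor [simp]:
  assumes "iso_arr C f" "iso_arr C g"
  shows "iso_arr C (f \<boxtimes> g)" "inv (f \<boxtimes> g) = inv f \<boxtimes> inv g"
proof -
  have "inverse_arrs C (f \<boxtimes> g) (inv f \<boxtimes> inv g)"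
    using assms iso_arr_Arr[of f] iso_arr_Arr[of g] by (simp add: inverse_arrs_def Tensor_Comp)
  then show "iso_arr C (f \<boxtimes> g)" "inv (f \<boxtimes> g) = inv f \<boxtimes> inv g"
    by (auto simp: iso_arr_def inv_eqI)
qed

lemma whisker_inv [simp]:
  assumes "iso_arr C f" "A \<in> Obj C"
  shows "(A \<lhd> inv f) \<cdot> (A \<lhd> f) = Ident C (A \<otimes> Dom C f)"
    "(A \<lhd> f) \<cdot> (A \<lhd> inv f) = Ident C (A \<otimes> Cod C f)"
    "(inv f \<rhd> A) \<cdot> (f \<rhd> A) = Ident C (Dom C f \<otimes> A)"
    "(f \<rhd> A) \<cdot> (inv f \<rhd> A) = Ident C (Cod C f \<otimes> A)"
  using assms iso_arr_Arr[of f] by (simp_all add: Tensor_Comp)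

lemma whisker_inv_assoc [simp]:
  assumes "iso_arr C f" "A \<in> Obj C" "x \<in> Arr C"
  shows "Cod C x = A \<otimes> Dom C f \<Longrightarrow> (A \<lhd> inv f) \<cdot> (A \<lhd> f) \<cdot> x = x"
    "Cod C x = A \<otimes> Cod C f \<Longrightarrow> (A \<lhd> f) \<cdot> (A \<lhd> inv f) \<cdot> x = x"
    "Cod C x = Dom C f \<otimes> A \<Longrightarrow> (inv f \<rhd> A) \<cdot> (f \<rhd> A) \<cdot> x = x"
    "Cod C x = Cod C f \<otimes> A \<Longrightarrow> (f \<rhd> A) \<cdot> (inv f \<rhd> A) \<cdot> x = x"
  using assms iso_arr_Arr[of f] by (simp_all add: Tensor_Comp_assoc)

lemma Associator_natural':
  assumes "f \<in> Arr C" "g \<in> Arr C" "h \<in> Arr C" "Cod C f = A" "Cod C g = B" "Cod C h = D"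
  shows "\<a> A B D \<cdot> ((f \<boxtimes> g) \<boxtimes> h) = (f \<boxtimes> (g \<boxtimes> h)) \<cdot> \<a> (Dom C f) (Dom C g) (Dom C h)"
  using Associator_natural[of f "Dom C f" A g "Dom C g" B h "Dom C h" D] assms by simp

lemma Associator_natural_inv:
  assumes "f \<in> Arr C" "g \<in> Arr C" "h \<in> Arr C" "Cod C f = A" "Cod C g = B" "Cod C h = D"
  shows "inv (\<a> A B D) \<cdot> (f \<boxtimes> (g \<boxtimes> h)) = ((f \<boxtimes> g) \<boxtimes> h) \<cdot> inv (\<a> (Dom C f) (Dom C g) (Dom C h))"
proof -
  have [simp]: "A \<in> Obj C" "B \<in> Obj C" "D \<in> Obj C" using assms by auto
  have "inv (\<a> A B D) \<cdot> (\<a> A B D \<cdot> ((f \<boxtimes> g) \<boxtimes> h)) \<cdot> inv (\<a> (Dom C f) (Dom C g) (Dom C h)) =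
    inv (\<a> A B D) \<cdot> ((f \<boxtimes> (g \<boxtimes> h)) \<cdot> \<a> (Dom C f) (Dom C g) (Dom C h)) \<cdot> inv (\<a> (Dom C f) (Dom C g) (Dom C h))"
    by (simp only: Associator_natural' assms)
  then show ?thesis using assms by simp
qed

lemmas assoc_nat = Associator_natural' Comp_rewrite[OF Associator_natural']

lemmas assoc_nat_inv = Associator_natural_inv Comp_rewrite[OF Associator_natural_inv]

lemma pentagon_assoc:
  assumes "A \<in> Obj C" "B \<in> Obj C" "D \<in> Obj C" "E \<in> Obj C" "x \<in> Arr C"
    "Cod C x = ((A \<otimes> B) \<otimes> D) \<otimes> E"
  shows "(A \<lhd> \<a> B D E) \<cdot> \<a> A (B \<otimes> D) E \<cdot> (\<a> A B D \<rhd> E) \<cdot> x =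
    \<a> A B (D \<otimes> E) \<cdot> \<a> (A \<otimes> B) D E \<cdot> x"
proof -
  have "((A \<lhd> \<a> B D E) \<cdot> \<a> A (B \<otimes> D) E \<cdot> (\<a> A B D \<rhd> E)) \<cdot> x =
    (\<a> A B (D \<otimes> E) \<cdot> \<a> (A \<otimes> B) D E) \<cdot> x"
    using assms by (simp only: pentagon)
  then show ?thesis using assms by simp
qed

lemma triangle_assoc:
  assumes "A \<in> Obj C" "B \<in> Obj C" "x \<in> Arr C" "Cod C x = (A \<otimes> \<one>) \<otimes> B"
  shows "(A \<lhd> \<l> B) \<cdot> \<a> A \<one> B \<cdot> x = (\<r> A \<rhd> B) \<cdot> x"
  by (rule Comp_rewrite[OF triangle]) (use assms in simp_all)

lemma unitor_natural:
  assumes "f \<in> Arr C" "Cod C f = B"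
  shows "\<l> B \<cdot> (\<one> \<lhd> f) = f \<cdot> \<l> (Dom C f)" "\<r> B \<cdot> (f \<rhd> \<one>) = f \<cdot> \<r> (Dom C f)"
  using assms LeftUnitor_natural[of f "Dom C f" B] RightUnitor_natural[of f "Dom C f" B] by simp_all

lemmas unitor_nat = unitor_natural Comp_rewrite[OF unitor_natural(1)] Comp_rewrite[OF unitor_natural(2)]

text \<open>Whiskering with the unit is isomorphic to the identity functor, by the unitors.\<close>

lemma unit_whisker_faithful:
  assumes "f \<in> Arr C" "g \<in> Arr C" "Dom C f = Dom C g" "Cod C f = Cod C g"
  shows "\<one> \<lhd> f = \<one> \<lhd> g \<Longrightarrow> f = g" "f \<rhd> \<one> = g \<rhd> \<one> \<Longrightarrow> f = g"
proof -
  assume "\<one> \<lhd> f = \<one> \<lhd> g"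
  then have "f \<cdot> \<l> (Dom C f) = g \<cdot> \<l> (Dom C f)"
    using unitor_natural(1)[of f] unitor_natural(1)[of g] assms by simp
  then show "f = g" by (rule iso_epi) (use assms in simp_all)
next
  assume "f \<rhd> \<one> = g \<rhd> \<one>"
  then have "f \<cdot> \<r> (Dom C f) = g \<cdot> \<r> (Dom C f)"
    using unitor_natural(2)[of f] unitor_natural(2)[of g] assms by simp
  then show "f = g" by (rule iso_epi) (use assms in simp_all)
qed

text \<open>Kelly's consequence of the pentagon and triangle axioms: after whiskering with the unit on the left, the
  two sides are compared by one pentagon and two triangles.\<close>

lemma LeftUnitor_Tensor:
  assumes [simp]: "A \<in> Obj C" "B \<in> Obj C"
  shows "\<l> (A \<otimes> B) \<cdot> \<a> \<one> A B = \<l> A \<rhd> B"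
proof (rule unit_whisker_faithful(1))
  let ?h = "\<a> \<one> (\<one> \<otimes> A) B \<cdot> (\<a> \<one> \<one> A \<rhd> B)"
  show "\<one> \<lhd> (\<l> (A \<otimes> B) \<cdot> \<a> \<one> A B) = \<one> \<lhd> (\<l> A \<rhd> B)"
  proof (rule iso_epi)
    have "(\<one> \<lhd> (\<l> (A \<otimes> B) \<cdot> \<a> \<one> A B)) \<cdot> ?h = (\<r> \<one> \<rhd> (A \<otimes> B)) \<cdot> \<a> (\<one> \<otimes> \<one>) A B"
      by (simp add: pentagon triangle_assoc)
    also have "\<dots> = \<a> \<one> A B \<cdot> ((\<r> \<one> \<rhd> A) \<rhd> B)"
      by (simp add: assoc_nat)
    also have "\<dots> = \<a> \<one> A B \<cdot> ((\<one> \<lhd> \<l> A) \<rhd> B) \<cdot> (\<a> \<one> \<one> A \<rhd> B)"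
      by (simp flip: triangle)
    also have "\<dots> = (\<one> \<lhd> (\<l> A \<rhd> B)) \<cdot> ?h"
      by (simp add: assoc_nat)
    finally show "(\<one> \<lhd> (\<l> (A \<otimes> B) \<cdot> \<a> \<one> A B)) \<cdot> ?h = (\<one> \<lhd> (\<l> A \<rhd> B)) \<cdot> ?h" .
  qed simp_all
qed simp_all

text \<open>The mirror image of the previous lemma, by whiskering with the unit on the right.\<close>

lemma RightUnitor_Tensor:
  assumes [simp]: "A \<in> Obj C" "B \<in> Obj C"
  shows "(A \<lhd> \<r> B) \<cdot> \<a> A B \<one> = \<r> (A \<otimes> B)"
proof (rule unit_whisker_faithful(2))
  show "((A \<lhd> \<r> B) \<cdot> \<a> A B \<one>) \<rhd> \<one> = \<r> (A \<otimes> B) \<rhd> \<one>"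
  proof (rule iso_mono)
    have "\<a> A B \<one> \<cdot> (((A \<lhd> \<r> B) \<cdot> \<a> A B \<one>) \<rhd> \<one>) =
        (A \<lhd> (\<r> B \<rhd> \<one>)) \<cdot> \<a> A (B \<otimes> \<one>) \<one> \<cdot> (\<a> A B \<one> \<rhd> \<one>)"
      by (simp add: assoc_nat)
    also have "\<dots> = (A \<lhd> (B \<lhd> \<l> \<one>)) \<cdot> (A \<lhd> \<a> B \<one> \<one>) \<cdot> \<a> A (B \<otimes> \<one>) \<one> \<cdot> (\<a> A B \<one> \<rhd> \<one>)"
      by (simp flip: triangle)
    also have "\<dots> = (A \<lhd> (B \<lhd> \<l> \<one>)) \<cdot> \<a> A B (\<one> \<otimes> \<one>) \<cdot> \<a> (A \<otimes> B) \<one> \<one>"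
      by (simp add: pentagon)
    also have "\<dots> = \<a> A B \<one> \<cdot> ((A \<otimes> B) \<lhd> \<l> \<one>) \<cdot> \<a> (A \<otimes> B) \<one> \<one>"
      using assoc_nat(2)[of "Ident C A" "Ident C B" "\<l> \<one>" A B \<one>] by simp
    also have "\<dots> = \<a> A B \<one> \<cdot> (\<r> (A \<otimes> B) \<rhd> \<one>)"
      by (simp add: triangle)
    finally show "\<a> A B \<one> \<cdot> (((A \<lhd> \<r> B) \<cdot> \<a> A B \<one>) \<rhd> \<one>) = \<a> A B \<one> \<cdot> (\<r> (A \<otimes> B) \<rhd> \<one>)" .
  qed simp_all
qed simp_all

lemma Associator_natural_Ident:
  assumes "A \<in> Obj C" "B \<in> Obj C" "h \<in> Arr C" "Cod C h = D"
  shows "\<a> A B D \<cdot> ((A \<otimes> B) \<lhd> h) = (A \<lhd> (B \<lhd> h)) \<cdot> \<a> A B (Dom C h)"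
    and "inv (\<a> A B D) \<cdot> (A \<lhd> (B \<lhd> h)) = ((A \<otimes> B) \<lhd> h) \<cdot> inv (\<a> A B (Dom C h))"
    and "\<a> D A B \<cdot> ((h \<rhd> A) \<rhd> B) = (h \<rhd> (A \<otimes> B)) \<cdot> \<a> (Dom C h) A B"
    and "inv (\<a> D A B) \<cdot> (h \<rhd> (A \<otimes> B)) = ((h \<rhd> A) \<rhd> B) \<cdot> inv (\<a> (Dom C h) A B)"
  using assms Associator_natural'[of "Ident C A" "Ident C B" h A B D]
    Associator_natural_inv[of "Ident C A" "Ident C B" h A B D]
    Associator_natural'[of h "Ident C A" "Ident C B" D A B]
    Associator_natural_inv[of h "Ident C A" "Ident C B" D A B] by simp_all

lemmas assoc_nat_Ident = Associator_natural_Ident(1,3) Comp_rewrite[OF Associator_natural_Ident(1)]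
  Comp_rewrite[OF Associator_natural_Ident(3)]

lemmas assoc_nat_inv_Ident = Associator_natural_Ident(2,4) Comp_rewrite[OF Associator_natural_Ident(2)]
  Comp_rewrite[OF Associator_natural_Ident(4)]

lemma pentagon_inv:
  assumes [simp]: "A \<in> Obj C" "B \<in> Obj C" "D \<in> Obj C" "E \<in> Obj C"
  shows "(inv (\<a> A B D) \<rhd> E) \<cdot> inv (\<a> A (B \<otimes> D) E) \<cdot> (A \<lhd> inv (\<a> B D E)) =
    inv (\<a> (A \<otimes> B) D E) \<cdot> inv (\<a> A B (D \<otimes> E))"
proof -
  have "inv ((A \<lhd> \<a> B D E) \<cdot> \<a> A (B \<otimes> D) E \<cdot> (\<a> A B D \<rhd> E)) = inv (\<a> A B (D \<otimes> E) \<cdot> \<a> (A \<otimes> B) D E)"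
    by (simp only: pentagon assms)
  then show ?thesis by simp
qed

lemma pentagon_inv_assoc:
  assumes "A \<in> Obj C" "B \<in> Obj C" "D \<in> Obj C" "E \<in> Obj C" "x \<in> Arr C"
    "Cod C x = A \<otimes> (B \<otimes> (D \<otimes> E))"
  shows "(inv (\<a> A B D) \<rhd> E) \<cdot> inv (\<a> A (B \<otimes> D) E) \<cdot> (A \<lhd> inv (\<a> B D E)) \<cdot> x =
    inv (\<a> (A \<otimes> B) D E) \<cdot> inv (\<a> A B (D \<otimes> E)) \<cdot> x"
proof -
  have "((inv (\<a> A B D) \<rhd> E) \<cdot> inv (\<a> A (B \<otimes> D) E) \<cdot> (A \<lhd> inv (\<a> B D E))) \<cdot> x =
      (inv (\<a> (A \<otimes> B) D E) \<cdot> inv (\<a> A B (D \<otimes> E))) \<cdot> x"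
    using assms by (simp only: pentagon_inv)
  then show ?thesis using assms by simp
qed

lemma whisker_left_rewrite:
  assumes "g \<cdot> f = k" "f \<in> Arr C" "g \<in> Arr C" "Dom C g = Cod C f" "A \<in> Obj C"
  shows "(A \<lhd> g) \<cdot> (A \<lhd> f) = A \<lhd> k"
    and "\<lbrakk>x \<in> Arr C; Cod C x = A \<otimes> Dom C f\<rbrakk> \<Longrightarrow> (A \<lhd> g) \<cdot> (A \<lhd> f) \<cdot> x = (A \<lhd> k) \<cdot> x"
proof -
  show 1: "(A \<lhd> g) \<cdot> (A \<lhd> f) = A \<lhd> k" using assms by (simp flip: assms(1))
  show "\<lbrakk>x \<in> Arr C; Cod C x = A \<otimes> Dom C f\<rbrakk> \<Longrightarrow> (A \<lhd> g) \<cdot> (A \<lhd> f) \<cdot> x = (A \<lhd> k) \<cdot> x"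
    using assms(2-) by (simp add: Comp_rewrite[OF 1])
qed

lemma triangle_inv:
  assumes [simp]: "A \<in> Obj C" "B \<in> Obj C"
  shows "(\<r> A \<rhd> B) \<cdot> inv (\<a> A \<one> B) = A \<lhd> \<l> B"
    and "(\<l> A \<rhd> B) \<cdot> inv (\<a> \<one> A B) = \<l> (A \<otimes> B)"
  by (simp_all flip: triangle LeftUnitor_Tensor)

lemmas triangle_inv_assoc = Comp_rewrite[OF triangle_inv(1)] Comp_rewrite[OF triangle_inv(2)]

text \<open>These cancel the associators of a whiskering on the right against those of a composite.\<close>

lemma pentagon_mixed:
  assumes [simp]: "A \<in> Obj C" "B \<in> Obj C" "D \<in> Obj C" "E \<in> Obj C"
  shows "inv (\<a> A B (D \<otimes> E)) \<cdot> (A \<lhd> \<a> B D E) =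
      \<a> (A \<otimes> B) D E \<cdot> (inv (\<a> A B D) \<rhd> E) \<cdot> inv (\<a> A (B \<otimes> D) E)"
    and "(A \<lhd> inv (\<a> B D E)) \<cdot> \<a> A B (D \<otimes> E) =
      \<a> A (B \<otimes> D) E \<cdot> (\<a> A B D \<rhd> E) \<cdot> inv (\<a> (A \<otimes> B) D E)"
proof -
  show 1: "inv (\<a> A B (D \<otimes> E)) \<cdot> (A \<lhd> \<a> B D E) =
      \<a> (A \<otimes> B) D E \<cdot> (inv (\<a> A B D) \<rhd> E) \<cdot> inv (\<a> A (B \<otimes> D) E)" (is "?l = ?r")
  proof (rule iso_epi)
    show "?l \<cdot> (\<a> A (B \<otimes> D) E \<cdot> (\<a> A B D \<rhd> E)) = ?r \<cdot> (\<a> A (B \<otimes> D) E \<cdot> (\<a> A B D \<rhd> E))"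
      by (simp add: pentagon)
  qed simp_all
  have "inv ?l = inv ?r" by (simp only: 1)
  then show "(A \<lhd> inv (\<a> B D E)) \<cdot> \<a> A B (D \<otimes> E) =
      \<a> A (B \<otimes> D) E \<cdot> (\<a> A B D \<rhd> E) \<cdot> inv (\<a> (A \<otimes> B) D E)"
    by simp
qed

lemma whisker_merge:
  assumes "f \<in> Arr C" "g \<in> Arr C" "x \<in> Arr C" "Cod C x = Dom C f \<otimes> Dom C g"
  shows "Cod C f = A \<Longrightarrow> Dom C g = B \<Longrightarrow> (A \<lhd> g) \<cdot> (f \<rhd> B) \<cdot> x = (f \<boxtimes> g) \<cdot> x"
    and "Dom C f = A \<Longrightarrow> Cod C g = B \<Longrightarrow> (f \<rhd> B) \<cdot> (A \<lhd> g) \<cdot> x = (f \<boxtimes> g) \<cdot> x"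
  using assms by (auto simp: Tensor_Comp_assoc)

lemmas pentagon_mixed_assoc = Comp_rewrite[OF pentagon_mixed(1)] Comp_rewrite[OF pentagon_mixed(2)]

lemma unitor_natural_inv:
  assumes "f \<in> Arr C" "Dom C f = B"
  shows "(\<one> \<lhd> f) \<cdot> inv (\<l> B) = inv (\<l> (Cod C f)) \<cdot> f" "(f \<rhd> \<one>) \<cdot> inv (\<r> B) = inv (\<r> (Cod C f)) \<cdot> f"
proof -
  have [simp]: "B \<in> Obj C" using assms by auto
  show "(\<one> \<lhd> f) \<cdot> inv (\<l> B) = inv (\<l> (Cod C f)) \<cdot> f"
    by (rule iso_mono[of "\<l> (Cod C f)"]) (use assms in \<open>simp_all add: unitor_nat\<close>)
  show "(f \<rhd> \<one>) \<cdot> inv (\<r> B) = inv (\<r> (Cod C f)) \<cdot> f"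
    by (rule iso_mono[of "\<r> (Cod C f)"]) (use assms in \<open>simp_all add: unitor_nat\<close>)
qed

end

section \<open>Symmetries\<close>

context symmetric_monoidal_category
begin

lemma Symmetry_simps [simp]:
  assumes "A \<in> Obj C" "B \<in> Obj C"
  shows "\<s> A B \<in> Arr C" "Dom C (\<s> A B) = A \<otimes> B" "Cod C (\<s> A B) = B \<otimes> A"
    "\<s> B A \<cdot> \<s> A B = Ident C (A \<otimes> B)"
  using Symmetry_in[OF assms] Symmetry_involutive[OF assms] by simp_all

lemma Symmetry_iso [simp]:
  assumes "A \<in> Obj C" "B \<in> Obj C"
  shows "iso_arr C (\<s> A B)" "inv (\<s> A B) = \<s> B A"
proof -
  have "inverse_arrs C (\<s> A B) (\<s> B A)" using assms by (simp add: inverse_arrs_def)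
  then show "iso_arr C (\<s> A B)" "inv (\<s> A B) = \<s> B A" by (auto simp: iso_arr_def inv_eqI)
qed

lemma Symmetry_cancel [simp]:
  assumes "A \<in> Obj C" "B \<in> Obj C"
  shows "\<lbrakk>x \<in> Arr C; Cod C x = A \<otimes> B\<rbrakk> \<Longrightarrow> \<s> B A \<cdot> \<s> A B \<cdot> x = x"
    and "D \<in> Obj C \<Longrightarrow> (D \<lhd> \<s> B A) \<cdot> (D \<lhd> \<s> A B) = Ident C (D \<otimes> (A \<otimes> B))"
    and "D \<in> Obj C \<Longrightarrow> (\<s> B A \<rhd> D) \<cdot> (\<s> A B \<rhd> D) = Ident C ((A \<otimes> B) \<otimes> D)"
    and "\<lbrakk>D \<in> Obj C; x \<in> Arr C; Cod C x = D \<otimes> (A \<otimes> B)\<rbrakk> \<Longrightarrow>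
      (D \<lhd> \<s> B A) \<cdot> (D \<lhd> \<s> A B) \<cdot> x = x"
    and "\<lbrakk>D \<in> Obj C; x \<in> Arr C; Cod C x = (A \<otimes> B) \<otimes> D\<rbrakk> \<Longrightarrow>
      (\<s> B A \<rhd> D) \<cdot> (\<s> A B \<rhd> D) \<cdot> x = x"
  using assms by (simp_all add: Tensor_Comp Tensor_Comp_assoc Comp_rewrite[OF Symmetry_simps(4)])

lemma Symmetry_natural':
  assumes "f \<in> Arr C" "g \<in> Arr C" "Cod C f = A" "Cod C g = B"
  shows "\<s> A B \<cdot> (f \<boxtimes> g) = (g \<boxtimes> f) \<cdot> \<s> (Dom C f) (Dom C g)"
  using Symmetry_natural[of f "Dom C f" A g "Dom C g" B] assms by simp

lemmas sym_nat = Symmetry_natural' Comp_rewrite[OF Symmetry_natural']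

text \<open>Unlike the symmetry, this keeps right-nested tensor products right-nested.\<close>

definition exch :: "'o \<Rightarrow> 'o \<Rightarrow> 'o \<Rightarrow> 'm" where
  "exch A B D = \<a> B A D \<cdot> (\<s> A B \<rhd> D) \<cdot> inv (\<a> A B D)"

lemma exch_simps [simp]:
  assumes "A \<in> Obj C" "B \<in> Obj C" "D \<in> Obj C"
  shows "exch A B D \<in> Arr C" "Dom C (exch A B D) = A \<otimes> (B \<otimes> D)"
    "Cod C (exch A B D) = B \<otimes> (A \<otimes> D)" "iso_arr C (exch A B D)" "inv (exch A B D) = exch B A D"
    "exch B A D \<cdot> exch A B D = Ident C (A \<otimes> (B \<otimes> D))"
  using assms by (simp_all add: exch_def)

lemma exch_cancel [simp]:
  assumes "A \<in> Obj C" "B \<in> Obj C" "D \<in> Obj C"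
  shows "E \<in> Obj C \<Longrightarrow> (E \<lhd> exch B A D) \<cdot> (E \<lhd> exch A B D) = Ident C (E \<otimes> (A \<otimes> (B \<otimes> D)))"
    and "\<lbrakk>E \<in> Obj C; x \<in> Arr C; Cod C x = E \<otimes> (A \<otimes> (B \<otimes> D))\<rbrakk> \<Longrightarrow>
      (E \<lhd> exch B A D) \<cdot> (E \<lhd> exch A B D) \<cdot> x = x"
  using assms by (simp_all add: Tensor_Comp Tensor_Comp_assoc)

lemma exch_natural:
  assumes "f \<in> Arr C" "g \<in> Arr C" "h \<in> Arr C" "Cod C f = A" "Cod C g = B" "Cod C h = D"
  shows "exch A B D \<cdot> (f \<boxtimes> (g \<boxtimes> h)) = (g \<boxtimes> (f \<boxtimes> h)) \<cdot> exch (Dom C f) (Dom C g) (Dom C h)"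
proof -
  have [simp]: "A \<in> Obj C" "B \<in> Obj C" "D \<in> Obj C" using assms by auto
  have "exch A B D \<cdot> (f \<boxtimes> (g \<boxtimes> h)) =
      \<a> B A D \<cdot> (\<s> A B \<rhd> D) \<cdot> ((f \<boxtimes> g) \<boxtimes> h) \<cdot> inv (\<a> (Dom C f) (Dom C g) (Dom C h))"
    using assms by (simp add: exch_def assoc_nat_inv)
  also have "\<dots> = \<a> B A D \<cdot> ((g \<boxtimes> f) \<boxtimes> h) \<cdot> (\<s> (Dom C f) (Dom C g) \<rhd> Dom C h)
      \<cdot> inv (\<a> (Dom C f) (Dom C g) (Dom C h))"
    using assms by (simp add: Tensor_Comp_assoc Symmetry_natural')
  also have "\<dots> = (g \<boxtimes> (f \<boxtimes> h)) \<cdot> exch (Dom C f) (Dom C g) (Dom C h)"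
    using assms by (simp add: exch_def assoc_nat)
  finally show ?thesis .
qed

text \<open>The hexagon: moving \<open>A\<close> past \<open>B\<close> is moving it past \<open>B \<otimes> D\<close> and back past \<open>D\<close>.\<close>

lemma exch_Symmetry:
  assumes [simp]: "A \<in> Obj C" "B \<in> Obj C" "D \<in> Obj C"
  shows "exch A B D = (B \<lhd> \<s> D A) \<cdot> \<a> B D A \<cdot> \<s> A (B \<otimes> D)"
proof (rule iso_epi)
  show "exch A B D \<cdot> \<a> A B D = ((B \<lhd> \<s> D A) \<cdot> \<a> B D A \<cdot> \<s> A (B \<otimes> D)) \<cdot> \<a> A B D"
    by (simp add: hexagon exch_def)
qed simp_all

text \<open>Moving \<open>R\<close> past \<open>S \<otimes> T\<close> is moving it past \<open>S\<close> and then past \<open>T\<close>. In the form of the preceding lemma, each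
  exchange moves \<open>R\<close> to the far end and back. The two inner moves cancel, and what remains is naturality
  of the symmetry and one pentagon.\<close>

lemma exch_assoc_left:
  assumes [simp]: "R \<in> Obj C" "S \<in> Obj C" "T \<in> Obj C" "D \<in> Obj C"
  shows "(S \<lhd> exch R T D) \<cdot> exch R S (T \<otimes> D) \<cdot> (R \<lhd> \<a> S T D) =
    \<a> S T (R \<otimes> D) \<cdot> exch R (S \<otimes> T) D"
proof -
  have "(S \<lhd> exch R T D) \<cdot> exch R S (T \<otimes> D) \<cdot> (R \<lhd> \<a> S T D) =
      (S \<lhd> (T \<lhd> \<s> D R)) \<cdot> (S \<lhd> \<a> T D R) \<cdot> \<a> S (T \<otimes> D) R \<cdot> \<s> R (S \<otimes> (T \<otimes> D)) \<cdot> (R \<lhd> \<a> S T D)"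
    by (simp add: exch_Symmetry)
  also have "\<dots> = (S \<lhd> (T \<lhd> \<s> D R)) \<cdot> (S \<lhd> \<a> T D R) \<cdot> \<a> S (T \<otimes> D) R \<cdot> (\<a> S T D \<rhd> R)
      \<cdot> \<s> R ((S \<otimes> T) \<otimes> D)"
    by (simp add: sym_nat)
  also have "\<dots> = (S \<lhd> (T \<lhd> \<s> D R)) \<cdot> \<a> S T (D \<otimes> R) \<cdot> \<a> (S \<otimes> T) D R \<cdot> \<s> R ((S \<otimes> T) \<otimes> D)"
    by (simp add: pentagon_assoc)
  also have "\<dots> = \<a> S T (R \<otimes> D) \<cdot> exch R (S \<otimes> T) D"
    using assoc_nat(2)[of "Ident C S" "Ident C T" "\<s> D R" S T "R \<otimes> D"] by (simp add: exch_Symmetry)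
  finally show ?thesis .
qed

text \<open>Moving \<open>R \<otimes> T\<close> past \<open>S\<close>: the inverse of the preceding lemma, since an exchange is inverted by the opposite
  exchange.\<close>

lemma exch_assoc_right:
  assumes [simp]: "R \<in> Obj C" "S \<in> Obj C" "T \<in> Obj C" "D \<in> Obj C"
  shows "(S \<lhd> \<a> R T D) \<cdot> exch (R \<otimes> T) S D =
    exch R S (T \<otimes> D) \<cdot> (R \<lhd> exch T S D) \<cdot> \<a> R T (S \<otimes> D)"
proof -
  have "inv ((R \<lhd> exch S T D) \<cdot> exch S R (T \<otimes> D) \<cdot> (S \<lhd> \<a> R T D)) =
      inv (\<a> R T (S \<otimes> D) \<cdot> exch S (R \<otimes> T) D)"
    by (simp only: exch_assoc_left assms)
  then have *: "(S \<lhd> inv (\<a> R T D)) \<cdot> exch R S (T \<otimes> D) \<cdot> (R \<lhd> exch T S D) =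
      exch (R \<otimes> T) S D \<cdot> inv (\<a> R T (S \<otimes> D))"
    by simp
  have "(S \<lhd> \<a> R T D) \<cdot> exch (R \<otimes> T) S D =
      (S \<lhd> \<a> R T D) \<cdot> (exch (R \<otimes> T) S D \<cdot> inv (\<a> R T (S \<otimes> D))) \<cdot> \<a> R T (S \<otimes> D)"
    by simp
  also have "\<dots> = exch R S (T \<otimes> D) \<cdot> (R \<lhd> exch T S D) \<cdot> \<a> R T (S \<otimes> D)"
    unfolding *[symmetric] by simp
  finally show ?thesis .
qed

text \<open>An exchange does not involve the factors behind the first two, so these may be split off by associators.\<close>

lemma exch_whisker:
  assumes [simp]: "R \<in> Obj C" "S \<in> Obj C" "B \<in> Obj C" "D \<in> Obj C"
  shows "exch R S (B \<otimes> D) \<cdot> (R \<lhd> \<a> S B D) \<cdot> \<a> R (S \<otimes> B) D =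
    (S \<lhd> \<a> R B D) \<cdot> \<a> S (R \<otimes> B) D \<cdot> (exch R S B \<rhd> D)"
proof (rule iso_epi)
  let ?h = "\<a> R S B \<rhd> D"
  have "(exch R S (B \<otimes> D) \<cdot> (R \<lhd> \<a> S B D) \<cdot> \<a> R (S \<otimes> B) D) \<cdot> ?h =
      \<a> S R (B \<otimes> D) \<cdot> (\<s> R S \<rhd> (B \<otimes> D)) \<cdot> \<a> (R \<otimes> S) B D"
    by (simp add: exch_def pentagon)
  also have "\<dots> = \<a> S R (B \<otimes> D) \<cdot> \<a> (S \<otimes> R) B D \<cdot> ((\<s> R S \<rhd> B) \<rhd> D)"
    by (simp add: assoc_nat)
  also have "\<dots> = (S \<lhd> \<a> R B D) \<cdot> \<a> S (R \<otimes> B) D \<cdot> (\<a> S R B \<rhd> D) \<cdot> ((\<s> R S \<rhd> B) \<rhd> D)"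
    by (simp add: pentagon_assoc)
  also have "\<dots> = ((S \<lhd> \<a> R B D) \<cdot> \<a> S (R \<otimes> B) D \<cdot> (exch R S B \<rhd> D)) \<cdot> ?h"
    by (simp add: exch_def)
  finally show "(exch R S (B \<otimes> D) \<cdot> (R \<lhd> \<a> S B D) \<cdot> \<a> R (S \<otimes> B) D) \<cdot> ?h = \<dots>" .
qed simp_all

lemma exch_Unit:
  assumes [simp]: "A \<in> Obj C" "D \<in> Obj C"
  shows "\<l> (A \<otimes> D) \<cdot> exch A \<one> D = A \<lhd> \<l> D" "(A \<lhd> \<l> D) \<cdot> exch \<one> A D = \<l> (A \<otimes> D)"
proof -
  have "\<l> (A \<otimes> D) \<cdot> exch A \<one> D = ((\<l> A \<cdot> \<s> A \<one>) \<rhd> D) \<cdot> inv (\<a> A \<one> D)"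
    by (simp add: exch_def Comp_rewrite[OF LeftUnitor_Tensor])
  also have "\<dots> = A \<lhd> \<l> D"
    unfolding Symmetry_Unit[OF assms(1)] by (simp flip: triangle)
  finally show 1: "\<l> (A \<otimes> D) \<cdot> exch A \<one> D = A \<lhd> \<l> D" .
  show "(A \<lhd> \<l> D) \<cdot> exch \<one> A D = \<l> (A \<otimes> D)"
    unfolding 1[symmetric] by simp
qed

lemma exch_natural_Ident:
  assumes "A \<in> Obj C" "B \<in> Obj C" "h \<in> Arr C" "Cod C h = D"
  shows "exch A B D \<cdot> (A \<lhd> (B \<lhd> h)) = (B \<lhd> (A \<lhd> h)) \<cdot> exch A B (Dom C h)"
    and "exch A D B \<cdot> (A \<lhd> (h \<rhd> B)) = (h \<rhd> (A \<otimes> B)) \<cdot> exch A (Dom C h) B"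
    and "exch D A B \<cdot> (h \<rhd> (A \<otimes> B)) = (A \<lhd> (h \<rhd> B)) \<cdot> exch (Dom C h) A B"
  using assms exch_natural[of "Ident C A" "Ident C B" h A B D]
    exch_natural[of "Ident C A" h "Ident C B" A D B] exch_natural[of h "Ident C A" "Ident C B" D A B]
  by simp_all

lemmas exch_nat_Ident = exch_natural_Ident Comp_rewrite[OF exch_natural_Ident(1)]
  Comp_rewrite[OF exch_natural_Ident(2)] Comp_rewrite[OF exch_natural_Ident(3)]

lemma exch_assoc_left':
  assumes [simp]: "R \<in> Obj C" "S \<in> Obj C" "T \<in> Obj C" "D \<in> Obj C"
  shows "exch R (S \<otimes> T) D \<cdot> (R \<lhd> inv (\<a> S T D)) =
    inv (\<a> S T (R \<otimes> D)) \<cdot> (S \<lhd> exch R T D) \<cdot> exch R S (T \<otimes> D)"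
proof -
  have "exch R (S \<otimes> T) D \<cdot> (R \<lhd> inv (\<a> S T D)) =
      inv (\<a> S T (R \<otimes> D)) \<cdot> (\<a> S T (R \<otimes> D) \<cdot> exch R (S \<otimes> T) D) \<cdot> (R \<lhd> inv (\<a> S T D))"
    by simp
  then show ?thesis unfolding exch_assoc_left[symmetric, OF assms] by simp
qed

lemmas exch_assoc_left_assoc = Comp_rewrite[OF exch_assoc_left']

lemmas exch_assoc_right_assoc = Comp_rewrite[OF exch_assoc_right]

lemma exch_Symmetry':
  assumes [simp]: "A \<in> Obj C" "B \<in> Obj C" "D \<in> Obj C"
  shows "exch B A D = \<s> (B \<otimes> D) A \<cdot> inv (\<a> B D A) \<cdot> (B \<lhd> \<s> A D)"
proof -
  have "inv (exch A B D) = inv ((B \<lhd> \<s> D A) \<cdot> \<a> B D A \<cdot> \<s> A (B \<otimes> D))"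
    by (simp only: exch_Symmetry assms)
  then show ?thesis by simp
qed

lemma exch_Symmetry_pre:
  assumes "A \<in> Obj C" "B \<in> Obj C" "D \<in> Obj C"
  shows "inv (\<a> B A D) \<cdot> exch A B D = (\<s> A B \<rhd> D) \<cdot> inv (\<a> A B D)"
  using assms by (simp add: exch_def)

lemma exch_Symmetry_post:
  assumes "A \<in> Obj C" "B \<in> Obj C" "D \<in> Obj C"
  shows "exch A B D \<cdot> \<a> A B D = \<a> B A D \<cdot> (\<s> A B \<rhd> D)"
  using assms by (simp add: exch_def)

lemma exch_whisker':
  assumes [simp]: "R \<in> Obj C" "S \<in> Obj C" "B \<in> Obj C" "D \<in> Obj C"
  shows "exch R S (B \<otimes> D) \<cdot> (R \<lhd> \<a> S B D) =
    (S \<lhd> \<a> R B D) \<cdot> \<a> S (R \<otimes> B) D \<cdot> (exch R S B \<rhd> D) \<cdot> inv (\<a> R (S \<otimes> B) D)"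
proof (rule iso_epi)
  show "(exch R S (B \<otimes> D) \<cdot> (R \<lhd> \<a> S B D)) \<cdot> \<a> R (S \<otimes> B) D =
    ((S \<lhd> \<a> R B D) \<cdot> \<a> S (R \<otimes> B) D \<cdot> (exch R S B \<rhd> D) \<cdot> inv (\<a> R (S \<otimes> B) D)) \<cdot> \<a> R (S \<otimes> B) D"
    by (simp add: exch_whisker)
qed simp_all

text \<open>Both sides reverse the order of three factors. Up to symmetries of \<open>A\<close>, \<open>B\<close> and of \<open>B\<close>, \<open>E\<close> they are exchanges of
  \<open>A\<close> and \<open>E\<close>.\<close>

lemma Associator_Symmetry_pair:
  assumes [simp]: "A \<in> Obj C" "B \<in> Obj C" "E \<in> Obj C"
  shows "\<a> A B E \<cdot> \<s> E (A \<otimes> B) \<cdot> (E \<lhd> \<s> B A) = (A \<lhd> \<s> E B) \<cdot> \<s> (E \<otimes> B) A \<cdot> inv (\<a> E B A)"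
    and "(E \<lhd> \<s> A B) \<cdot> \<s> (A \<otimes> B) E = \<a> E B A \<cdot> \<s> A (E \<otimes> B) \<cdot> (A \<lhd> \<s> B E) \<cdot> \<a> A B E"
proof -
  have "(A \<lhd> \<s> E B) \<cdot> exch E A B \<cdot> (E \<lhd> \<s> B A) = \<a> A B E \<cdot> \<s> E (A \<otimes> B) \<cdot> (E \<lhd> \<s> B A)"
    unfolding exch_Symmetry[OF assms(3,1,2)] by simp
  moreover have "(A \<lhd> \<s> E B) \<cdot> exch E A B \<cdot> (E \<lhd> \<s> B A) = (A \<lhd> \<s> E B) \<cdot> \<s> (E \<otimes> B) A \<cdot> inv (\<a> E B A)"
    unfolding exch_Symmetry'[OF assms(1,3,2)] by simp
  ultimately show 1: "\<a> A B E \<cdot> \<s> E (A \<otimes> B) \<cdot> (E \<lhd> \<s> B A) = (A \<lhd> \<s> E B) \<cdot> \<s> (E \<otimes> B) A \<cdot> inv (\<a> E B A)"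
    by simp
  have "inv (\<a> A B E \<cdot> \<s> E (A \<otimes> B) \<cdot> (E \<lhd> \<s> B A)) = inv ((A \<lhd> \<s> E B) \<cdot> \<s> (E \<otimes> B) A \<cdot> inv (\<a> E B A))"
    by (simp only: 1)
  then have 2: "(E \<lhd> \<s> A B) \<cdot> \<s> (A \<otimes> B) E \<cdot> inv (\<a> A B E) = \<a> E B A \<cdot> \<s> A (E \<otimes> B) \<cdot> (A \<lhd> \<s> B E)"
    by simp
  have "(E \<lhd> \<s> A B) \<cdot> \<s> (A \<otimes> B) E = ((E \<lhd> \<s> A B) \<cdot> \<s> (A \<otimes> B) E \<cdot> inv (\<a> A B E)) \<cdot> \<a> A B E" by simp
  then show "(E \<lhd> \<s> A B) \<cdot> \<s> (A \<otimes> B) E = \<a> E B A \<cdot> \<s> A (E \<otimes> B) \<cdot> (A \<lhd> \<s> B E) \<cdot> \<a> A B E"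
    unfolding 2 by simp
qed

end

section \<open>Composition of parametrised maps\<close>

context symmetric_monoidal_category
begin

text \<open>Parameters and objects are arguments, because they cannot be recovered from \<open>R \<otimes> A\<close> and \<open>S \<otimes> B\<close>.\<close>

definition param_map :: "'o \<Rightarrow> 'o \<Rightarrow> 'o \<Rightarrow> 'o \<Rightarrow> 'm \<Rightarrow> bool" where
  "param_map R A S B u \<longleftrightarrow> R \<in> Obj C \<and> A \<in> Obj C \<and> S \<in> Obj C \<and> B \<in> Obj C \<and> u \<in> Hom C (R \<otimes> A) (S \<otimes> B)"

lemma param_comp_exch:
  assumes "param_map R A S B u" "param_map T B U D v"
  shows "param_comp C R S T U A B D u v =
    inv (\<a> S U D) \<cdot> (S \<lhd> v) \<cdot> exch T S B \<cdot> (T \<lhd> u) \<cdot> \<a> T R A"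
  using assms by (simp add: param_map_def param_comp_def exch_def)

lemma param_comp_param_map:
  assumes "param_map R A S B u" "param_map T B U D v"
  shows "param_map (T \<otimes> R) A (S \<otimes> U) D (param_comp C R S T U A B D u v)"
  using assms by (auto simp: param_comp_exch[OF assms] param_map_def)

text \<open>Reparametrisations can be pulled out of a composite. This is what makes composition well defined on
  learners.\<close>

lemma param_comp_natural:
  assumes u: "param_map R' A S B u" and v: "param_map T' B U D v"
    and p: "p \<in> Hom C R R'" and q: "q \<in> Hom C S S'" and p': "p' \<in> Hom C T T'" and q': "q' \<in> Hom C U U'"
  shows "param_comp C R S' T U' A B D ((q \<rhd> B) \<cdot> u \<cdot> (p \<rhd> A)) ((q' \<rhd> D) \<cdot> v \<cdot> (p' \<rhd> B)) =
    ((q \<boxtimes> q') \<rhd> D) \<cdot> param_comp C R' S T' U A B D u v \<cdot> ((p' \<boxtimes> p) \<rhd> A)"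
proof -
  have [simp]: "R \<in> Obj C" "S' \<in> Obj C" "T \<in> Obj C" "U' \<in> Obj C" using p q p' q' by auto
  note [simp] = u[unfolded param_map_def Hom_iff] v[unfolded param_map_def Hom_iff]
    p[unfolded Hom_iff] q[unfolded Hom_iff] p'[unfolded Hom_iff] q'[unfolded Hom_iff]
  have "param_comp C R S' T U' A B D ((q \<rhd> B) \<cdot> u \<cdot> (p \<rhd> A)) ((q' \<rhd> D) \<cdot> v \<cdot> (p' \<rhd> B)) =
    inv (\<a> S' U' D) \<cdot> (S' \<lhd> (q' \<rhd> D)) \<cdot> (S' \<lhd> v) \<cdot> (S' \<lhd> (p' \<rhd> B)) \<cdot> exch T S' B \<cdot> (T \<lhd> (q \<rhd> B))
      \<cdot> (T \<lhd> u) \<cdot> (T \<lhd> (p \<rhd> A)) \<cdot> \<a> T R A"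
    by (subst param_comp_exch) (simp_all add: param_map_def)
  \<comment> \<open>The exchange lets \<open>q\<close> pass to the front, where it meets \<open>q'\<close>, and \<open>p'\<close> to the back, where it meets \<open>p\<close>.\<close>
  also have "\<dots> = inv (\<a> S' U' D) \<cdot> (S' \<lhd> (q' \<rhd> D)) \<cdot> (S' \<lhd> v) \<cdot> (S' \<lhd> (p' \<rhd> B)) \<cdot> (q \<rhd> (T \<otimes> B)) \<cdot> exch T S B
      \<cdot> (T \<lhd> u) \<cdot> (T \<lhd> (p \<rhd> A)) \<cdot> \<a> T R A"
    by (simp add: exch_nat_Ident)
  also have "\<dots> = inv (\<a> S' U' D) \<cdot> (S' \<lhd> (q' \<rhd> D)) \<cdot> (S' \<lhd> v) \<cdot> (q \<rhd> (T' \<otimes> B)) \<cdot> (S \<lhd> (p' \<rhd> B)) \<cdot> exch T S B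
      \<cdot> (T \<lhd> u) \<cdot> (T \<lhd> (p \<rhd> A)) \<cdot> \<a> T R A"
    by (simp add: Tensor_Comp_assoc del: whisker_left_Comp whisker_right_Comp)
  also have "\<dots> = inv (\<a> S' U' D) \<cdot> (S' \<lhd> (q' \<rhd> D)) \<cdot> (S' \<lhd> v) \<cdot> (q \<rhd> (T' \<otimes> B)) \<cdot> exch T' S B
      \<cdot> (p' \<rhd> (S \<otimes> B)) \<cdot> (T \<lhd> u) \<cdot> (T \<lhd> (p \<rhd> A)) \<cdot> \<a> T R A"
    by (simp add: exch_nat_Ident)
  also have "\<dots> = inv (\<a> S' U' D) \<cdot> (q \<boxtimes> (q' \<rhd> D)) \<cdot> (S \<lhd> v) \<cdot> exch T' S B
      \<cdot> (T' \<lhd> u) \<cdot> (p' \<boxtimes> (p \<rhd> A)) \<cdot> \<a> T R A"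
    by (simp add: Tensor_Comp_assoc del: whisker_left_Comp whisker_right_Comp)
  also have "\<dots> = ((q \<boxtimes> q') \<rhd> D) \<cdot> param_comp C R' S T' U A B D u v \<cdot> ((p' \<boxtimes> p) \<rhd> A)"
    by (simp add: param_comp_exch[OF u v] assoc_nat assoc_nat_inv)
  finally show ?thesis .
qed

text \<open>In both bracketings, expanded by the rules for exchanges and associators, the maps \<open>f\<close>, \<open>g\<close>, \<open>h\<close> occur in this
  order with exchanges in between, and the only difference is whether the parameter \<open>R3\<close> of \<open>h\<close> passes the
  target parameter \<open>S1\<close> of \<open>f\<close> before or after \<open>g\<close> is applied.\<close>

lemma param_comp_assoc:
  assumes f: "param_map R1 A S1 B f" and g: "param_map R2 B S2 D g" and h: "param_map R3 D S3 E h"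
  shows "param_comp C (R2 \<otimes> R1) (S1 \<otimes> S2) R3 S3 A D E (param_comp C R1 S1 R2 S2 A B D f g) h
      \<cdot> (\<a> R3 R2 R1 \<rhd> A) =
    (inv (\<a> S1 S2 S3) \<rhd> E) \<cdot>
      param_comp C R1 S1 (R3 \<otimes> R2) (S2 \<otimes> S3) A B E f (param_comp C R2 S2 R3 S3 B D E g h)"
proof -
  note [simp] = f[unfolded param_map_def Hom_iff] g[unfolded param_map_def Hom_iff] h[unfolded param_map_def Hom_iff]
  have "param_comp C (R2 \<otimes> R1) (S1 \<otimes> S2) R3 S3 A D E (param_comp C R1 S1 R2 S2 A B D f g) h
      \<cdot> (\<a> R3 R2 R1 \<rhd> A) =
    inv (\<a> (S1 \<otimes> S2) S3 E) \<cdot> inv (\<a> S1 S2 (S3 \<otimes> E)) \<cdot> (S1 \<lhd> (S2 \<lhd> h)) \<cdot> (S1 \<lhd> exch R3 S2 D)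
      \<cdot> exch R3 S1 (S2 \<otimes> D) \<cdot> (R3 \<lhd> (S1 \<lhd> g)) \<cdot> (R3 \<lhd> exch R2 S1 B) \<cdot> (R3 \<lhd> (R2 \<lhd> f))
      \<cdot> \<a> R3 R2 (R1 \<otimes> A) \<cdot> \<a> (R3 \<otimes> R2) R1 A"
    unfolding param_comp_exch[OF param_comp_param_map[OF f g] h] unfolding param_comp_exch[OF f g]
    by (simp add: exch_assoc_left_assoc pentagon assoc_nat_inv_Ident)
  also have "\<dots> = inv (\<a> (S1 \<otimes> S2) S3 E) \<cdot> inv (\<a> S1 S2 (S3 \<otimes> E)) \<cdot> (S1 \<lhd> (S2 \<lhd> h)) \<cdot> (S1 \<lhd> exch R3 S2 D)
      \<cdot> (S1 \<lhd> (R3 \<lhd> g)) \<cdot> exch R3 S1 (R2 \<otimes> B) \<cdot> (R3 \<lhd> exch R2 S1 B) \<cdot> (R3 \<lhd> (R2 \<lhd> f))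
      \<cdot> \<a> R3 R2 (R1 \<otimes> A) \<cdot> \<a> (R3 \<otimes> R2) R1 A"
    by (simp add: exch_nat_Ident)
  also have "\<dots> = (inv (\<a> S1 S2 S3) \<rhd> E) \<cdot>
      param_comp C R1 S1 (R3 \<otimes> R2) (S2 \<otimes> S3) A B E f (param_comp C R2 S2 R3 S3 B D E g h)"
    unfolding param_comp_exch[OF f param_comp_param_map[OF g h]] unfolding param_comp_exch[OF g h]
    by (simp add: exch_assoc_right_assoc pentagon_inv_assoc assoc_nat_Ident)
  finally show ?thesis .
qed

text \<open>Composition is dinatural in the middle object and natural in the outer ones, because exchanges and
  associators are natural.\<close>

lemma param_comp_whisker:
  assumes "R \<in> Obj C" "S \<in> Obj C" "T \<in> Obj C" "U \<in> Obj C"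
    "A \<in> Obj C" "B \<in> Obj C" "D \<in> Obj C"
  shows "\<lbrakk>u \<in> Hom C (R \<otimes> A) (S \<otimes> B); k \<in> Hom C B B'; v \<in> Hom C (T \<otimes> B') (U \<otimes> D)\<rbrakk> \<Longrightarrow>
      param_comp C R S T U A B' D ((S \<lhd> k) \<cdot> u) v = param_comp C R S T U A B D u (v \<cdot> (T \<lhd> k))"
    and "\<lbrakk>u \<in> Hom C (R \<otimes> A) (S \<otimes> B); k \<in> Hom C A' A; v \<in> Hom C (T \<otimes> B) (U \<otimes> D)\<rbrakk> \<Longrightarrow>
      param_comp C R S T U A' B D (u \<cdot> (R \<lhd> k)) v = param_comp C R S T U A B D u v \<cdot> ((T \<otimes> R) \<lhd> k)"
    and "\<lbrakk>u \<in> Hom C (R \<otimes> A) (S \<otimes> B); k \<in> Hom C D D'; v \<in> Hom C (T \<otimes> B) (U \<otimes> D)\<rbrakk> \<Longrightarrow>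
      param_comp C R S T U A B D' u ((U \<lhd> k) \<cdot> v) = ((S \<otimes> U) \<lhd> k) \<cdot> param_comp C R S T U A B D u v"
proof goal_cases
  case 1
  then have [simp]: "B' \<in> Obj C" by auto
  from 1 assms show ?case
    by (simp add: param_comp_exch param_map_def exch_nat_Ident)
next
  case 2
  then have [simp]: "A' \<in> Obj C" by auto
  from 2 assms show ?case
    by (simp add: param_comp_exch param_map_def assoc_nat_Ident)
next
  case 3
  then have [simp]: "D' \<in> Obj C" by auto
  from 3 assms show ?case
    by (simp add: param_comp_exch param_map_def assoc_nat_inv_Ident)
qed

text \<open>Composing with a map without parameters, regarded as having unit parameters, only removes units from the
  parameters.\<close>

lemma param_comp_iota_left:
  assumes u: "param_map R A S B u" and k: "k \<in> Hom C B B'"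
  shows "(\<r> S \<rhd> B') \<cdot> param_comp C R S \<one> \<one> A B B' u (\<one> \<lhd> k) = (S \<lhd> k) \<cdot> u \<cdot> (\<l> R \<rhd> A)"
proof -
  have [simp]: "B' \<in> Obj C" using k by auto
  note [simp] = u[unfolded param_map_def Hom_iff] k[unfolded Hom_iff]
  have "(\<r> S \<rhd> B') \<cdot> param_comp C R S \<one> \<one> A B B' u (\<one> \<lhd> k) =
    (S \<lhd> \<l> B') \<cdot> (S \<lhd> (\<one> \<lhd> k)) \<cdot> exch \<one> S B \<cdot> (\<one> \<lhd> u) \<cdot> \<a> \<one> R A"
    by (subst param_comp_exch) (simp_all add: param_map_def triangle_inv_assoc)
  also have "\<dots> = (S \<lhd> k) \<cdot> (S \<lhd> \<l> B) \<cdot> exch \<one> S B \<cdot> (\<one> \<lhd> u) \<cdot> \<a> \<one> R A"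
    by (simp add: whisker_left_rewrite(2)[OF unitor_natural(1)])
  also have "\<dots> = (S \<lhd> k) \<cdot> u \<cdot> (\<l> R \<rhd> A)"
    by (simp add: Comp_rewrite[OF exch_Unit(2)] unitor_nat LeftUnitor_Tensor)
  finally show ?thesis .
qed

lemma param_comp_iota_right:
  assumes v: "param_map T B U D v" and k: "k \<in> Hom C A B"
  shows "(\<l> U \<rhd> D) \<cdot> param_comp C \<one> \<one> T U A B D (\<one> \<lhd> k) v = v \<cdot> (T \<lhd> k) \<cdot> (\<r> T \<rhd> A)"
proof -
  have [simp]: "A \<in> Obj C" using k by auto
  note [simp] = v[unfolded param_map_def Hom_iff] k[unfolded Hom_iff]
  have "(\<l> U \<rhd> D) \<cdot> param_comp C \<one> \<one> T U A B D (\<one> \<lhd> k) v =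
    \<l> (U \<otimes> D) \<cdot> (\<one> \<lhd> v) \<cdot> exch T \<one> B \<cdot> (T \<lhd> (\<one> \<lhd> k)) \<cdot> \<a> T \<one> A"
    by (subst param_comp_exch) (simp_all add: param_map_def triangle_inv_assoc)
  also have "\<dots> = v \<cdot> (\<l> (T \<otimes> B) \<cdot> exch T \<one> B) \<cdot> (T \<lhd> (\<one> \<lhd> k)) \<cdot> \<a> T \<one> A"
    by (simp add: unitor_nat)
  also have "\<dots> = v \<cdot> (T \<lhd> \<l> B) \<cdot> (T \<lhd> (\<one> \<lhd> k)) \<cdot> \<a> T \<one> A"
    by (simp add: Comp_rewrite[OF exch_Unit(1)])
  also have "\<dots> = v \<cdot> (T \<lhd> k) \<cdot> (\<r> T \<rhd> A)"
    by (simp add: whisker_left_rewrite(2)[OF unitor_natural(1)] triangle)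
  finally show ?thesis .
qed

end

section \<open>Whiskering and tensor of parametrised maps\<close>

context symmetric_monoidal_category
begin

text \<open>Right whiskering involves no exchange, because the parameter stands on the left.\<close>

definition param_right :: "'o \<Rightarrow> 'o \<Rightarrow> 'o \<Rightarrow> 'o \<Rightarrow> 'm \<Rightarrow> 'o \<Rightarrow> 'm" where
  "param_right R A S B u Z = \<a> S B Z \<cdot> (u \<rhd> Z) \<cdot> inv (\<a> R A Z)"

text \<open>In left whiskering the parameter has to move past \<open>Z\<close> and back.\<close>

definition param_left :: "'o \<Rightarrow> 'o \<Rightarrow> 'o \<Rightarrow> 'o \<Rightarrow> 'o \<Rightarrow> 'm \<Rightarrow> 'm" where
  "param_left Z R A S B u = exch Z S B \<cdot> (Z \<lhd> u) \<cdot> exch R Z A"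

lemma param_right_param_map:
  assumes "param_map R A S B u" "Z \<in> Obj C"
  shows "param_map R (A \<otimes> Z) S (B \<otimes> Z) (param_right R A S B u Z)"
  using assms by (auto simp: param_right_def param_map_def)

lemma param_left_param_map:
  assumes "param_map R A S B u" "Z \<in> Obj C"
  shows "param_map R (Z \<otimes> A) S (Z \<otimes> B) (param_left Z R A S B u)"
  using assms by (auto simp: param_left_def param_map_def)

lemma param_whisker_iota:
  assumes "f \<in> Hom C A B" "Z \<in> Obj C"
  shows "param_right \<one> A \<one> B (\<one> \<lhd> f) Z = \<one> \<lhd> (f \<rhd> Z)"
    and "param_left Z \<one> A \<one> B (\<one> \<lhd> f) = \<one> \<lhd> (Z \<lhd> f)"
proof -
  have [simp]: "A \<in> Obj C" "B \<in> Obj C" using assms by auto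
  show "param_right \<one> A \<one> B (\<one> \<lhd> f) Z = \<one> \<lhd> (f \<rhd> Z)"
    using assms by (simp add: param_right_def assoc_nat)
  show "param_left Z \<one> A \<one> B (\<one> \<lhd> f) = \<one> \<lhd> (Z \<lhd> f)"
    using assms by (simp add: param_left_def exch_nat_Ident)
qed

lemma param_whisker_natural:
  assumes "param_map R A S B u" "k \<in> Hom C Z Z'"
  shows "(S \<lhd> (B \<lhd> k)) \<cdot> param_right R A S B u Z = param_right R A S B u Z' \<cdot> (R \<lhd> (A \<lhd> k))"
    and "(S \<lhd> (k \<rhd> B)) \<cdot> param_left Z R A S B u = param_left Z' R A S B u \<cdot> (R \<lhd> (k \<rhd> A))"
proof -
  have [simp]: "Z \<in> Obj C" "Z' \<in> Obj C" using assms by auto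
  note [simp] = assms(1)[unfolded param_map_def Hom_iff] assms(2)[unfolded Hom_iff]
  have "(S \<lhd> (B \<lhd> k)) \<cdot> param_right R A S B u Z = \<a> S B Z' \<cdot> ((S \<otimes> B) \<lhd> k) \<cdot> (u \<rhd> Z) \<cdot> inv (\<a> R A Z)"
    by (simp add: param_right_def assoc_nat_Ident)
  also have "\<dots> = \<a> S B Z' \<cdot> (u \<rhd> Z') \<cdot> ((R \<otimes> A) \<lhd> k) \<cdot> inv (\<a> R A Z)"
    by (simp add: Tensor_Comp_assoc)
  also have "\<dots> = param_right R A S B u Z' \<cdot> (R \<lhd> (A \<lhd> k))"
    by (simp add: param_right_def assoc_nat_inv_Ident)
  finally show "(S \<lhd> (B \<lhd> k)) \<cdot> param_right R A S B u Z = \<dots>" .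
  have "(S \<lhd> (k \<rhd> B)) \<cdot> param_left Z R A S B u = exch Z' S B \<cdot> (k \<rhd> (S \<otimes> B)) \<cdot> (Z \<lhd> u) \<cdot> exch R Z A"
    by (simp add: param_left_def exch_nat_Ident)
  also have "\<dots> = exch Z' S B \<cdot> (Z' \<lhd> u) \<cdot> (k \<rhd> (R \<otimes> A)) \<cdot> exch R Z A"
    by (simp add: Tensor_Comp_assoc)
  also have "\<dots> = param_left Z' R A S B u \<cdot> (R \<lhd> (k \<rhd> A))"
    by (simp add: param_left_def exch_nat_Ident)
  finally show "(S \<lhd> (k \<rhd> B)) \<cdot> param_left Z R A S B u = \<dots>" .
qed

lemma param_whisker_assoc:
  assumes u: "param_map R A S B u" and [simp]: "Y \<in> Obj C" "Z \<in> Obj C"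
  shows "(S \<lhd> \<a> B Y Z) \<cdot> param_right R (A \<otimes> Y) S (B \<otimes> Y) (param_right R A S B u Y) Z =
      param_right R A S B u (Y \<otimes> Z) \<cdot> (R \<lhd> \<a> A Y Z)"
    and "(S \<lhd> \<a> Y Z B) \<cdot> param_left (Y \<otimes> Z) R A S B u =
      param_left Y R (Z \<otimes> A) S (Z \<otimes> B) (param_left Z R A S B u) \<cdot> (R \<lhd> \<a> Y Z A)"
proof -
  note [simp] = u[unfolded param_map_def Hom_iff]
  show "(S \<lhd> \<a> B Y Z) \<cdot> param_right R (A \<otimes> Y) S (B \<otimes> Y) (param_right R A S B u Y) Z =
      param_right R A S B u (Y \<otimes> Z) \<cdot> (R \<lhd> \<a> A Y Z)"
    by (simp add: param_right_def pentagon_assoc assoc_nat_Ident pentagon_mixed)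
  show "(S \<lhd> \<a> Y Z B) \<cdot> param_left (Y \<otimes> Z) R A S B u =
      param_left Y R (Z \<otimes> A) S (Z \<otimes> B) (param_left Z R A S B u) \<cdot> (R \<lhd> \<a> Y Z A)"
    by (simp add: param_left_def exch_assoc_right_assoc assoc_nat_Ident exch_assoc_left)
qed

lemma param_whisker_Unit:
  assumes u: "param_map R A S B u"
  shows "(S \<lhd> \<r> B) \<cdot> param_right R A S B u \<one> = u \<cdot> (R \<lhd> \<r> A)"
    and "(S \<lhd> \<l> B) \<cdot> param_left \<one> R A S B u = u \<cdot> (R \<lhd> \<l> A)"
proof -
  note [simp] = u[unfolded param_map_def Hom_iff]
  have *: "\<r> (R \<otimes> A) \<cdot> inv (\<a> R A \<one>) = R \<lhd> \<r> A" by (simp flip: RightUnitor_Tensor)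
  show "(S \<lhd> \<r> B) \<cdot> param_right R A S B u \<one> = u \<cdot> (R \<lhd> \<r> A)"
    by (simp add: param_right_def Comp_rewrite[OF RightUnitor_Tensor] unitor_nat *)
  show "(S \<lhd> \<l> B) \<cdot> param_left \<one> R A S B u = u \<cdot> (R \<lhd> \<l> A)"
    by (simp add: param_left_def Comp_rewrite[OF exch_Unit(2)] exch_Unit(1) unitor_nat)
qed

text \<open>Expanding the exchanges by the hexagon, the moves past the far end on either side of \<open>u\<close> cancel by
  naturality of the symmetry. So left whiskering inherits laws from right whiskering.\<close>

lemma param_whisker_Symmetry:
  assumes u: "param_map R A S B u" and [simp]: "Z \<in> Obj C"
  shows "param_left Z R A S B u = (S \<lhd> \<s> B Z) \<cdot> param_right R A S B u Z \<cdot> (R \<lhd> \<s> Z A)"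
    and "param_right R A S B u Z = (S \<lhd> \<s> Z B) \<cdot> param_left Z R A S B u \<cdot> (R \<lhd> \<s> A Z)"
proof -
  note [simp] = u[unfolded param_map_def Hom_iff]
  show *: "param_left Z R A S B u = (S \<lhd> \<s> B Z) \<cdot> param_right R A S B u Z \<cdot> (R \<lhd> \<s> Z A)"
    by (simp add: param_left_def param_right_def exch_Symmetry[of Z S B] exch_Symmetry'[of Z R A] sym_nat)
  show "param_right R A S B u Z = (S \<lhd> \<s> Z B) \<cdot> param_left Z R A S B u \<cdot> (R \<lhd> \<s> A Z)"
    unfolding * using param_right_param_map[OF u, of Z] by (simp add: param_map_def)
qed

lemma param_whisker_param:
  assumes u: "param_map R' A S B u" and p: "p \<in> Hom C R R'" and q: "q \<in> Hom C S S'" and [simp]: "Z \<in> Obj C"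
  shows "param_right R A S' B ((q \<rhd> B) \<cdot> u \<cdot> (p \<rhd> A)) Z =
      (q \<rhd> (B \<otimes> Z)) \<cdot> param_right R' A S B u Z \<cdot> (p \<rhd> (A \<otimes> Z))"
    and "param_left Z R A S' B ((q \<rhd> B) \<cdot> u \<cdot> (p \<rhd> A)) =
      (q \<rhd> (Z \<otimes> B)) \<cdot> param_left Z R' A S B u \<cdot> (p \<rhd> (Z \<otimes> A))"
proof -
  have [simp]: "R \<in> Obj C" "S' \<in> Obj C" using p q by auto
  note [simp] = u[unfolded param_map_def Hom_iff] p[unfolded Hom_iff] q[unfolded Hom_iff]
  show "param_right R A S' B ((q \<rhd> B) \<cdot> u \<cdot> (p \<rhd> A)) Z =
      (q \<rhd> (B \<otimes> Z)) \<cdot> param_right R' A S B u Z \<cdot> (p \<rhd> (A \<otimes> Z))"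
    by (simp add: param_right_def assoc_nat_Ident assoc_nat_inv_Ident)
  show "param_left Z R A S' B ((q \<rhd> B) \<cdot> u \<cdot> (p \<rhd> A)) =
      (q \<rhd> (Z \<otimes> B)) \<cdot> param_left Z R' A S B u \<cdot> (p \<rhd> (Z \<otimes> A))"
    by (simp add: param_left_def exch_nat_Ident)
qed

text \<open>The map \<open>exch T S B\<close> in the middle of the composite is unaffected by a further factor \<open>Z\<close>, by \<open>exch_whisker\<close>.\<close>

lemma param_right_comp:
  assumes u: "param_map R A S B u" and v: "param_map T B U D v" and [simp]: "Z \<in> Obj C"
  shows "param_right (T \<otimes> R) A (S \<otimes> U) D (param_comp C R S T U A B D u v) Z =
    param_comp C R S T U (A \<otimes> Z) (B \<otimes> Z) (D \<otimes> Z) (param_right R A S B u Z) (param_right T B U D v Z)"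
proof -
  note [simp] = u[unfolded param_map_def Hom_iff] v[unfolded param_map_def Hom_iff]
  show ?thesis
    unfolding param_comp_exch[OF u v] param_comp_exch[OF param_right_param_map[OF u assms(3)] param_right_param_map[OF v assms(3)]]
    by (simp add: param_right_def Comp_rewrite[OF exch_whisker'] pentagon_mixed pentagon_mixed_assoc
      assoc_nat_inv_Ident assoc_nat_inv)
qed

text \<open>Inherited from right whiskering: the symmetries introduced between the two factors cancel.\<close>

lemma param_left_comp:
  assumes u: "param_map R A S B u" and v: "param_map T B U D v" and [simp]: "Z \<in> Obj C"
  shows "param_left Z (T \<otimes> R) A (S \<otimes> U) D (param_comp C R S T U A B D u v) =
    param_comp C R S T U (Z \<otimes> A) (Z \<otimes> B) (Z \<otimes> D) (param_left Z R A S B u) (param_left Z T B U D v)"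
proof -
  note [simp] = u[unfolded param_map_def Hom_iff] v[unfolded param_map_def Hom_iff]
    param_right_param_map[OF u, of Z, unfolded param_map_def Hom_iff, simplified]
    param_right_param_map[OF v, of Z, unfolded param_map_def Hom_iff, simplified]
  show ?thesis
    unfolding param_whisker_Symmetry(1)[OF u assms(3)] param_whisker_Symmetry(1)[OF v assms(3)]
      param_whisker_Symmetry(1)[OF param_comp_param_map[OF u v] assms(3)] param_right_comp[OF assms]
    by (subst param_comp_whisker(1)[where B = "B \<otimes> Z"]; simp?)
      (simp add: param_comp_whisker(2)[where A = "A \<otimes> Z"] param_comp_whisker(3)[where D = "D \<otimes> Z"])
qed

lemma param_tensor_exch:
  assumes u: "param_map R A S B u" and v: "param_map T D U E v"
  shows "param_tensor C R S T U A B D E u v =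
    (\<s> S U \<rhd> (B \<otimes> E)) \<cdot> inv (\<a> S U (B \<otimes> E)) \<cdot> (S \<lhd> exch B U E) \<cdot> \<a> S B (U \<otimes> E) \<cdot> (u \<boxtimes> v)
      \<cdot> inv (\<a> R A (T \<otimes> D)) \<cdot> (R \<lhd> exch T A D) \<cdot> \<a> R T (A \<otimes> D)"
proof -
  have interchange: "interchange C W X Y Z = inv (\<a> W Y (X \<otimes> Z)) \<cdot> (W \<lhd> exch X Y Z) \<cdot> \<a> W X (Y \<otimes> Z)"
    if "W \<in> Obj C" "X \<in> Obj C" "Y \<in> Obj C" "Z \<in> Obj C" for W X Y Z
    using that by (simp add: interchange_def exch_def)
  show ?thesis using u v by (simp add: param_map_def param_tensor_def interchange)
qed

text \<open>The tensor product of parametrised maps is the composite of a left and a right whiskering, with the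
  same parameters. In the composite, the exchanges of \<open>U\<close> with \<open>R\<close> and \<open>A\<close> fuse to one with \<open>R \<otimes> A\<close>. It is moved
  across \<open>u\<close>, where it splits into exchanges with \<open>S\<close> and \<open>B\<close>.\<close>

lemma param_tensor_comp:
  assumes u: "param_map R A S B u" and v: "param_map T D U E v"
  shows "param_tensor C R S T U A B D E u v =
    param_comp C T U R S (A \<otimes> D) (A \<otimes> E) (B \<otimes> E) (param_left A T D U E v) (param_right R A S B u E)"
proof -
  note [simp] = u[unfolded param_map_def Hom_iff] v[unfolded param_map_def Hom_iff]
  have right: "exch R U (A \<otimes> E) \<cdot> (R \<lhd> exch A U E) =
      (U \<lhd> \<a> R A E) \<cdot> exch (R \<otimes> A) U E \<cdot> inv (\<a> R A (U \<otimes> E))"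
    by (rule iso_epi[where h = "\<a> R A (U \<otimes> E)"]) (simp_all add: exch_assoc_right)
  have "param_comp C T U R S (A \<otimes> D) (A \<otimes> E) (B \<otimes> E) (param_left A T D U E v) (param_right R A S B u E) =
    inv (\<a> U S (B \<otimes> E)) \<cdot> (U \<lhd> \<a> S B E) \<cdot> (U \<lhd> (u \<rhd> E)) \<cdot> exch (R \<otimes> A) U E \<cdot> ((R \<otimes> A) \<lhd> v)
      \<cdot> inv (\<a> R A (T \<otimes> D)) \<cdot> (R \<lhd> exch T A D) \<cdot> \<a> R T (A \<otimes> D)"
    by (subst param_comp_exch[OF param_left_param_map[OF v] param_right_param_map[OF u]])
      (simp_all add: param_left_def param_right_def Comp_rewrite[OF right] assoc_nat_inv_Ident)
  also have "\<dots> = inv (\<a> U S (B \<otimes> E)) \<cdot> (U \<lhd> \<a> S B E) \<cdot> exch (S \<otimes> B) U E \<cdot> (u \<rhd> (U \<otimes> E))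
      \<cdot> ((R \<otimes> A) \<lhd> v) \<cdot> inv (\<a> R A (T \<otimes> D)) \<cdot> (R \<lhd> exch T A D) \<cdot> \<a> R T (A \<otimes> D)"
    by (simp add: exch_nat_Ident)
  also have "\<dots> = inv (\<a> U S (B \<otimes> E)) \<cdot> exch S U (B \<otimes> E) \<cdot> (S \<lhd> exch B U E) \<cdot> \<a> S B (U \<otimes> E)
      \<cdot> (u \<rhd> (U \<otimes> E)) \<cdot> ((R \<otimes> A) \<lhd> v) \<cdot> inv (\<a> R A (T \<otimes> D)) \<cdot> (R \<lhd> exch T A D) \<cdot> \<a> R T (A \<otimes> D)"
    by (simp add: exch_assoc_right_assoc)
  also have "\<dots> = param_tensor C R S T U A B D E u v"
    by (simp add: param_tensor_exch[OF u v] Comp_rewrite[OF exch_Symmetry_pre] whisker_merge)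
  finally show ?thesis ..
qed

text \<open>Left and right whiskering commute up to symmetries of the parameters: both composites can be brought to
  the form of \<open>param_tensor_exch\<close>, with \<open>u \<boxtimes> v\<close> between the same exchanges.\<close>

lemma param_interchange:
  assumes u: "param_map R A S B u" and v: "param_map T D U E v"
  shows "param_comp C T U R S (A \<otimes> D) (A \<otimes> E) (B \<otimes> E) (param_left A T D U E v) (param_right R A S B u E)
      \<cdot> (\<s> T R \<rhd> (A \<otimes> D)) =
    (\<s> S U \<rhd> (B \<otimes> E)) \<cdot>
      param_comp C R S T U (A \<otimes> D) (B \<otimes> D) (B \<otimes> E) (param_right R A S B u D) (param_left B T D U E v)"
proof -
  note [simp] = u[unfolded param_map_def Hom_iff] v[unfolded param_map_def Hom_iff]
  have "param_comp C R S T U (A \<otimes> D) (B \<otimes> D) (B \<otimes> E) (param_right R A S B u D) (param_left B T D U E v) =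
    inv (\<a> S U (B \<otimes> E)) \<cdot> (S \<lhd> exch B U E) \<cdot> (S \<lhd> (B \<lhd> v)) \<cdot> ((S \<lhd> exch T B D) \<cdot> exch T S (B \<otimes> D)
      \<cdot> (T \<lhd> \<a> S B D)) \<cdot> (T \<lhd> (u \<rhd> D)) \<cdot> (T \<lhd> inv (\<a> R A D)) \<cdot> \<a> T R (A \<otimes> D)"
    by (subst param_comp_exch[OF param_right_param_map[OF u] param_left_param_map[OF v]])
      (simp_all add: param_left_def param_right_def)
  also have "(S \<lhd> exch T B D) \<cdot> exch T S (B \<otimes> D) \<cdot> (T \<lhd> \<a> S B D) = \<a> S B (T \<otimes> D) \<cdot> exch T (S \<otimes> B) D"
    by (simp add: exch_assoc_left)
  also have "inv (\<a> S U (B \<otimes> E)) \<cdot> (S \<lhd> exch B U E) \<cdot> (S \<lhd> (B \<lhd> v)) \<cdot> (\<a> S B (T \<otimes> D) \<cdot> exch T (S \<otimes> B) D)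
      \<cdot> (T \<lhd> (u \<rhd> D)) \<cdot> (T \<lhd> inv (\<a> R A D)) \<cdot> \<a> T R (A \<otimes> D) =
    inv (\<a> S U (B \<otimes> E)) \<cdot> (S \<lhd> exch B U E) \<cdot> \<a> S B (U \<otimes> E) \<cdot> ((S \<otimes> B) \<lhd> v)
      \<cdot> (u \<rhd> (T \<otimes> D)) \<cdot> exch T (R \<otimes> A) D \<cdot> (T \<lhd> inv (\<a> R A D)) \<cdot> \<a> T R (A \<otimes> D)"
    by (simp add: exch_natural_Ident(2) Comp_rewrite[OF exch_natural_Ident(2)] assoc_nat_Ident)
  also have "\<dots> = inv (\<a> S U (B \<otimes> E)) \<cdot> (S \<lhd> exch B U E) \<cdot> \<a> S B (U \<otimes> E) \<cdot> ((S \<otimes> B) \<lhd> v)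
      \<cdot> (u \<rhd> (T \<otimes> D)) \<cdot> inv (\<a> R A (T \<otimes> D)) \<cdot> (R \<lhd> exch T A D) \<cdot> exch T R (A \<otimes> D) \<cdot> \<a> T R (A \<otimes> D)"
    by (simp add: exch_assoc_left_assoc)
  finally show ?thesis
    unfolding param_tensor_comp[OF u v, symmetric] param_tensor_exch[OF u v]
    by (simp add: exch_Symmetry_post whisker_merge)
qed

end

section \<open>Tensor products from whiskering\<close>

text \<open>The category \<open>N\<close> has the objects of the symmetric monoidal category \<open>M\<close> and takes its structure
  isomorphisms from \<open>M\<close> through the functor \<open>\<iota>\<close>. The operation \<open>W\<close> whiskers arrows of \<open>N\<close> with objects on the
  right. Whiskering on the left is \<open>W\<close> conjugated by symmetries. The last two assumptions say that the tensor
  product of \<open>N\<close> is whiskering in both arguments, in either order, so every arrow is central in the sense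
  of premonoidal categories.\<close>

locale central_action =
  M: symmetric_monoidal_category M + N: category N for M :: "('o, 'm) smc" and N :: "('o, 'n) smc" +
  fixes \<iota> :: "'m \<Rightarrow> 'n" and W :: "'n \<Rightarrow> 'o \<Rightarrow> 'n"
  assumes Obj_N [simp]: "Obj N = Obj M"
    and TensorObj_N [simp]: "TensorObj N = TensorObj M"
    and Unit_N [simp]: "Unit N = Unit M"
    and Associator_N: "\<lbrakk>A \<in> Obj M; B \<in> Obj M; D \<in> Obj M\<rbrakk> \<Longrightarrow> \<a>\<^bsub>N\<^esub> A B D = \<iota> (\<a>\<^bsub>M\<^esub> A B D)"
    and LeftUnitor_N: "A \<in> Obj M \<Longrightarrow> \<l>\<^bsub>N\<^esub> A = \<iota> (\<l>\<^bsub>M\<^esub> A)"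
    and RightUnitor_N: "A \<in> Obj M \<Longrightarrow> \<r>\<^bsub>N\<^esub> A = \<iota> (\<r>\<^bsub>M\<^esub> A)"
    and Symmetry_N: "\<lbrakk>A \<in> Obj M; B \<in> Obj M\<rbrakk> \<Longrightarrow> \<s>\<^bsub>N\<^esub> A B = \<iota> (\<s>\<^bsub>M\<^esub> A B)"
    and iota_in: "f \<in> Arr M \<Longrightarrow> \<iota> f \<in> Hom N (Dom M f) (Cod M f)"
    and iota_Ident: "A \<in> Obj M \<Longrightarrow> \<iota> (Ident M A) = Ident N A"
    and iota_Comp: "\<lbrakk>f \<in> Arr M; g \<in> Arr M; Dom M g = Cod M f\<rbrakk> \<Longrightarrow> \<iota> g \<cdot>\<^bsub>N\<^esub> \<iota> f = \<iota> (g \<cdot>\<^bsub>M\<^esub> f)"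
    and W_in: "\<lbrakk>u \<in> Arr N; Z \<in> Obj M\<rbrakk> \<Longrightarrow> W u Z \<in> Hom N (Dom N u \<otimes>\<^bsub>M\<^esub> Z) (Cod N u \<otimes>\<^bsub>M\<^esub> Z)"
    and W_Comp: "\<lbrakk>u \<in> Arr N; v \<in> Arr N; Dom N v = Cod N u; Z \<in> Obj M\<rbrakk> \<Longrightarrow>
      W (v \<cdot>\<^bsub>N\<^esub> u) Z = W v Z \<cdot>\<^bsub>N\<^esub> W u Z"
    and W_iota: "\<lbrakk>f \<in> Arr M; Z \<in> Obj M\<rbrakk> \<Longrightarrow> W (\<iota> f) Z = \<iota> (f \<boxtimes>\<^bsub>M\<^esub> Ident M Z)"
    and W_natural: "\<lbrakk>u \<in> Arr N; k \<in> Arr M\<rbrakk> \<Longrightarrow>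
      \<iota> (Ident M (Cod N u) \<boxtimes>\<^bsub>M\<^esub> k) \<cdot>\<^bsub>N\<^esub> W u (Dom M k) = W u (Cod M k) \<cdot>\<^bsub>N\<^esub> \<iota> (Ident M (Dom N u) \<boxtimes>\<^bsub>M\<^esub> k)"
    and W_assoc: "\<lbrakk>u \<in> Arr N; Y \<in> Obj M; Z \<in> Obj M\<rbrakk> \<Longrightarrow>
      \<iota> (\<a>\<^bsub>M\<^esub> (Cod N u) Y Z) \<cdot>\<^bsub>N\<^esub> W (W u Y) Z = W u (Y \<otimes>\<^bsub>M\<^esub> Z) \<cdot>\<^bsub>N\<^esub> \<iota> (\<a>\<^bsub>M\<^esub> (Dom N u) Y Z)"
    and W_Unit: "u \<in> Arr N \<Longrightarrow>
      \<iota> (\<r>\<^bsub>M\<^esub> (Cod N u)) \<cdot>\<^bsub>N\<^esub> W u \<one>\<^bsub>M\<^esub> = u \<cdot>\<^bsub>N\<^esub> \<iota> (\<r>\<^bsub>M\<^esub> (Dom N u))"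
    and Tensor_N: "\<lbrakk>u \<in> Arr N; v \<in> Arr N\<rbrakk> \<Longrightarrow> u \<boxtimes>\<^bsub>N\<^esub> v =
      W u (Cod N v) \<cdot>\<^bsub>N\<^esub> \<iota> (\<s>\<^bsub>M\<^esub> (Cod N v) (Dom N u)) \<cdot>\<^bsub>N\<^esub> W v (Dom N u) \<cdot>\<^bsub>N\<^esub> \<iota> (\<s>\<^bsub>M\<^esub> (Dom N u) (Dom N v))"
    and Tensor_N': "\<lbrakk>u \<in> Arr N; v \<in> Arr N\<rbrakk> \<Longrightarrow> u \<boxtimes>\<^bsub>N\<^esub> v =
      \<iota> (\<s>\<^bsub>M\<^esub> (Cod N v) (Cod N u)) \<cdot>\<^bsub>N\<^esub> W v (Cod N u) \<cdot>\<^bsub>N\<^esub> \<iota> (\<s>\<^bsub>M\<^esub> (Cod N u) (Dom N v)) \<cdot>\<^bsub>N\<^esub> W u (Dom N v)"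
begin

definition L :: "'o \<Rightarrow> 'n \<Rightarrow> 'n" where
  "L A v = \<iota> (\<s>\<^bsub>M\<^esub> (Cod N v) A) \<cdot>\<^bsub>N\<^esub> W v A \<cdot>\<^bsub>N\<^esub> \<iota> (\<s>\<^bsub>M\<^esub> A (Dom N v))"

lemma N_Obj_in [simp]: "u \<in> Arr N \<Longrightarrow> Dom N u \<in> Obj M" "u \<in> Arr N \<Longrightarrow> Cod N u \<in> Obj M"
  using N.Dom_in N.Cod_in by simp_all

lemma iota_simps [simp]:
  assumes "f \<in> Arr M"
  shows "\<iota> f \<in> Arr N" "Dom N (\<iota> f) = Dom M f" "Cod N (\<iota> f) = Cod M f"
  using iota_in[OF assms] by simp_all

lemma W_simps [simp]:
  assumes "u \<in> Arr N" "Z \<in> Obj M"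
  shows "W u Z \<in> Arr N" "Dom N (W u Z) = Dom N u \<otimes>\<^bsub>M\<^esub> Z" "Cod N (W u Z) = Cod N u \<otimes>\<^bsub>M\<^esub> Z"
  using W_in[OF assms] by simp_all

lemma L_simps [simp]:
  assumes "u \<in> Arr N" "Z \<in> Obj M"
  shows "L Z u \<in> Arr N" "Dom N (L Z u) = Z \<otimes>\<^bsub>M\<^esub> Dom N u" "Cod N (L Z u) = Z \<otimes>\<^bsub>M\<^esub> Cod N u"
  using assms by (simp_all add: L_def)

declare W_iota [simp] iota_Comp [simp]

lemma iota_Comp_assoc [simp]:
  assumes "f \<in> Arr M" "g \<in> Arr M" "Dom M g = Cod M f" "x \<in> Arr N" "Cod N x = Dom M f"
  shows "\<iota> g \<cdot>\<^bsub>N\<^esub> \<iota> f \<cdot>\<^bsub>N\<^esub> x = \<iota> (g \<cdot>\<^bsub>M\<^esub> f) \<cdot>\<^bsub>N\<^esub> x"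
  using assms by (intro N.Comp_rewrite[OF iota_Comp]) simp_all

lemma iota_iso [simp]:
  assumes "iso_arr M f"
  shows "iso_arr N (\<iota> f)"
proof -
  have "inverse_arrs N (\<iota> f) (\<iota> (inv\<^bsub>M\<^esub> f))"
    using assms M.iso_arr_Arr[OF assms] by (simp add: inverse_arrs_def iota_Ident)
  then show "iso_arr N (\<iota> f)" by (auto simp: iso_arr_def)
qed

lemma Ident_comp_N [simp]:
  "\<lbrakk>u \<in> Arr N; Cod N u = A\<rbrakk> \<Longrightarrow> \<iota> (Ident M A) \<cdot>\<^bsub>N\<^esub> u = u"
  "\<lbrakk>u \<in> Arr N; Dom N u = A\<rbrakk> \<Longrightarrow> u \<cdot>\<^bsub>N\<^esub> \<iota> (Ident M A) = u"
  by (auto simp: iota_Ident)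

lemma L_iota [simp]:
  assumes "f \<in> Arr M" "Z \<in> Obj M"
  shows "L Z (\<iota> f) = \<iota> (Ident M Z \<boxtimes>\<^bsub>M\<^esub> f)"
  using assms by (simp add: L_def M.sym_nat)

lemma tensor_W_L:
  assumes "u \<in> Arr N" "v \<in> Arr N"
  shows "u \<boxtimes>\<^bsub>N\<^esub> v = W u (Cod N v) \<cdot>\<^bsub>N\<^esub> L (Dom N u) v"
    and "W u (Cod N v) \<cdot>\<^bsub>N\<^esub> L (Dom N u) v = L (Cod N u) v \<cdot>\<^bsub>N\<^esub> W u (Dom N v)"
  using assms Tensor_N[OF assms] Tensor_N'[OF assms] by (simp_all add: L_def)

lemma tensor_simps [simp]:
  assumes "u \<in> Arr N" "v \<in> Arr N"
  shows "u \<boxtimes>\<^bsub>N\<^esub> v \<in> Arr N" "Dom N (u \<boxtimes>\<^bsub>N\<^esub> v) = Dom N u \<otimes>\<^bsub>M\<^esub> Dom N v"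
    "Cod N (u \<boxtimes>\<^bsub>N\<^esub> v) = Cod N u \<otimes>\<^bsub>M\<^esub> Cod N v"
  using assms by (simp_all add: tensor_W_L(1))

lemma L_Comp:
  assumes "u \<in> Arr N" "v \<in> Arr N" "Dom N v = Cod N u" "Z \<in> Obj M"
  shows "L Z (v \<cdot>\<^bsub>N\<^esub> u) = L Z v \<cdot>\<^bsub>N\<^esub> L Z u"
  using assms by (simp add: L_def W_Comp)

lemma tensor_iota:
  assumes "f \<in> Arr M" "g \<in> Arr M"
  shows "\<iota> f \<boxtimes>\<^bsub>N\<^esub> \<iota> g = \<iota> (f \<boxtimes>\<^bsub>M\<^esub> g)"
  using assms by (simp add: tensor_W_L(1) M.Tensor_Comp)

lemma tensor_Comp:
  assumes "f \<in> Arr N" "g \<in> Arr N" "Dom N g = Cod N f"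
    and "f' \<in> Arr N" "g' \<in> Arr N" "Dom N g' = Cod N f'"
  shows "(g \<cdot>\<^bsub>N\<^esub> f) \<boxtimes>\<^bsub>N\<^esub> (g' \<cdot>\<^bsub>N\<^esub> f') = (g \<boxtimes>\<^bsub>N\<^esub> g') \<cdot>\<^bsub>N\<^esub> (f \<boxtimes>\<^bsub>N\<^esub> f')"
proof -
  have "(g \<cdot>\<^bsub>N\<^esub> f) \<boxtimes>\<^bsub>N\<^esub> (g' \<cdot>\<^bsub>N\<^esub> f') =
      W g (Cod N g') \<cdot>\<^bsub>N\<^esub> (W f (Cod N g') \<cdot>\<^bsub>N\<^esub> L (Dom N f) g') \<cdot>\<^bsub>N\<^esub> L (Dom N f) f'"
    using assms by (simp add: tensor_W_L(1) W_Comp L_Comp)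
  also have "\<dots> = W g (Cod N g') \<cdot>\<^bsub>N\<^esub> (L (Cod N f) g' \<cdot>\<^bsub>N\<^esub> W f (Dom N g')) \<cdot>\<^bsub>N\<^esub> L (Dom N f) f'"
    using assms by (simp only: tensor_W_L(2))
  also have "\<dots> = (g \<boxtimes>\<^bsub>N\<^esub> g') \<cdot>\<^bsub>N\<^esub> (f \<boxtimes>\<^bsub>N\<^esub> f')"
    using assms by (simp add: tensor_W_L(1))
  finally show ?thesis .
qed

lemma W_W:
  assumes "u \<in> Arr N" "Y \<in> Obj M" "Z \<in> Obj M"
  shows "W (W u Y) Z =
    \<iota> (inv\<^bsub>M\<^esub> (\<a>\<^bsub>M\<^esub> (Cod N u) Y Z)) \<cdot>\<^bsub>N\<^esub> W u (Y \<otimes>\<^bsub>M\<^esub> Z) \<cdot>\<^bsub>N\<^esub> \<iota> (\<a>\<^bsub>M\<^esub> (Dom N u) Y Z)"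
  using assms by (simp flip: W_assoc)

lemma W_Symmetry:
  assumes "u \<in> Arr N" "Y \<in> Obj M" "Z \<in> Obj M"
  shows "W u (Z \<otimes>\<^bsub>M\<^esub> Y) = \<iota> (Ident M (Cod N u) \<boxtimes>\<^bsub>M\<^esub> \<s>\<^bsub>M\<^esub> Y Z) \<cdot>\<^bsub>N\<^esub> W u (Y \<otimes>\<^bsub>M\<^esub> Z)
    \<cdot>\<^bsub>N\<^esub> \<iota> (Ident M (Dom N u) \<boxtimes>\<^bsub>M\<^esub> \<s>\<^bsub>M\<^esub> Z Y)"
  using assms N.Comp_rewrite[OF W_natural[of u "\<s>\<^bsub>M\<^esub> Y Z"], of "\<iota> (Ident M (Dom N u) \<boxtimes>\<^bsub>M\<^esub> \<s>\<^bsub>M\<^esub> Z Y)"] by simp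

text \<open>Conjugation by symmetries turns the associativity isomorphisms of \<open>W\<close> into exchanges.\<close>

lemma L_W:
  assumes "g \<in> Arr N" "A \<in> Obj M" "Z \<in> Obj M"
  shows "L A (W g Z) = \<iota> (M.exch (Cod N g) A Z) \<cdot>\<^bsub>N\<^esub> W g (A \<otimes>\<^bsub>M\<^esub> Z) \<cdot>\<^bsub>N\<^esub> \<iota> (M.exch A (Dom N g) Z)"
  using assms by (simp add: L_def W_W W_Symmetry[of g A Z] M.exch_Symmetry[of A "Dom N g"]
     M.exch_Symmetry'[of A "Cod N g"])

text \<open>Together with \<open>W_assoc\<close> and \<open>L_L\<close> this is naturality of the associator, one argument at a time.\<close>

lemma W_L:
  assumes "g \<in> Arr N" "A \<in> Obj M" "Z \<in> Obj M"
  shows "\<iota> (\<a>\<^bsub>M\<^esub> A (Cod N g) Z) \<cdot>\<^bsub>N\<^esub> W (L A g) Z = L A (W g Z) \<cdot>\<^bsub>N\<^esub> \<iota> (\<a>\<^bsub>M\<^esub> A (Dom N g) Z)"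
  using assms by (simp add: L_W) (simp add: L_def W_Comp W_W M.exch_def)

text \<open>Both sides are \<open>W h (B \<otimes> A)\<close> conjugated by isomorphisms that reverse the order of three factors, which agree
  by \<open>Associator_Symmetry_pair\<close>.\<close>

lemma L_L:
  assumes "h \<in> Arr N" "A \<in> Obj M" "B \<in> Obj M"
  shows "\<iota> (\<a>\<^bsub>M\<^esub> A B (Cod N h)) \<cdot>\<^bsub>N\<^esub> L (A \<otimes>\<^bsub>M\<^esub> B) h = L A (L B h) \<cdot>\<^bsub>N\<^esub> \<iota> (\<a>\<^bsub>M\<^esub> A B (Dom N h))"
proof -
  have "\<iota> (\<a>\<^bsub>M\<^esub> A B (Cod N h)) \<cdot>\<^bsub>N\<^esub> L (A \<otimes>\<^bsub>M\<^esub> B) h =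
    \<iota> (\<a>\<^bsub>M\<^esub> A B (Cod N h) \<cdot>\<^bsub>M\<^esub> \<s>\<^bsub>M\<^esub> (Cod N h) (A \<otimes>\<^bsub>M\<^esub> B) \<cdot>\<^bsub>M\<^esub> (Ident M (Cod N h) \<boxtimes>\<^bsub>M\<^esub> \<s>\<^bsub>M\<^esub> B A))
    \<cdot>\<^bsub>N\<^esub> W h (B \<otimes>\<^bsub>M\<^esub> A)
    \<cdot>\<^bsub>N\<^esub> \<iota> ((Ident M (Dom N h) \<boxtimes>\<^bsub>M\<^esub> \<s>\<^bsub>M\<^esub> A B) \<cdot>\<^bsub>M\<^esub> \<s>\<^bsub>M\<^esub> (A \<otimes>\<^bsub>M\<^esub> B) (Dom N h))"
    using assms by (simp add: L_def W_Symmetry[of h B A])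
  also have "\<dots> = L A (L B h) \<cdot>\<^bsub>N\<^esub> \<iota> (\<a>\<^bsub>M\<^esub> A B (Dom N h))"
    unfolding M.Associator_Symmetry_pair[OF assms(2,3) N_Obj_in(1)[OF assms(1)]]
      M.Associator_Symmetry_pair[OF assms(2,3) N_Obj_in(2)[OF assms(1)]]
    using assms by (simp add: L_def W_Comp W_W M.sym_nat)
  finally show ?thesis .
qed

text \<open>Axioms without arrows hold because \<open>\<iota>\<close> preserves composition and, by \<open>tensor_iota\<close>, tensor products. Each
  naturality axiom splits into naturality for whiskered arrows.\<close>

theorem symmetric_monoidal: "symmetric_monoidal_category N"
proof
  fix A B A' B' f g
  assume "f \<in> Hom N A B" "g \<in> Hom N A' B'"
  then show "f \<boxtimes>\<^bsub>N\<^esub> g \<in> Hom N (A \<otimes>\<^bsub>N\<^esub> A') (B \<otimes>\<^bsub>N\<^esub> B')" by simp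
next
  fix A B D f g A' B' D' f' g'
  assume "f \<in> Hom N A B" "g \<in> Hom N B D" "f' \<in> Hom N A' B'" "g' \<in> Hom N B' D'"
  then show "(g \<cdot>\<^bsub>N\<^esub> f) \<boxtimes>\<^bsub>N\<^esub> (g' \<cdot>\<^bsub>N\<^esub> f') = (g \<boxtimes>\<^bsub>N\<^esub> g') \<cdot>\<^bsub>N\<^esub> (f \<boxtimes>\<^bsub>N\<^esub> f')"
    by (simp add: tensor_Comp)
next
  fix A A' B B' D D' f g h
  assume "f \<in> Hom N A A'" "g \<in> Hom N B B'" "h \<in> Hom N D D'"
  then have fgh [simp]: "f \<in> Arr N" "Dom N f = A" "Cod N f = A'" "g \<in> Arr N" "Dom N g = B" "Cod N g = B'"
    "h \<in> Arr N" "Dom N h = D" "Cod N h = D'" by simp_all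
  have [simp]: "A \<in> Obj M" "A' \<in> Obj M" "B \<in> Obj M" "B' \<in> Obj M" "D \<in> Obj M" "D' \<in> Obj M"
    using fgh N_Obj_in by metis+
  have "\<a>\<^bsub>N\<^esub> A' B' D' \<cdot>\<^bsub>N\<^esub> ((f \<boxtimes>\<^bsub>N\<^esub> g) \<boxtimes>\<^bsub>N\<^esub> h) =
    \<iota> (\<a>\<^bsub>M\<^esub> A' B' D') \<cdot>\<^bsub>N\<^esub> W (W f B') D' \<cdot>\<^bsub>N\<^esub> W (L A g) D' \<cdot>\<^bsub>N\<^esub> L (A \<otimes>\<^bsub>M\<^esub> B) h"
    by (simp add: Associator_N tensor_W_L(1) W_Comp)
  also have "\<dots> = W f (B' \<otimes>\<^bsub>M\<^esub> D') \<cdot>\<^bsub>N\<^esub> L A (W g D') \<cdot>\<^bsub>N\<^esub> L A (L B h) \<cdot>\<^bsub>N\<^esub> \<iota> (\<a>\<^bsub>M\<^esub> A B D)"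
    using N.Comp_rewrite[OF W_assoc[of f B' D'], of "W (L A g) D' \<cdot>\<^bsub>N\<^esub> L (A \<otimes>\<^bsub>M\<^esub> B) h"]
      N.Comp_rewrite[OF W_L[of g A D'], of "L (A \<otimes>\<^bsub>M\<^esub> B) h"] L_L[of h A B] by simp
  also have "\<dots> = (f \<boxtimes>\<^bsub>N\<^esub> (g \<boxtimes>\<^bsub>N\<^esub> h)) \<cdot>\<^bsub>N\<^esub> \<a>\<^bsub>N\<^esub> A B D"
    by (simp add: Associator_N tensor_W_L(1) L_Comp)
  finally show "\<a>\<^bsub>N\<^esub> A' B' D' \<cdot>\<^bsub>N\<^esub> ((f \<boxtimes>\<^bsub>N\<^esub> g) \<boxtimes>\<^bsub>N\<^esub> h) = (f \<boxtimes>\<^bsub>N\<^esub> (g \<boxtimes>\<^bsub>N\<^esub> h)) \<cdot>\<^bsub>N\<^esub> \<a>\<^bsub>N\<^esub> A B D" .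
next
  fix f A B
  assume "f \<in> Hom N A B"
  then have f [simp]: "f \<in> Arr N" "Dom N f = A" "Cod N f = B" by simp_all
  have [simp]: "A \<in> Obj M" "B \<in> Obj M" using f N_Obj_in by metis+
  show "\<r>\<^bsub>N\<^esub> B \<cdot>\<^bsub>N\<^esub> (f \<boxtimes>\<^bsub>N\<^esub> Ident N \<one>\<^bsub>N\<^esub>) = f \<cdot>\<^bsub>N\<^esub> \<r>\<^bsub>N\<^esub> A"
    using W_Unit[of f] by (simp add: RightUnitor_N tensor_W_L(1) flip: iota_Ident)
  have "\<l>\<^bsub>N\<^esub> B \<cdot>\<^bsub>N\<^esub> (Ident N \<one>\<^bsub>N\<^esub> \<boxtimes>\<^bsub>N\<^esub> f) = \<iota> (\<l>\<^bsub>M\<^esub> B) \<cdot>\<^bsub>N\<^esub> L \<one>\<^bsub>M\<^esub> f"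
    by (simp add: LeftUnitor_N tensor_W_L(1) flip: iota_Ident)
  also have "\<dots> = \<iota> (\<l>\<^bsub>M\<^esub> B \<cdot>\<^bsub>M\<^esub> \<s>\<^bsub>M\<^esub> B \<one>\<^bsub>M\<^esub>) \<cdot>\<^bsub>N\<^esub> W f \<one>\<^bsub>M\<^esub> \<cdot>\<^bsub>N\<^esub> \<iota> (\<s>\<^bsub>M\<^esub> \<one>\<^bsub>M\<^esub> A)"
    by (simp add: L_def)
  also have "\<dots> = f \<cdot>\<^bsub>N\<^esub> \<iota> (\<r>\<^bsub>M\<^esub> A \<cdot>\<^bsub>M\<^esub> \<s>\<^bsub>M\<^esub> \<one>\<^bsub>M\<^esub> A)"
    using N.Comp_rewrite[OF W_Unit[of f], of "\<iota> (\<s>\<^bsub>M\<^esub> \<one>\<^bsub>M\<^esub> A)"] by (simp add: M.Symmetry_Unit)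
  also have "\<dots> = f \<cdot>\<^bsub>N\<^esub> \<l>\<^bsub>N\<^esub> A"
    by (simp add: LeftUnitor_N flip: M.Symmetry_Unit)
  finally show "\<l>\<^bsub>N\<^esub> B \<cdot>\<^bsub>N\<^esub> (Ident N \<one>\<^bsub>N\<^esub> \<boxtimes>\<^bsub>N\<^esub> f) = f \<cdot>\<^bsub>N\<^esub> \<l>\<^bsub>N\<^esub> A" .
next
  fix f g A A' B B'
  assume "f \<in> Hom N A A'" "g \<in> Hom N B B'"
  then have fg [simp]: "f \<in> Arr N" "Dom N f = A" "Cod N f = A'" "g \<in> Arr N" "Dom N g = B" "Cod N g = B'"
    by simp_all
  have [simp]: "A \<in> Obj M" "A' \<in> Obj M" "B \<in> Obj M" "B' \<in> Obj M" using fg N_Obj_in by metis+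
  have "\<s>\<^bsub>N\<^esub> A' B' \<cdot>\<^bsub>N\<^esub> (f \<boxtimes>\<^bsub>N\<^esub> g) = L B' f \<cdot>\<^bsub>N\<^esub> W g A \<cdot>\<^bsub>N\<^esub> \<iota> (\<s>\<^bsub>M\<^esub> A B)"
    by (simp add: Symmetry_N tensor_W_L(1)) (simp add: L_def)
  also have "\<dots> = (g \<boxtimes>\<^bsub>N\<^esub> f) \<cdot>\<^bsub>N\<^esub> \<s>\<^bsub>N\<^esub> A B"
    using N.Comp_rewrite[OF tensor_W_L(2)[of g f], of "\<iota> (\<s>\<^bsub>M\<^esub> A B)"] by (simp add: Symmetry_N tensor_W_L(1))
  finally show "\<s>\<^bsub>N\<^esub> A' B' \<cdot>\<^bsub>N\<^esub> (f \<boxtimes>\<^bsub>N\<^esub> g) = (g \<boxtimes>\<^bsub>N\<^esub> f) \<cdot>\<^bsub>N\<^esub> \<s>\<^bsub>N\<^esub> A B" .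
qed (simp_all add: Associator_N LeftUnitor_N RightUnitor_N Symmetry_N tensor_iota M.pentagon M.triangle
   M.hexagon M.Symmetry_Unit flip: iota_Ident)

end

section \<open>The product of a category with its opposite\<close>

text \<open>The source of \<open>\<iota> : C \<times> C\<^sup>o\<^sup>p \<rightarrow> Learn\<close>. The tensor product is reversed in the second factor, so that an
  associator is again paired with an associator, and a left unitor with the inverse of a right one.\<close>

definition with_opposite :: "('o, 'm) smc \<Rightarrow> ('o \<times> 'o, 'm \<times> 'm) smc" where
  "with_opposite C =
     \<lparr>Obj = Obj C \<times> Obj C,
      Arr = Arr C \<times> Arr C,
      Dom = (\<lambda>(f, f'). (Dom C f, Cod C f')),
      Cod = (\<lambda>(f, f'). (Cod C f, Dom C f')),
      Ident = (\<lambda>(A, A'). (Ident C A, Ident C A')),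
      Comp = (\<lambda>(g, g') (f, f'). (g \<cdot>\<^bsub>C\<^esub> f, f' \<cdot>\<^bsub>C\<^esub> g')),
      TensorObj = learner_tensor_obj C,
      TensorArr = (\<lambda>(f, f') (g, g'). (f \<boxtimes>\<^bsub>C\<^esub> g, g' \<boxtimes>\<^bsub>C\<^esub> f')),
      Unit = (\<one>\<^bsub>C\<^esub>, \<one>\<^bsub>C\<^esub>),
      Associator = (\<lambda>(A, A') (B, B') (D, D'). (\<a>\<^bsub>C\<^esub> A B D, \<a>\<^bsub>C\<^esub> D' B' A')),
      LeftUnitor = (\<lambda>(A, A'). (\<l>\<^bsub>C\<^esub> A, inv\<^bsub>C\<^esub> (\<r>\<^bsub>C\<^esub> A'))),
      RightUnitor = (\<lambda>(A, A'). (\<r>\<^bsub>C\<^esub> A, inv\<^bsub>C\<^esub> (\<l>\<^bsub>C\<^esub> A'))),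
      Symmetry = (\<lambda>(A, A') (B, B'). (\<s>\<^bsub>C\<^esub> A B, \<s>\<^bsub>C\<^esub> A' B'))\<rparr>"

lemma with_opposite_simps [simp]:
  "Obj (with_opposite C) = Obj C \<times> Obj C"
  "Arr (with_opposite C) = Arr C \<times> Arr C"
  "Dom (with_opposite C) (f, f') = (Dom C f, Cod C f')"
  "Cod (with_opposite C) (f, f') = (Cod C f, Dom C f')"
  "Ident (with_opposite C) (A, A') = (Ident C A, Ident C A')"
  "(g, g') \<cdot>\<^bsub>with_opposite C\<^esub> (f, f') = (g \<cdot>\<^bsub>C\<^esub> f, f' \<cdot>\<^bsub>C\<^esub> g')"
  "(A, A') \<otimes>\<^bsub>with_opposite C\<^esub> (B, B') = (A \<otimes>\<^bsub>C\<^esub> B, B' \<otimes>\<^bsub>C\<^esub> A')"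
  "(f, f') \<boxtimes>\<^bsub>with_opposite C\<^esub> (g, g') = (f \<boxtimes>\<^bsub>C\<^esub> g, g' \<boxtimes>\<^bsub>C\<^esub> f')"
  "\<one>\<^bsub>with_opposite C\<^esub> = (\<one>\<^bsub>C\<^esub>, \<one>\<^bsub>C\<^esub>)"
  "\<a>\<^bsub>with_opposite C\<^esub> (A, A') (B, B') (D, D') = (\<a>\<^bsub>C\<^esub> A B D, \<a>\<^bsub>C\<^esub> D' B' A')"
  "\<l>\<^bsub>with_opposite C\<^esub> (A, A') = (\<l>\<^bsub>C\<^esub> A, inv\<^bsub>C\<^esub> (\<r>\<^bsub>C\<^esub> A'))"
  "\<r>\<^bsub>with_opposite C\<^esub> (A, A') = (\<r>\<^bsub>C\<^esub> A, inv\<^bsub>C\<^esub> (\<l>\<^bsub>C\<^esub> A'))"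
  "\<s>\<^bsub>with_opposite C\<^esub> (A, A') (B, B') = (\<s>\<^bsub>C\<^esub> A B, \<s>\<^bsub>C\<^esub> A' B')"
  by (simp_all add: with_opposite_def learner_tensor_obj_def)

context symmetric_monoidal_category
begin

lemma iso_arr_with_opposite:
  assumes "iso_arr C f" "iso_arr C f'"
  shows "iso_arr (with_opposite C) (f, f')"
proof -
  have "inverse_arrs (with_opposite C) (f, f') (inv f, inv f')"
    using assms iso_arr_Arr[of f] iso_arr_Arr[of f'] by (simp add: inverse_arrs_def)
  then show ?thesis by (auto simp: iso_arr_def)
qed

text \<open>In the second component each coherence axiom becomes, after reversal of tensor factors and of arrows, the
  same axiom of \<open>C\<close>.\<close>

lemma symmetric_monoidal_with_opposite: "symmetric_monoidal_category (with_opposite C)"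
proof -
  have triangle': "\<a> A \<one> B \<cdot> (inv (\<r> A) \<rhd> B) = A \<lhd> inv (\<l> B)" if "A \<in> Obj C" "B \<in> Obj C" for A B
    by (rule iso_mono[of "A \<lhd> \<l> B"]) (use that in \<open>simp_all add: triangle_assoc\<close>)
  have unit': "\<s> A \<one> \<cdot> inv (\<r> A) = inv (\<l> A)" if "A \<in> Obj C" for A
    by (rule iso_mono[of "\<l> A"]) (use that Comp_rewrite[OF Symmetry_Unit] in simp_all)
  show ?thesis
    by unfold_locales
      (auto simp: iso_arr_with_opposite assoc_nat Tensor_Comp unitor_nat unitor_natural_inv pentagon triangle triangle'
        sym_nat Symmetry_Unit unit' hexagon)
qed

end

section \<open>Operations on classes of presentations\<close>

context symmetric_monoidal_category
begin

lemma presentations_param_map: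
  assumes "A \<in> Obj C" "A' \<in> Obj C" "B \<in> Obj C" "B' \<in> Obj C"
  shows "(P, Q, f, g) \<in> presentations C (A, A') (B, B') \<longleftrightarrow> param_map P A Q B f \<and> param_map Q B' P A' g"
  using assms by (auto simp: presentations_def param_map_def)

lemma param_map_arr:
  assumes "param_map R A S B u"
  shows "u \<in> Arr C" "Dom C u = R \<otimes> A" "Cod C u = S \<otimes> B"
    "R \<in> Obj C" "A \<in> Obj C" "S \<in> Obj C" "B \<in> Obj C"
  using assms by (simp_all add: param_map_def)

lemma learner_eq_presentations:
  "learner_eq C X Y x y \<Longrightarrow> x \<in> presentations C X Y \<and> y \<in> presentations C X Y"
proof (induction rule: learner_eq.induct)
  case (slide A A' B B' P P' Q Q' p q f g)
  then show ?case by (simp add: presentations_def)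
qed auto

lemma learner_class_eq_iff:
  "x \<in> presentations C X Y \<Longrightarrow> learner_class C X Y x = learner_class C X Y y \<longleftrightarrow> learner_eq C X Y x y"
  unfolding learner_class_def by (blast intro: learner_eq.refl learner_eq.sym learner_eq.trans)

lemma learner_class_eqI: "learner_eq C X Y x y \<Longrightarrow> learner_class C X Y x = learner_class C X Y y"
  using learner_class_eq_iff[of x X Y y] learner_eq_presentations[of X Y x y] by simp

lemma learner_class_self: "x \<in> presentations C X Y \<Longrightarrow> x \<in> learner_class C X Y x"
  by (simp add: learner_class_def learner_eq.refl)

lemma learner_of_eqI: "learner_eq C X Y x y \<Longrightarrow> learner_of C X Y x = learner_of C X Y y"
  using learner_class_eqI by (simp add: learner_of_def)

text \<open>Sliding the inverse of \<open>p\<close> and \<open>q\<close>. An isomorphism of parameters only has to intertwine both components, so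
  that equations between learners reduce to equations of parametrised maps.\<close>

lemma learner_eq_iso:
  assumes f: "param_map P A Q B f" and g: "param_map Q B' P A' g"
    and f': "param_map P' A Q' B f'" and g': "param_map Q' B' P' A' g'"
    and p: "p \<in> Hom C P P'" "iso_arr C p" and q: "q \<in> Hom C Q Q'"
    and pf: "f' \<cdot> (p \<rhd> A) = (q \<rhd> B) \<cdot> f" and pg: "(p \<rhd> A') \<cdot> g = g' \<cdot> (q \<rhd> B')"
  shows "learner_eq C (A, A') (B, B') (P, Q, f, g) (P', Q', f', g')"
proof -
  note [simp] = param_map_arr[OF f] param_map_arr[OF g] param_map_arr[OF f'] param_map_arr[OF g']
    p[unfolded Hom_iff] q[unfolded Hom_iff]
  \<comment> \<open>The slide relation reparametrises the first component by \<open>inv p\<close> at its source, whence the inverse.\<close>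
  have "learner_eq C (A, A') (B, B') (P', Q', (q \<rhd> B) \<cdot> f \<cdot> (inv p \<rhd> A), g')
      (P, Q, f, (inv p \<rhd> A') \<cdot> g' \<cdot> (q \<rhd> B'))"
    by (rule learner_eq.slide) simp_all
  moreover have "(q \<rhd> B) \<cdot> f \<cdot> (inv p \<rhd> A) = f'"
  proof -
    have "(q \<rhd> B) \<cdot> f \<cdot> (inv p \<rhd> A) = ((q \<rhd> B) \<cdot> f) \<cdot> (inv p \<rhd> A)" by simp
    then show ?thesis unfolding pf[symmetric] by simp
  qed
  moreover have "(inv p \<rhd> A') \<cdot> g' \<cdot> (q \<rhd> B') = g"
    unfolding pg[symmetric] by simp
  ultimately show ?thesis by (simp add: learner_eq.sym)
qed

text \<open>An operation on presentations respects the equivalence as soon as it does so on generators.\<close>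

lemma learner_eq_lift:
  assumes xy: "learner_eq C X Y x y"
    and pres: "\<And>x. x \<in> presentations C X Y \<Longrightarrow> F x \<in> presentations C X' Y'"
    and slide: "\<And>A A' B B' P P' Q Q' p q f g. \<lbrakk>X = (A, A'); Y = (B, B');
      p \<in> Hom C P P'; q \<in> Hom C Q Q'; param_map P' A Q B f; param_map Q' B' P A' g\<rbrakk>
      \<Longrightarrow> learner_eq C X' Y' (F (P, Q', (q \<rhd> B) \<cdot> f \<cdot> (p \<rhd> A), g))
          (F (P', Q, f, (p \<rhd> A') \<cdot> g \<cdot> (q \<rhd> B')))"
  shows "learner_eq C X' Y' (F x) (F y)"
  using xy
proof (induction rule: learner_eq.induct)
  case (slide A A' B B' P P' Q Q' p q f g)
  then show ?case by (intro assms(3)) (auto simp: param_map_def)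
next
  case (refl x)
  then show ?case by (intro learner_eq.refl pres)
qed (auto intro: learner_eq.sym learner_eq.trans)

fun comp_presentation :: "'o \<times> 'o \<Rightarrow> 'o \<times> 'o \<Rightarrow> 'o \<times> 'o \<Rightarrow> ('o, 'm) presentation \<Rightarrow> ('o, 'm) presentation
    \<Rightarrow> ('o, 'm) presentation" where
  "comp_presentation (A, A') (B, B') (D, D') (P\<^sub>2, Q\<^sub>2, l\<^sub>2, r\<^sub>2) (P\<^sub>1, Q\<^sub>1, l\<^sub>1, r\<^sub>1) =
    (P\<^sub>2 \<otimes> P\<^sub>1, Q\<^sub>1 \<otimes> Q\<^sub>2, param_comp C P\<^sub>1 Q\<^sub>1 P\<^sub>2 Q\<^sub>2 A B D l\<^sub>1 l\<^sub>2, param_comp C Q\<^sub>2 P\<^sub>2 Q\<^sub>1 P\<^sub>1 D' B' A' r\<^sub>2 r\<^sub>1)"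

text \<open>A right whiskering of the first component goes with a left whiskering of the second, and conversely, because
  \<open>(A, A') \<otimes> (B, B') = (A \<otimes> B, B' \<otimes> A')\<close>.\<close>

fun right_presentation :: "'o \<times> 'o \<Rightarrow> 'o \<times> 'o \<Rightarrow> 'o \<times> 'o \<Rightarrow> ('o, 'm) presentation
    \<Rightarrow> ('o, 'm) presentation" where
  "right_presentation (A, A') (B, B') (Z, Z') (P, Q, f, g) =
    (P, Q, param_right P A Q B f Z, param_left Z' Q B' P A' g)"

fun left_presentation :: "'o \<times> 'o \<Rightarrow> 'o \<times> 'o \<Rightarrow> 'o \<times> 'o \<Rightarrow> ('o, 'm) presentation
    \<Rightarrow> ('o, 'm) presentation" where
  "left_presentation (Z, Z') (A, A') (B, B') (P, Q, f, g) =
    (P, Q, param_left Z P A Q B f, param_right Q B' P A' g Z')"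

abbreviation (input) Ob where "Ob \<equiv> Obj C \<times> Obj C"

lemma comp_presentation_in:
  assumes "X \<in> Ob" "Y \<in> Ob" "Z \<in> Ob" "x \<in> presentations C X Y" "y \<in> presentations C Y Z"
  shows "comp_presentation X Y Z y x \<in> presentations C X Z"
  using assms by (cases X; cases Y; cases Z; cases x; cases y)
    (auto simp: presentations_param_map intro!: param_comp_param_map)

lemma right_presentation_in:
  assumes "X \<in> Ob" "Y \<in> Ob" "Z \<in> Ob" "x \<in> presentations C X Y"
  shows "right_presentation X Y Z x \<in> presentations C (learner_tensor_obj C X Z) (learner_tensor_obj C Y Z)"
  using assms by (cases X; cases Y; cases Z; cases x)
    (auto simp: presentations_param_map learner_tensor_obj_def intro!: param_right_param_map param_left_param_map)

lemma left_presentation_in: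
  assumes "X \<in> Ob" "Y \<in> Ob" "Z \<in> Ob" "x \<in> presentations C X Y"
  shows "left_presentation Z X Y x \<in> presentations C (learner_tensor_obj C Z X) (learner_tensor_obj C Z Y)"
  using assms by (cases X; cases Y; cases Z; cases x)
    (auto simp: presentations_param_map learner_tensor_obj_def intro!: param_right_param_map param_left_param_map)

lemma learner_eq_right:
  assumes "X \<in> Ob" "Y \<in> Ob" "Z \<in> Ob" "learner_eq C X Y x y"
  shows "learner_eq C (learner_tensor_obj C X Z) (learner_tensor_obj C Y Z)
    (right_presentation X Y Z x) (right_presentation X Y Z y)"
proof (rule learner_eq_lift[OF assms(4)])
  fix x assume "x \<in> presentations C X Y"
  with assms show "right_presentation X Y Z x \<in>
      presentations C (learner_tensor_obj C X Z) (learner_tensor_obj C Y Z)"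
    by (intro right_presentation_in)
next
  fix A A' B B' P P' Q Q' p q f g
  assume h [simp]: "X = (A, A')" "Y = (B, B')" and p: "p \<in> Hom C P P'" and q: "q \<in> Hom C Q Q'"
    and f: "param_map P' A Q B f" and g: "param_map Q' B' P A' g"
  obtain D D' where [simp]: "Z = (D, D')" by (cases Z)
  from assms have [simp]: "D \<in> Obj C" "D' \<in> Obj C" by auto
  have P: "P \<in> Obj C" "P' \<in> Obj C" "Q \<in> Obj C" "Q' \<in> Obj C" using p q by auto
  show "learner_eq C (learner_tensor_obj C X Z) (learner_tensor_obj C Y Z)
      (right_presentation X Y Z (P, Q', (q \<rhd> B) \<cdot> f \<cdot> (p \<rhd> A), g))
      (right_presentation X Y Z (P', Q, f, (p \<rhd> A') \<cdot> g \<cdot> (q \<rhd> B')))"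
    unfolding h right_presentation.simps \<open>Z = (D, D')\<close>
      param_whisker_param(1)[OF f p q \<open>D \<in> Obj C\<close>] param_whisker_param(2)[OF g q p \<open>D' \<in> Obj C\<close>]
    by (rule learner_eq.slide)
      (use p q P param_map_arr[OF f] param_map_arr[OF g] param_map_arr[OF param_right_param_map[OF f, of D]]
        param_map_arr[OF param_left_param_map[OF g, of D']] in \<open>simp_all add: learner_tensor_obj_def\<close>)
qed

lemma learner_eq_left:
  assumes "X \<in> Ob" "Y \<in> Ob" "Z \<in> Ob" "learner_eq C X Y x y"
  shows "learner_eq C (learner_tensor_obj C Z X) (learner_tensor_obj C Z Y)
    (left_presentation Z X Y x) (left_presentation Z X Y y)"
proof (rule learner_eq_lift[OF assms(4)])
  fix x assume "x \<in> presentations C X Y"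
  with assms show "left_presentation Z X Y x \<in>
      presentations C (learner_tensor_obj C Z X) (learner_tensor_obj C Z Y)"
    by (intro left_presentation_in)
next
  fix A A' B B' P P' Q Q' p q f g
  assume h [simp]: "X = (A, A')" "Y = (B, B')" and p: "p \<in> Hom C P P'" and q: "q \<in> Hom C Q Q'"
    and f: "param_map P' A Q B f" and g: "param_map Q' B' P A' g"
  obtain D D' where [simp]: "Z = (D, D')" by (cases Z)
  from assms have [simp]: "D \<in> Obj C" "D' \<in> Obj C" by auto
  have P: "P \<in> Obj C" "P' \<in> Obj C" "Q \<in> Obj C" "Q' \<in> Obj C" using p q by auto
  show "learner_eq C (learner_tensor_obj C Z X) (learner_tensor_obj C Z Y)
      (left_presentation Z X Y (P, Q', (q \<rhd> B) \<cdot> f \<cdot> (p \<rhd> A), g))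
      (left_presentation Z X Y (P', Q, f, (p \<rhd> A') \<cdot> g \<cdot> (q \<rhd> B')))"
    unfolding h left_presentation.simps \<open>Z = (D, D')\<close>
      param_whisker_param(2)[OF f p q \<open>D \<in> Obj C\<close>] param_whisker_param(1)[OF g q p \<open>D' \<in> Obj C\<close>]
    by (rule learner_eq.slide)
      (use p q P param_map_arr[OF f] param_map_arr[OF g] param_map_arr[OF param_left_param_map[OF f, of D]]
        param_map_arr[OF param_right_param_map[OF g, of D']] in \<open>simp_all add: learner_tensor_obj_def\<close>)
qed

lemma learner_eq_comp:
  assumes XYZ: "X \<in> Ob" "Y \<in> Ob" "Z \<in> Ob" and x: "learner_eq C X Y x x'" and y: "learner_eq C Y Z y y'"
  shows "learner_eq C X Z (comp_presentation X Y Z y x) (comp_presentation X Y Z y' x')"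
proof (rule learner_eq.trans)
  have in_pres: "x \<in> presentations C X Y" "x' \<in> presentations C X Y" "y \<in> presentations C Y Z" "y' \<in> presentations C Y Z"
    using learner_eq_presentations[OF x] learner_eq_presentations[OF y] by auto
  obtain A A' B B' D D' where [simp]: "X = (A, A')" "Y = (B, B')" "Z = (D, D')" by (cases X; cases Y; cases Z)
  from XYZ have [simp]: "A \<in> Obj C" "A' \<in> Obj C" "B \<in> Obj C" "B' \<in> Obj C" "D \<in> Obj C" "D' \<in> Obj C" by auto
  show "learner_eq C X Z (comp_presentation X Y Z y x) (comp_presentation X Y Z y x')"
  proof (rule learner_eq_lift[OF x])
    show "comp_presentation X Y Z y z \<in> presentations C X Z" if "z \<in> presentations C X Y" for z
      using comp_presentation_in[OF XYZ that in_pres(3)] .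
  next
    fix A1 A1' B1 B1' P P' Q Q' p q f g
    assume "X = (A1, A1')" "Y = (B1, B1')"
    then have h: "A1 = A" "A1' = A'" "B1 = B" "B1' = B'" by simp_all
    assume p: "p \<in> Hom C P P'" and q: "q \<in> Hom C Q Q'" and "param_map P' A1 Q B1 f" "param_map Q' B1' P A1' g"
    then have f: "param_map P' A Q B f" and g: "param_map Q' B' P A' g" by (simp_all add: h)
    obtain P2 Q2 l r where y_def [simp]: "y = (P2, Q2, l, r)" by (cases y)
    then have l: "param_map P2 B Q2 D l" and r: "param_map Q2 D' P2 B' r" using in_pres(3) by (simp_all add: presentations_param_map)
    note [simp] = param_map_arr[OF f] param_map_arr[OF g] param_map_arr[OF l] param_map_arr[OF r] p[unfolded Hom_iff] q[unfolded Hom_iff]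
    have [simp]: "P \<in> Obj C" "P' \<in> Obj C" "Q \<in> Obj C" "Q' \<in> Obj C" using p q by auto
    have 1: "param_comp C P Q' P2 Q2 A B D ((q \<rhd> B) \<cdot> f \<cdot> (p \<rhd> A)) l =
        ((q \<rhd> Q2) \<rhd> D) \<cdot> param_comp C P' Q P2 Q2 A B D f l \<cdot> ((P2 \<lhd> p) \<rhd> A)"
      using param_comp_natural[OF f l p q, of "Ident C P2" P2 "Ident C Q2" Q2] by simp
    have 2: "param_comp C Q2 P2 Q P' D' B' A' r ((p \<rhd> A') \<cdot> g \<cdot> (q \<rhd> B')) =
        ((P2 \<lhd> p) \<rhd> A') \<cdot> param_comp C Q2 P2 Q' P D' B' A' r g \<cdot> ((q \<rhd> Q2) \<rhd> D')"
      using param_comp_natural[OF r g, of "Ident C Q2" Q2 "Ident C P2" P2 q Q p P'] by simp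
    show "learner_eq C X Z (comp_presentation X Y Z y (P, Q', (q \<rhd> B1) \<cdot> f \<cdot> (p \<rhd> A1), g))
      (comp_presentation X Y Z y (P', Q, f, (p \<rhd> A1') \<cdot> g \<cdot> (q \<rhd> B1')))"
      unfolding h \<open>X = (A, A')\<close> \<open>Y = (B, B')\<close> \<open>Z = (D, D')\<close> y_def comp_presentation.simps 1 2
      by (rule learner_eq.slide) (use param_map_arr[OF param_comp_param_map[OF f l]] param_map_arr[OF param_comp_param_map[OF r g]] in simp_all)
  qed
  show "learner_eq C X Z (comp_presentation X Y Z y x') (comp_presentation X Y Z y' x')"
  proof (rule learner_eq_lift[OF y, where F = "\<lambda>y. comp_presentation X Y Z y x'"])
    show "comp_presentation X Y Z z x' \<in> presentations C X Z" if "z \<in> presentations C Y Z" for z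
      using comp_presentation_in[OF XYZ in_pres(2) that] .
  next
    fix A1 A1' B1 B1' P P' Q Q' p q f g
    assume "Y = (A1, A1')" "Z = (B1, B1')"
    then have h: "A1 = B" "A1' = B'" "B1 = D" "B1' = D'" by simp_all
    assume p: "p \<in> Hom C P P'" and q: "q \<in> Hom C Q Q'" and "param_map P' A1 Q B1 f" "param_map Q' B1' P A1' g"
    then have f: "param_map P' B Q D f" and g: "param_map Q' D' P B' g" by (simp_all add: h)
    obtain P1 Q1 l r where x_def [simp]: "x' = (P1, Q1, l, r)" by (cases x')
    then have l: "param_map P1 A Q1 B l" and r: "param_map Q1 B' P1 A' r" using in_pres(2) by (simp_all add: presentations_param_map)
    note [simp] = param_map_arr[OF f] param_map_arr[OF g] param_map_arr[OF l] param_map_arr[OF r] p[unfolded Hom_iff] q[unfolded Hom_iff]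
    have [simp]: "P \<in> Obj C" "P' \<in> Obj C" "Q \<in> Obj C" "Q' \<in> Obj C" using p q by auto
    have 1: "param_comp C P1 Q1 P Q' A B D l ((q \<rhd> D) \<cdot> f \<cdot> (p \<rhd> B)) =
        ((Q1 \<lhd> q) \<rhd> D) \<cdot> param_comp C P1 Q1 P' Q A B D l f \<cdot> ((p \<rhd> P1) \<rhd> A)"
      using param_comp_natural[OF l f, of "Ident C P1" P1 "Ident C Q1" Q1 p P q Q'] by simp
    have 2: "param_comp C Q P' Q1 P1 D' B' A' ((p \<rhd> B') \<cdot> g \<cdot> (q \<rhd> D')) r =
        ((p \<rhd> P1) \<rhd> A') \<cdot> param_comp C Q' P Q1 P1 D' B' A' g r \<cdot> ((Q1 \<lhd> q) \<rhd> D')"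
      using param_comp_natural[OF g r, of q Q p P' "Ident C Q1" Q1 "Ident C P1" P1] by simp
    show "learner_eq C X Z (comp_presentation X Y Z (P, Q', (q \<rhd> B1) \<cdot> f \<cdot> (p \<rhd> A1), g) x')
      (comp_presentation X Y Z (P', Q, f, (p \<rhd> A1') \<cdot> g \<cdot> (q \<rhd> B1')) x')"
      unfolding h \<open>X = (A, A')\<close> \<open>Y = (B, B')\<close> \<open>Z = (D, D')\<close> x_def comp_presentation.simps 1 2
      by (rule learner_eq.slide) (use param_map_arr[OF param_comp_param_map[OF l f]] param_map_arr[OF param_comp_param_map[OF g r]] in simp_all)
  qed
qed

lemma UN_learner_classes:
  assumes x: "x \<in> presentations C X Y" and y: "y \<in> presentations C X' Y'"
    and G: "\<And>x' y'. \<lbrakk>learner_eq C X Y x x'; learner_eq C X' Y' y y'\<rbrakk> \<Longrightarrow> G x' y' = G x y"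
  shows "(\<Union>x' \<in> learner_class C X Y x. \<Union>y' \<in> learner_class C X' Y' y. G x' y') = G x y"
proof -
  have "(\<Union>x' \<in> learner_class C X Y x. \<Union>y' \<in> learner_class C X' Y' y. G x' y') =
      (\<Union>x' \<in> learner_class C X Y x. \<Union>y' \<in> learner_class C X' Y' y. G x y)"
    by (intro SUP_cong HOL.refl) (simp add: learner_class_def G)
  also have "\<dots> = G x y"
    using learner_class_self[OF x] learner_class_self[OF y] by auto
  finally show ?thesis .
qed

lemma learner_comp_of:
  assumes XYZ: "X \<in> Ob" "Y \<in> Ob" "Z \<in> Ob" and x: "x \<in> presentations C X Y" and y: "y \<in> presentations C Y Z"
  shows "learner_comp C (learner_of C Y Z y) (learner_of C X Y x) = learner_of C X Z (comp_presentation X Y Z y x)"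
proof -
  have "learner_comp C (learner_of C Y Z y) (learner_of C X Y x) =
      (X, Z, \<Union>x' \<in> learner_class C X Y x. \<Union>y' \<in> learner_class C Y Z y.
        learner_class C X Z (comp_presentation X Y Z y' x'))"
    by (cases X; cases Y; cases Z) (auto simp: learner_comp_def learner_of_def intro!: SUP_cong)
  also have "(\<Union>x' \<in> learner_class C X Y x. \<Union>y' \<in> learner_class C Y Z y.
        learner_class C X Z (comp_presentation X Y Z y' x')) = learner_class C X Z (comp_presentation X Y Z y x)"
  proof (rule UN_learner_classes[OF x y])
    fix x' y' assume "learner_eq C X Y x x'" "learner_eq C Y Z y y'"
    then show "learner_class C X Z (comp_presentation X Y Z y' x') = learner_class C X Z (comp_presentation X Y Z y x)"
      by (intro learner_class_eqI[symmetric] learner_eq_comp[OF XYZ])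
  qed
  finally show ?thesis by (simp add: learner_of_def)
qed

end

section \<open>The symmetric monoidal category of learners\<close>

context symmetric_monoidal_category
begin

abbreviation learner where
  "learner A A' B B' P Q f g \<equiv> learner_of C (A, A') (B, B') (P, Q, f, g)"

lemma learner_cases:
  assumes "u \<in> learners C"
  obtains A A' B B' P Q f g where "param_map P A Q B f" "param_map Q B' P A' g" "u = learner A A' B B' P Q f g"
proof -
  from assms obtain X Y x where u: "u = learner_of C X Y x" "X \<in> Ob" "Y \<in> Ob" "x \<in> presentations C X Y"
    by (auto simp: learners_def)
  obtain A A' B B' P Q f g where "X = (A, A')" "Y = (B, B')" "x = (P, Q, f, g)"
    by (cases X; cases Y; cases x)
  with u show ?thesis by (intro that[of P A Q B f B' A' g]) (simp_all add: presentations_param_map)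
qed

lemma learner_in:
  assumes "param_map P A Q B f" "param_map Q B' P A' g"
  shows "learner A A' B B' P Q f g \<in> learners C"
proof -
  have "(P, Q, f, g) \<in> presentations C (A, A') (B, B')"
    using assms param_map_arr[OF assms(1)] param_map_arr[OF assms(2)] by (simp add: presentations_param_map)
  then show ?thesis
    unfolding learners_def using param_map_arr[OF assms(1)] param_map_arr[OF assms(2)]
    by (intro CollectI exI[of _ "(A, A')"] exI[of _ "(B, B')"] exI[of _ "(P, Q, f, g)"]) simp
qed

lemma Learn_simps [simp]:
  "Obj (Learn C) = Ob"
  "Arr (Learn C) = learners C"
  "Dom (Learn C) (learner_of C X Y x) = X"
  "Cod (Learn C) (learner_of C X Y x) = Y"
  "Ident (Learn C) = learner_id C"
  "Comp (Learn C) = learner_comp C"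
  "TensorObj (Learn C) = learner_tensor_obj C"
  "TensorArr (Learn C) = learner_tensor C"
  "Unit (Learn C) = (\<one>, \<one>)"
  "\<a>\<^bsub>Learn C\<^esub> (A, A') (B, B') (D, D') = learner_iota C (\<a> A B D) (\<a> D' B' A')"
  "\<l>\<^bsub>Learn C\<^esub> (A, A') = learner_iota C (\<l> A) (inv (\<r> A'))"
  "\<r>\<^bsub>Learn C\<^esub> (A, A') = learner_iota C (\<r> A) (inv (\<l> A'))"
  "\<s>\<^bsub>Learn C\<^esub> (A, A') (B, B') = learner_iota C (\<s> A B) (\<s> A' B')"
  by (simp_all add: Learn_def learner_of_def)

lemma learner_comp_learner:
  assumes "param_map P\<^sub>1 A Q\<^sub>1 B f\<^sub>1" "param_map Q\<^sub>1 B' P\<^sub>1 A' g\<^sub>1" "param_map P\<^sub>2 B Q\<^sub>2 D f\<^sub>2" "param_map Q\<^sub>2 D' P\<^sub>2 B' g\<^sub>2"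
  shows "learner_comp C (learner B B' D D' P\<^sub>2 Q\<^sub>2 f\<^sub>2 g\<^sub>2) (learner A A' B B' P\<^sub>1 Q\<^sub>1 f\<^sub>1 g\<^sub>1) =
    learner A A' D D' (P\<^sub>2 \<otimes> P\<^sub>1) (Q\<^sub>1 \<otimes> Q\<^sub>2) (param_comp C P\<^sub>1 Q\<^sub>1 P\<^sub>2 Q\<^sub>2 A B D f\<^sub>1 f\<^sub>2)
      (param_comp C Q\<^sub>2 P\<^sub>2 Q\<^sub>1 P\<^sub>1 D' B' A' g\<^sub>2 g\<^sub>1)"
  using assms param_map_arr[OF assms(1)] param_map_arr[OF assms(2)] param_map_arr[OF assms(3)] param_map_arr[OF assms(4)]
  by (subst learner_comp_of) (auto simp: presentations_param_map)

lemma learner_eqI: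
  assumes "param_map P A Q B f" "param_map Q B' P A' g" "param_map P' A Q' B f'" "param_map Q' B' P' A' g'"
    and "p \<in> Hom C P P'" "iso_arr C p" "q \<in> Hom C Q Q'"
    and "f' \<cdot> (p \<rhd> A) = (q \<rhd> B) \<cdot> f" "(p \<rhd> A') \<cdot> g = g' \<cdot> (q \<rhd> B')"
  shows "learner A A' B B' P Q f g = learner A A' B B' P' Q' f' g'"
  by (rule learner_of_eqI[OF learner_eq_iso[OF assms]])

lemma learner_comp_assoc:
  assumes f: "param_map P1 A Q1 B f" "param_map Q1 B' P1 A' f'" and g: "param_map P2 B Q2 D g" "param_map Q2 D' P2 B' g'"
    and h: "param_map P3 D Q3 E h" "param_map Q3 E' P3 D' h'"
  shows "learner_comp C (learner_comp C (learner D D' E E' P3 Q3 h h') (learner B B' D D' P2 Q2 g g'))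
      (learner A A' B B' P1 Q1 f f') =
    learner_comp C (learner D D' E E' P3 Q3 h h')
      (learner_comp C (learner B B' D D' P2 Q2 g g') (learner A A' B B' P1 Q1 f f'))"
proof -
  note gf = param_comp_param_map[OF f(1) g(1)] param_comp_param_map[OF g(2) f(2)]
  note hg = param_comp_param_map[OF g(1) h(1)] param_comp_param_map[OF h(2) g(2)]
  note l = param_comp_param_map[OF f(1) hg(1)] param_comp_param_map[OF hg(2) f(2)]
  note r = param_comp_param_map[OF gf(1) h(1)] param_comp_param_map[OF h(2) gf(2)]
  note [simp] = param_map_arr[OF f(1)] param_map_arr[OF g(1)] param_map_arr[OF h(1)] param_map_arr[OF l(2)] param_map_arr[OF r(2)]
  \<comment> \<open>Second components compose in the opposite order, so here the other bracketing has to be solved for.\<close>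
  have "(\<a> P3 P2 P1 \<rhd> A') \<cdot> param_comp C (Q2 \<otimes> Q3) (P3 \<otimes> P2) Q1 P1 E' B' A' (param_comp C Q3 P3 Q2 P2 E' D' B' h' g') f' =
    param_comp C Q3 P3 (Q1 \<otimes> Q2) (P2 \<otimes> P1) E' D' A' h' (param_comp C Q2 P2 Q1 P1 D' B' A' g' f') \<cdot> (inv (\<a> Q1 Q2 Q3) \<rhd> E')"
  proof (rule iso_epi[where h = "\<a> Q1 Q2 Q3 \<rhd> E'"])
    have "(\<a> P3 P2 P1 \<rhd> A') \<cdot> (param_comp C (Q2 \<otimes> Q3) (P3 \<otimes> P2) Q1 P1 E' B' A' (param_comp C Q3 P3 Q2 P2 E' D' B' h' g') f'
        \<cdot> (\<a> Q1 Q2 Q3 \<rhd> E')) =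
      (\<a> P3 P2 P1 \<rhd> A') \<cdot> (inv (\<a> P3 P2 P1) \<rhd> A') \<cdot>
        param_comp C Q3 P3 (Q1 \<otimes> Q2) (P2 \<otimes> P1) E' D' A' h' (param_comp C Q2 P2 Q1 P1 D' B' A' g' f')"
      by (simp only: param_comp_assoc[OF h(2) g(2) f(2)])
    then show "((\<a> P3 P2 P1 \<rhd> A') \<cdot> param_comp C (Q2 \<otimes> Q3) (P3 \<otimes> P2) Q1 P1 E' B' A' (param_comp C Q3 P3 Q2 P2 E' D' B' h' g') f')
        \<cdot> (\<a> Q1 Q2 Q3 \<rhd> E') =
      (param_comp C Q3 P3 (Q1 \<otimes> Q2) (P2 \<otimes> P1) E' D' A' h' (param_comp C Q2 P2 Q1 P1 D' B' A' g' f') \<cdot> (inv (\<a> Q1 Q2 Q3) \<rhd> E'))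
        \<cdot> (\<a> Q1 Q2 Q3 \<rhd> E')"
      using param_map_arr[OF h(2)] param_map_arr[OF f(2)] by simp
  qed (use param_map_arr[OF h(2)] param_map_arr[OF f(2)] in simp_all)
  then show ?thesis
    unfolding learner_comp_learner[OF f g] learner_comp_learner[OF g h]
      learner_comp_learner[OF f hg] learner_comp_learner[OF gf h]
    by (intro learner_eqI[OF l r, of "\<a> P3 P2 P1" "inv (\<a> Q1 Q2 Q3)"] param_comp_assoc[OF f(1) g(1) h(1)])
      simp_all
qed

lemma iota_param_map: "f \<in> Arr C \<Longrightarrow> Dom C f = A \<Longrightarrow> Cod C f = B \<Longrightarrow> param_map \<one> A \<one> B (\<one> \<lhd> f)"
  by (auto simp: param_map_def)

lemma learner_iota_eq:
  assumes "f \<in> Hom C A B" "f' \<in> Hom C B' A'"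
  shows "learner_iota C f f' = learner A A' B B' \<one> \<one> (\<one> \<lhd> f) (\<one> \<lhd> f')"
  using assms by (simp add: learner_iota_def)

text \<open>Composing with an arrow from \<open>C \<times> C\<^sup>o\<^sup>p\<close> can be presented with unchanged parameters, so no coherence is needed
  to compare such composites.\<close>

lemma learner_comp_iota_left:
  assumes f: "param_map P A Q B f" and g: "param_map Q B' P A' g" and k: "k \<in> Hom C B D" "k' \<in> Hom C D' B'"
  shows "learner_comp C (learner_iota C k k') (learner A A' B B' P Q f g) =
    learner A A' D D' P Q ((Q \<lhd> k) \<cdot> f) (g \<cdot> (Q \<lhd> k'))"
proof -
  have [simp]: "D \<in> Obj C" "D' \<in> Obj C" using k by auto
  note [simp] = param_map_arr[OF f] param_map_arr[OF g] k[unfolded Hom_iff]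
  have \<iota>: "param_map \<one> B \<one> D (\<one> \<lhd> k)" "param_map \<one> D' \<one> B' (\<one> \<lhd> k')" using k by (auto intro: iota_param_map)
  show ?thesis
    unfolding learner_iota_eq[OF k] learner_comp_learner[OF f g \<iota>]
  proof (rule learner_eqI[OF param_comp_param_map[OF f \<iota>(1)] param_comp_param_map[OF \<iota>(2) g], of _ _ _ _ "\<l> P" "\<r> Q"])
    show "((Q \<lhd> k) \<cdot> f) \<cdot> (\<l> P \<rhd> A) = (\<r> Q \<rhd> D) \<cdot> param_comp C P Q \<one> \<one> A B D f (\<one> \<lhd> k)"
      by (simp add: param_comp_iota_left[OF f k(1)])
    show "(\<l> P \<rhd> A') \<cdot> param_comp C \<one> \<one> Q P D' B' A' (\<one> \<lhd> k') g = (g \<cdot> (Q \<lhd> k')) \<cdot> (\<r> Q \<rhd> D')"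
      by (simp add: param_comp_iota_right[OF g k(2)])
  qed (simp_all add: param_map_def)
qed

lemma learner_comp_iota_right:
  assumes f: "param_map P A Q B f" and g: "param_map Q B' P A' g" and k: "k \<in> Hom C D A" "k' \<in> Hom C A' D'"
  shows "learner_comp C (learner A A' B B' P Q f g) (learner_iota C k k') =
    learner D D' B B' P Q (f \<cdot> (P \<lhd> k)) ((P \<lhd> k') \<cdot> g)"
proof -
  have [simp]: "D \<in> Obj C" "D' \<in> Obj C" using k by auto
  note [simp] = param_map_arr[OF f] param_map_arr[OF g] k[unfolded Hom_iff]
  have \<iota>: "param_map \<one> D \<one> A (\<one> \<lhd> k)" "param_map \<one> A' \<one> D' (\<one> \<lhd> k')" using k by (auto intro: iota_param_map)
  show ?thesis
    unfolding learner_iota_eq[OF k] learner_comp_learner[OF \<iota> f g]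
  proof (rule learner_eqI[OF param_comp_param_map[OF \<iota>(1) f] param_comp_param_map[OF g \<iota>(2)], of _ _ _ _ "\<r> P" "\<l> Q"])
    show "(f \<cdot> (P \<lhd> k)) \<cdot> (\<r> P \<rhd> D) = (\<l> Q \<rhd> B) \<cdot> param_comp C \<one> \<one> P Q D A B (\<one> \<lhd> k) f"
      by (simp add: param_comp_iota_right[OF f k(1)])
    show "(\<r> P \<rhd> D') \<cdot> param_comp C Q P \<one> \<one> B' A' D' g (\<one> \<lhd> k') = ((P \<lhd> k') \<cdot> g) \<cdot> (\<l> Q \<rhd> B')"
      by (simp add: param_comp_iota_left[OF g k(2)])
  qed (simp_all add: param_map_def)
qed

lemma learner_id_iota: "A \<in> Obj C \<Longrightarrow> A' \<in> Obj C \<Longrightarrow> learner_id C (A, A') = learner_iota C (Ident C A) (Ident C A')"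
  by (simp add: learner_id_def learner_iota_def)

lemma learner_iota_in:
  assumes "f \<in> Arr C" "f' \<in> Arr C"
  shows "learner_iota C f f' \<in> learners C"
  unfolding learner_iota_def using assms by (intro learner_in iota_param_map) simp_all

lemma category_Learn: "category (Learn C)"
proof
  fix u assume "u \<in> Arr (Learn C)"
  then show "Dom (Learn C) u \<in> Obj (Learn C)" "Cod (Learn C) u \<in> Obj (Learn C)"
    by (auto elim!: learner_cases dest: param_map_arr)
next
  fix X assume "X \<in> Obj (Learn C)"
  then show "Ident (Learn C) X \<in> Hom (Learn C) X X"
    by (auto simp: learner_id_iota learner_iota_in) (simp_all add: learner_iota_def)
next
  fix u v X Y Z
  assume "u \<in> Hom (Learn C) X Y" "v \<in> Hom (Learn C) Y Z"
  then show "v \<cdot>\<^bsub>Learn C\<^esub> u \<in> Hom (Learn C) X Z"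
    by (auto elim!: learner_cases simp: learner_comp_learner intro!: learner_in param_comp_param_map)
next
  fix u X Y
  assume u: "u \<in> Hom (Learn C) X Y"
  then show "u \<cdot>\<^bsub>Learn C\<^esub> Ident (Learn C) X = u"
    by (auto elim!: learner_cases simp: learner_id_iota param_map_arr learner_comp_iota_right)
  show "Ident (Learn C) Y \<cdot>\<^bsub>Learn C\<^esub> u = u"
    using u by (auto elim!: learner_cases simp: learner_id_iota param_map_arr learner_comp_iota_left)
next
  fix u v w X Y Z T
  assume "u \<in> Hom (Learn C) X Y" "v \<in> Hom (Learn C) Y Z" "w \<in> Hom (Learn C) Z T"
  then show "(w \<cdot>\<^bsub>Learn C\<^esub> v) \<cdot>\<^bsub>Learn C\<^esub> u = w \<cdot>\<^bsub>Learn C\<^esub> v \<cdot>\<^bsub>Learn C\<^esub> u"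
    by (auto elim!: learner_cases simp: learner_comp_assoc)
qed

text \<open>Right whiskering of learners, in the same form as composition: a union of the classes obtained from all
  representatives.\<close>

definition learner_right :: "('o, 'm) learner \<Rightarrow> 'o \<times> 'o \<Rightarrow> ('o, 'm) learner" where
  "learner_right = (\<lambda>(X, Y, c) Z. (learner_tensor_obj C X Z, learner_tensor_obj C Y Z,
     \<Union>x \<in> c. learner_class C (learner_tensor_obj C X Z) (learner_tensor_obj C Y Z) (right_presentation X Y Z x)))"

lemma learner_right_learner:
  assumes f: "param_map P A Q B f" and g: "param_map Q B' P A' g" and Z: "Z \<in> Obj C" "Z' \<in> Obj C"
  shows "learner_right (learner A A' B B' P Q f g) (Z, Z') =
    learner (A \<otimes> Z) (Z' \<otimes> A') (B \<otimes> Z) (Z' \<otimes> B') P Q (param_right P A Q B f Z) (param_left Z' Q B' P A' g)"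
proof -
  let ?x = "(P, Q, f, g)" and ?X = "(A, A')" and ?Y = "(B, B')" and ?Z = "(Z, Z')"
  note [simp] = param_map_arr[OF f] param_map_arr[OF g] Z
  have x: "?x \<in> presentations C ?X ?Y" using f g by (simp add: presentations_param_map)
  have "learner_class C (learner_tensor_obj C ?X ?Z) (learner_tensor_obj C ?Y ?Z) (right_presentation ?X ?Y ?Z y) =
      learner_class C (learner_tensor_obj C ?X ?Z) (learner_tensor_obj C ?Y ?Z) (right_presentation ?X ?Y ?Z ?x)"
    if "learner_eq C ?X ?Y ?x y" for y
    by (intro learner_class_eqI[symmetric] learner_eq_right that) simp_all
  then have "(\<Union>y \<in> learner_class C ?X ?Y ?x. learner_class C (learner_tensor_obj C ?X ?Z) (learner_tensor_obj C ?Y ?Z)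
        (right_presentation ?X ?Y ?Z y)) =
      (\<Union>y \<in> learner_class C ?X ?Y ?x. learner_class C (learner_tensor_obj C ?X ?Z) (learner_tensor_obj C ?Y ?Z)
        (right_presentation ?X ?Y ?Z ?x))"
    by (intro SUP_cong HOL.refl) (simp add: learner_class_def)
  also have "\<dots> = learner_class C (learner_tensor_obj C ?X ?Z) (learner_tensor_obj C ?Y ?Z) (right_presentation ?X ?Y ?Z ?x)"
    using learner_class_self[OF x] by auto
  finally show ?thesis
    by (simp add: learner_right_def learner_of_def) (simp add: learner_tensor_obj_def)
qed

text \<open>Each representative of a tensor product is, by \<open>param_tensor_comp\<close>, a composite of whiskered presentations.
  So well-definedness is inherited from composition and whiskering.\<close>

lemma learner_tensor_learner:
  assumes f: "param_map P A Q B f" "param_map Q B' P A' f'" and g: "param_map S D T E g" "param_map T E' S D' g'"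
  shows "learner_tensor C (learner A A' B B' P Q f f') (learner D D' E E' S T g g') =
    learner (A \<otimes> D) (D' \<otimes> A') (B \<otimes> E) (E' \<otimes> B') (P \<otimes> S) (T \<otimes> Q)
      (param_comp C S T P Q (A \<otimes> D) (A \<otimes> E) (B \<otimes> E) (param_left A S D T E g) (param_right P A Q B f E))
      (param_comp C Q P T S (E' \<otimes> B') (E' \<otimes> A') (D' \<otimes> A') (param_left E' Q B' P A' f') (param_right T E' S D' g' A'))"
proof -
  let ?x = "(P, Q, f, f')" and ?y = "(S, T, g, g')"
  let ?G = "\<lambda>x y. comp_presentation (A \<otimes> D, D' \<otimes> A') (A \<otimes> E, E' \<otimes> A') (B \<otimes> E, E' \<otimes> B')
    (right_presentation (A, A') (B, B') (E, E') x) (left_presentation (A, A') (D, D') (E, E') y)"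
  let ?cl = "\<lambda>x y. learner_class C (A \<otimes> D, D' \<otimes> A') (B \<otimes> E, E' \<otimes> B') (?G x y)"
  note [simp] = param_map_arr[OF f(1)] param_map_arr[OF f(2)] param_map_arr[OF g(1)] param_map_arr[OF g(2)]
  have x: "?x \<in> presentations C (A, A') (B, B')" and y: "?y \<in> presentations C (D, D') (E, E')"
    using f g by (simp_all add: presentations_param_map)
  have "learner_tensor C (learner A A' B B' P Q f f') (learner D D' E E' S T g g') =
     ((A \<otimes> D, D' \<otimes> A'), (B \<otimes> E, E' \<otimes> B'),
      \<Union>x \<in> learner_class C (A, A') (B, B') ?x. \<Union>y \<in> learner_class C (D, D') (E, E') ?y. ?cl x y)"
  proof -
    have "learner_class C (A \<otimes> D, D' \<otimes> A') (B \<otimes> E, E' \<otimes> B') (P \<otimes> S, T \<otimes> Q,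
            param_tensor C P Q S T A B D E f g, param_tensor C T S Q P E' D' B' A' g' f') =
         ?cl (P, Q, f, f') (S, T, g, g')"
      if "(P, Q, f, f') \<in> learner_class C (A, A') (B, B') ?x" "(S, T, g, g') \<in> learner_class C (D, D') (E, E') ?y"
      for P Q f f' S T g g'
    proof -
      have "(P, Q, f, f') \<in> presentations C (A, A') (B, B')" "(S, T, g, g') \<in> presentations C (D, D') (E, E')"
        using that learner_eq_presentations by (auto simp: learner_class_def)
      then have *: "param_map P A Q B f" "param_map Q B' P A' f'" "param_map S D T E g" "param_map T E' S D' g'"
        by (simp_all add: presentations_param_map)
      show ?thesis by (simp add: param_tensor_comp[OF *(1,3)] param_tensor_comp[OF *(4,2)])
    qed
    then show ?thesis
      by (auto simp: learner_tensor_def learner_of_def learner_tensor_obj_def Let_def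
        simp del: comp_presentation.simps left_presentation.simps right_presentation.simps intro!: SUP_cong)
  qed
  also have "(\<Union>x \<in> learner_class C (A, A') (B, B') ?x. \<Union>y \<in> learner_class C (D, D') (E, E') ?y. ?cl x y) = ?cl ?x ?y"
  proof (rule UN_learner_classes[OF x y])
    fix x' y' assume "learner_eq C (A, A') (B, B') ?x x'" "learner_eq C (D, D') (E, E') ?y y'"
    then have "learner_eq C (A \<otimes> D, D' \<otimes> A') (B \<otimes> E, E' \<otimes> B') (?G ?x ?y) (?G x' y')"
      using learner_eq_right[of "(A, A')" "(B, B')" "(E, E')" ?x x'] learner_eq_left[of "(D, D')" "(E, E')" "(A, A')" ?y y']
      by (intro learner_eq_comp) (simp_all add: learner_tensor_obj_def)
    then show "?cl x' y' = ?cl ?x ?y"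
      by (rule learner_class_eqI[symmetric])
  qed
  finally show ?thesis by (simp add: learner_of_def)
qed

lemma learner_comp_iota:
  assumes f: "f \<in> Hom C A B" "f' \<in> Hom C B' A'" and g: "g \<in> Hom C B D" "g' \<in> Hom C D' B'"
  shows "learner_comp C (learner_iota C g g') (learner_iota C f f') = learner_iota C (g \<cdot> f) (f' \<cdot> g')"
proof -
  have \<iota>: "param_map \<one> A \<one> B (\<one> \<lhd> f)" "param_map \<one> B' \<one> A' (\<one> \<lhd> f')" using f by (auto intro: iota_param_map)
  have "g \<cdot> f \<in> Hom C A D" "f' \<cdot> g' \<in> Hom C D' A'" using f g by auto
  from learner_iota_eq[OF this] learner_iota_eq[OF f] learner_comp_iota_left[OF \<iota> g] show ?thesis
    using f g by simp
qed

text \<open>Composing with arrows from \<open>C \<times> C\<^sup>o\<^sup>p\<close> keeps the parameters, and so does whiskering. Hence, for all conditions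
  but one, both sides have presentations with equal parameters. The exception is the interchange of left
  and right whiskering.\<close>

lemma central_action_Learn:
  "central_action (with_opposite C) (Learn C) (\<lambda>(f, f'). learner_iota C f f') learner_right"
proof -
  interpret M: symmetric_monoidal_category "with_opposite C" by (rule symmetric_monoidal_with_opposite)
  interpret N: category "Learn C" by (rule category_Learn)
  show ?thesis
  proof
    show "TensorObj (Learn C) = TensorObj (with_opposite C)"
      by (simp add: with_opposite_def)
  next
    fix f assume "f \<in> Arr (with_opposite C)"
    then show "(\<lambda>(f, f'). learner_iota C f f') f \<in> Hom (Learn C) (Dom (with_opposite C) f) (Cod (with_opposite C) f)"
      by (auto simp: learner_iota_in) (simp_all add: learner_iota_def)
  next
    fix f g assume "f \<in> Arr (with_opposite C)" "g \<in> Arr (with_opposite C)"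
      "Dom (with_opposite C) g = Cod (with_opposite C) f"
    then show "(\<lambda>(f, f'). learner_iota C f f') g \<cdot>\<^bsub>Learn C\<^esub> (\<lambda>(f, f'). learner_iota C f f') f =
        (\<lambda>(f, f'). learner_iota C f f') (g \<cdot>\<^bsub>with_opposite C\<^esub> f)"
      by (auto simp: learner_comp_iota)
  next
    fix u Z assume "u \<in> Arr (Learn C)" "Z \<in> Obj (with_opposite C)"
    then show "learner_right u Z \<in> Hom (Learn C) (Dom (Learn C) u \<otimes>\<^bsub>with_opposite C\<^esub> Z)
        (Cod (Learn C) u \<otimes>\<^bsub>with_opposite C\<^esub> Z)"
      by (auto elim!: learner_cases simp: learner_right_learner intro!: learner_in param_right_param_map param_left_param_map)
  next
    fix u v Z
    assume "u \<in> Arr (Learn C)" "v \<in> Arr (Learn C)" "Dom (Learn C) v = Cod (Learn C) u" "Z \<in> Obj (with_opposite C)"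
    then show "learner_right (v \<cdot>\<^bsub>Learn C\<^esub> u) Z = learner_right v Z \<cdot>\<^bsub>Learn C\<^esub> learner_right u Z"
      by (auto elim!: learner_cases simp: learner_right_learner learner_comp_learner param_comp_param_map
        param_right_param_map param_left_param_map param_right_comp param_left_comp)
  next
    fix f Z assume "f \<in> Arr (with_opposite C)" "Z \<in> Obj (with_opposite C)"
    then show "learner_right ((\<lambda>(f, f'). learner_iota C f f') f) Z =
        (\<lambda>(f, f'). learner_iota C f f') (f \<boxtimes>\<^bsub>with_opposite C\<^esub> Ident (with_opposite C) Z)"
      by (auto simp: learner_iota_def learner_right_learner iota_param_map param_whisker_iota)
  next
    fix u k assume "u \<in> Arr (Learn C)" "k \<in> Arr (with_opposite C)"
    then show "(\<lambda>(f, f'). learner_iota C f f') (Ident (with_opposite C) (Cod (Learn C) u) \<boxtimes>\<^bsub>with_opposite C\<^esub> k)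
          \<cdot>\<^bsub>Learn C\<^esub> learner_right u (Dom (with_opposite C) k) =
        learner_right u (Cod (with_opposite C) k) \<cdot>\<^bsub>Learn C\<^esub>
          (\<lambda>(f, f'). learner_iota C f f') (Ident (with_opposite C) (Dom (Learn C) u) \<boxtimes>\<^bsub>with_opposite C\<^esub> k)"
      by (auto elim!: learner_cases simp: learner_right_learner param_map_arr learner_comp_iota_left learner_comp_iota_right
        param_right_param_map param_left_param_map param_whisker_natural)
  next
    fix u Y Z assume "u \<in> Arr (Learn C)" "Y \<in> Obj (with_opposite C)" "Z \<in> Obj (with_opposite C)"
    then show "(\<lambda>(f, f'). learner_iota C f f') (\<a>\<^bsub>with_opposite C\<^esub> (Cod (Learn C) u) Y Z)
          \<cdot>\<^bsub>Learn C\<^esub> learner_right (learner_right u Y) Z =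
        learner_right u (Y \<otimes>\<^bsub>with_opposite C\<^esub> Z) \<cdot>\<^bsub>Learn C\<^esub>
          (\<lambda>(f, f'). learner_iota C f f') (\<a>\<^bsub>with_opposite C\<^esub> (Dom (Learn C) u) Y Z)"
      by (auto elim!: learner_cases simp: learner_right_learner param_map_arr learner_comp_iota_left learner_comp_iota_right
        param_right_param_map param_left_param_map param_whisker_assoc)
  next
    fix u assume "u \<in> Arr (Learn C)"
    then obtain A A' B B' P Q f g where f: "param_map P A Q B f" and g: "param_map Q B' P A' g"
      and u: "u = learner A A' B B' P Q f g" by (auto elim: learner_cases)
    note [simp] = param_map_arr[OF f] param_map_arr[OF g] param_map_arr[OF param_left_param_map[OF g, of \<one>]]
    have "param_left \<one> Q B' P A' g \<cdot> (Q \<lhd> inv (\<l> B')) = (P \<lhd> inv (\<l> A')) \<cdot> g"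
    proof (rule iso_mono[where h = "P \<lhd> \<l> A'"])
      show "(P \<lhd> \<l> A') \<cdot> param_left \<one> Q B' P A' g \<cdot> (Q \<lhd> inv (\<l> B')) = (P \<lhd> \<l> A') \<cdot> (P \<lhd> inv (\<l> A')) \<cdot> g"
        by (simp add: Comp_rewrite[OF param_whisker_Unit(2)[OF g]])
    qed simp_all
    then show "(\<lambda>(f, f'). learner_iota C f f') (\<r>\<^bsub>with_opposite C\<^esub> (Cod (Learn C) u))
          \<cdot>\<^bsub>Learn C\<^esub> learner_right u \<one>\<^bsub>with_opposite C\<^esub> =
        u \<cdot>\<^bsub>Learn C\<^esub> (\<lambda>(f, f'). learner_iota C f f') (\<r>\<^bsub>with_opposite C\<^esub> (Dom (Learn C) u))"
      using f g by (simp add: u learner_right_learner learner_comp_iota_left learner_comp_iota_right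
        param_right_param_map param_left_param_map param_whisker_Unit(1))
  next
    fix u v assume "u \<in> Arr (Learn C)" "v \<in> Arr (Learn C)"
    obtain A A' B B' P Q f g where f: "param_map P A Q B f" and g: "param_map Q B' P A' g"
      and u: "u = learner A A' B B' P Q f g" using \<open>u \<in> Arr (Learn C)\<close> by (auto elim: learner_cases)
    obtain D D' E E' S T h k where h: "param_map S D T E h" and k: "param_map T E' S D' k"
      and v: "v = learner D D' E E' S T h k" using \<open>v \<in> Arr (Learn C)\<close> by (auto elim: learner_cases)
    note [simp] = param_map_arr[OF f] param_map_arr[OF g] param_map_arr[OF h] param_map_arr[OF k]
    \<comment> \<open>Conjugation by symmetries turns the whiskerings of the two components into those from the other side.\<close>
    have left: "learner_comp C (learner_iota C (\<s> E Z) (\<s> E' Z'))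
          (learner_comp C (learner_right v (Z, Z')) (learner_iota C (\<s> Z D) (\<s> Z' D'))) =
        learner (Z \<otimes> D) (D' \<otimes> Z') (Z \<otimes> E) (E' \<otimes> Z') S T (param_left Z S D T E h) (param_right T E' S D' k Z')"
      if "Z \<in> Obj C" "Z' \<in> Obj C" for Z Z'
    proof -
      note [simp] = that param_map_arr[OF param_right_param_map[OF h that(1)]] param_map_arr[OF param_left_param_map[OF k that(2)]]
      have "learner_comp C (learner_iota C (\<s> E Z) (\<s> E' Z'))
          (learner_comp C (learner_right v (Z, Z')) (learner_iota C (\<s> Z D) (\<s> Z' D'))) =
        learner (Z \<otimes> D) (D' \<otimes> Z') (Z \<otimes> E) (E' \<otimes> Z') S T
          ((T \<lhd> \<s> E Z) \<cdot> param_right S D T E h Z \<cdot> (S \<lhd> \<s> Z D))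
          (((S \<lhd> \<s> Z' D') \<cdot> param_left Z' T E' S D' k) \<cdot> (T \<lhd> \<s> E' Z'))"
      proof -
        have pm: "param_map S (Z \<otimes> D) T (E \<otimes> Z) (param_right S D T E h Z \<cdot> (S \<lhd> \<s> Z D))"
          "param_map T (Z' \<otimes> E') S (D' \<otimes> Z') ((S \<lhd> \<s> Z' D') \<cdot> param_left Z' T E' S D' k)"
          by (simp_all add: param_map_def)
        have "learner_comp C (learner_right v (Z, Z')) (learner_iota C (\<s> Z D) (\<s> Z' D')) =
          learner (Z \<otimes> D) (D' \<otimes> Z') (E \<otimes> Z) (Z' \<otimes> E') S T
            (param_right S D T E h Z \<cdot> (S \<lhd> \<s> Z D)) ((S \<lhd> \<s> Z' D') \<cdot> param_left Z' T E' S D' k)"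
          unfolding v learner_right_learner[OF h k that]
          by (rule learner_comp_iota_right[OF param_right_param_map[OF h that(1)] param_left_param_map[OF k that(2)]]) simp_all
        then show ?thesis
          by (simp only:) (rule learner_comp_iota_left[OF pm], simp_all)
      qed
      then show ?thesis
        by (simp add: param_whisker_Symmetry(1)[OF h] param_whisker_Symmetry(2)[OF k])
    qed
    have *: "learner_tensor C u v = learner_comp C (learner_right u (E, E'))
      (learner (A \<otimes> D) (D' \<otimes> A') (A \<otimes> E) (E' \<otimes> A') S T (param_left A S D T E h) (param_right T E' S D' k A'))"
      unfolding u v learner_tensor_learner[OF f g h k]
      using f g h k by (simp add: learner_right_learner learner_comp_learner param_right_param_map param_left_param_map)
    then show "u \<boxtimes>\<^bsub>Learn C\<^esub> v = learner_right u (Cod (Learn C) v) \<cdot>\<^bsub>Learn C\<^esub>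
        (\<lambda>(f, f'). learner_iota C f f') (\<s>\<^bsub>with_opposite C\<^esub> (Cod (Learn C) v) (Dom (Learn C) u)) \<cdot>\<^bsub>Learn C\<^esub>
        learner_right v (Dom (Learn C) u) \<cdot>\<^bsub>Learn C\<^esub>
        (\<lambda>(f, f'). learner_iota C f f') (\<s>\<^bsub>with_opposite C\<^esub> (Dom (Learn C) u) (Dom (Learn C) v))"
      using left[of A A'] by (simp add: u v)
    have "u \<boxtimes>\<^bsub>Learn C\<^esub> v = learner_comp C
        (learner (B \<otimes> D) (D' \<otimes> B') (B \<otimes> E) (E' \<otimes> B') S T (param_left B S D T E h) (param_right T E' S D' k B'))
        (learner_right u (D, D'))"
    proof -
      note pl = param_left_param_map[OF h, of A, simplified] param_right_param_map[OF f, of E, simplified]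
        param_left_param_map[OF g, of E', simplified] param_right_param_map[OF k, of A', simplified]
        param_right_param_map[OF f, of D, simplified] param_left_param_map[OF h, of B, simplified]
        param_right_param_map[OF k, of B', simplified] param_left_param_map[OF g, of D', simplified]
      note pc = param_comp_param_map[OF pl(5,6)] param_comp_param_map[OF pl(7,8)] param_comp_param_map[OF pl(1,2)] param_comp_param_map[OF pl(3,4)]
      \<comment> \<open>The second components satisfy the interchange equation with the two learners in opposite order.\<close>
      have "learner_comp C
          (learner (B \<otimes> D) (D' \<otimes> B') (B \<otimes> E) (E' \<otimes> B') S T (param_left B S D T E h) (param_right T E' S D' k B'))
          (learner_right u (D, D')) = u \<boxtimes>\<^bsub>Learn C\<^esub> v"
        unfolding u v learner_right_learner[OF f g param_map_arr(5)[OF h] param_map_arr(7)[OF k]]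
          learner_comp_learner[OF pl(5,8,6,7)] Learn_simps learner_tensor_learner[OF f g h k]
        by (rule learner_eqI[OF pc, of "\<s> S P" "\<s> Q T"])
          (simp_all add: param_interchange[OF f h] param_interchange[OF k g])
      then show ?thesis ..
    qed
    then show "u \<boxtimes>\<^bsub>Learn C\<^esub> v =
        (\<lambda>(f, f'). learner_iota C f f') (\<s>\<^bsub>with_opposite C\<^esub> (Cod (Learn C) v) (Cod (Learn C) u)) \<cdot>\<^bsub>Learn C\<^esub>
        learner_right v (Cod (Learn C) u) \<cdot>\<^bsub>Learn C\<^esub>
        (\<lambda>(f, f'). learner_iota C f f') (\<s>\<^bsub>with_opposite C\<^esub> (Cod (Learn C) u) (Dom (Learn C) v)) \<cdot>\<^bsub>Learn C\<^esub>
        learner_right u (Dom (Learn C) v)"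
    proof -
      assume tensor: "u \<boxtimes>\<^bsub>Learn C\<^esub> v = learner_comp C
        (learner (B \<otimes> D) (D' \<otimes> B') (B \<otimes> E) (E' \<otimes> B') S T (param_left B S D T E h) (param_right T E' S D' k B'))
        (learner_right u (D, D'))"
      have arr: "learner_iota C (\<s> E B) (\<s> E' B') \<in> Hom (Learn C) (E \<otimes> B, B' \<otimes> E') (B \<otimes> E, E' \<otimes> B')"
        "learner_right v (B, B') \<in> Hom (Learn C) (D \<otimes> B, B' \<otimes> D') (E \<otimes> B, B' \<otimes> E')"
        "learner_iota C (\<s> B D) (\<s> B' D') \<in> Hom (Learn C) (B \<otimes> D, D' \<otimes> B') (D \<otimes> B, B' \<otimes> D')"
        "learner_right u (D, D') \<in> Hom (Learn C) (A \<otimes> D, D' \<otimes> A') (B \<otimes> D, D' \<otimes> B')"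
        using f g h k by (simp_all add: learner_iota_in u v learner_right_learner param_right_param_map param_left_param_map learner_in)
          (simp_all add: learner_iota_def)
      show ?thesis
        unfolding tensor left[symmetric, OF param_map_arr(7)[OF f] param_map_arr(5)[OF g]]
        using arr N.Comp_simps N.Comp_assoc' by (simp add: u v)
    qed
  qed (auto simp: learner_id_iota)
qed

lemma symmetric_monoidal_Learn: "symmetric_monoidal_category (Learn C)"
  by (rule central_action.symmetric_monoidal[OF central_action_Learn])

end

section \<open>Quotients by monoidal congruences\<close>

context monoidal_category
begin

lemma snake_in:
  assumes [simp]: "X \<in> Obj C" "Y \<in> Obj C"
    and "\<eta> \<in> Hom C \<one> (X \<otimes> Y)" and "\<epsilon> \<in> Hom C (Y \<otimes> X) \<one>"
  shows "snake C X Y \<eta> \<epsilon> \<in> Hom C X X"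
  using assms(3,4) by (simp add: snake_def)

end

locale monoidal_congruence = symmetric_monoidal_category D for D :: "('o, 'm) smc" (structure) +
  fixes E :: "'m \<Rightarrow> 'm \<Rightarrow> bool"
  assumes E_parallel: "E f g \<Longrightarrow> f \<in> Arr D \<and> g \<in> Arr D \<and> Dom D f = Dom D g \<and> Cod D f = Cod D g"
    and E_refl: "f \<in> Arr D \<Longrightarrow> E f f"
    and E_sym: "E f g \<Longrightarrow> E g f"
    and E_trans: "\<lbrakk>E f g; E g h\<rbrakk> \<Longrightarrow> E f h"
    and E_Comp: "\<lbrakk>E f f'; E g g'; Dom D g = Cod D f\<rbrakk> \<Longrightarrow> E (g \<cdot> f) (g' \<cdot> f')"
    and E_Tensor: "\<lbrakk>E f f'; E g g'\<rbrakk> \<Longrightarrow> E (f \<boxtimes> g) (f' \<boxtimes> g')"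
begin

abbreviation Q where "Q \<equiv> quotient_smc D E"

abbreviation cls where "cls f \<equiv> Collect (E f)"

lemma cls_eqI: "E f g \<Longrightarrow> cls f = cls g"
  using E_sym E_trans by blast

lemma quotient_simps [simp]:
  "Obj Q = Obj D" "TensorObj Q = TensorObj D" "Unit Q = Unit D" "Ident Q A = cls (Ident D A)"
  "\<a>\<^bsub>Q\<^esub> A B F = cls (\<a> A B F)" "\<l>\<^bsub>Q\<^esub> A = cls (\<l> A)" "\<r>\<^bsub>Q\<^esub> A = cls (\<r> A)" "\<s>\<^bsub>Q\<^esub> A B = cls (\<s> A B)"
  by (simp_all add: quotient_smc_def)

lemma Arr_Q: "Arr Q = cls ` Arr D"
  by (auto simp: quotient_smc_def quotient_def)

lemma cls_simps [simp]:
  assumes "f \<in> Arr D"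
  shows "cls f \<in> Arr Q" "Dom Q (cls f) = Dom D f" "Cod Q (cls f) = Cod D f"
proof -
  show "cls f \<in> Arr Q" using assms by (simp add: Arr_Q)
  have "Dom D ` cls f = {Dom D f}" "Cod D ` cls f = {Cod D f}"
    using E_refl[OF assms] by (auto dest: E_parallel intro!: image_eqI[of _ _ f])
  then show "Dom Q (cls f) = Dom D f" "Cod Q (cls f) = Cod D f"
    by (simp_all add: quotient_smc_def)
qed

lemma Comp_Q [simp]:
  assumes "f \<in> Arr D" "g \<in> Arr D" "Dom D g = Cod D f"
  shows "cls g \<cdot>\<^bsub>Q\<^esub> cls f = cls (g \<cdot> f)"
proof -
  have "cls (g' \<cdot> f') = cls (g \<cdot> f)" if "E g g'" "E f f'" for g' f'
    using cls_eqI[OF E_Comp[OF that(2,1)]] assms by simp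
  moreover have "E g g" "E f f" using assms E_refl by auto
  ultimately have "(\<Union>g' \<in> cls g. \<Union>f' \<in> cls f. cls (g' \<cdot> f')) = cls (g \<cdot> f)" by blast
  then show ?thesis by (simp add: quotient_smc_def)
qed

lemma Tensor_Q [simp]:
  assumes "f \<in> Arr D" "g \<in> Arr D"
  shows "cls f \<boxtimes>\<^bsub>Q\<^esub> cls g = cls (f \<boxtimes> g)"
proof -
  have "cls (f' \<boxtimes> g') = cls (f \<boxtimes> g)" if "E f f'" "E g g'" for g' f'
    using cls_eqI[OF E_Tensor[OF that]] by simp
  moreover have "E g g" "E f f" using assms E_refl by auto
  ultimately have "(\<Union>f' \<in> cls f. \<Union>g' \<in> cls g. cls (f' \<boxtimes> g')) = cls (f \<boxtimes> g)" by blast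
  then show ?thesis by (simp add: quotient_smc_def)
qed

lemma Hom_QE:
  assumes "F \<in> Hom Q A B"
  obtains f where "f \<in> Arr D" "F = cls f" "Dom D f = A" "Cod D f = B"
proof -
  from assms obtain f where f: "f \<in> Arr D" "F = cls f" by (auto simp: Arr_Q)
  with assms that show ?thesis by simp
qed

lemma Hom_Q_iff: "f \<in> Arr D \<Longrightarrow> cls f \<in> Hom Q A B \<longleftrightarrow> Dom D f = A \<and> Cod D f = B"
  by simp

lemma inverse_arrs_Q:
  assumes "iso_arr D f"
  shows "inverse_arrs Q (cls f) (cls (inv f))"
  using assms iso_arr_Arr[OF assms] by (simp add: inverse_arrs_def)

lemma iso_arr_Q: "iso_arr D f \<Longrightarrow> iso_arr Q (cls f)"
  using inverse_arrs_Q by (auto simp: iso_arr_def)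

lemma symmetric_monoidal_quotient: "symmetric_monoidal_category Q"
proof -
  have "category Q"
  proof
    fix F assume "F \<in> Arr Q"
    then obtain f where "f \<in> Arr D" "F = cls f" by (auto simp: Arr_Q)
    then show "Dom Q F \<in> Obj Q" "Cod Q F \<in> Obj Q" by simp_all
  qed (auto elim!: Hom_QE simp: Hom_Q_iff simp del: Hom_iff)
  then interpret Q: category Q .
  show ?thesis
    by unfold_locales
      (auto elim!: Hom_QE simp: Hom_Q_iff iso_arr_Q Tensor_Comp assoc_nat unitor_nat pentagon triangle
        sym_nat Symmetry_Unit hexagon simp del: Hom_iff)
qed

lemma inv_Q: "iso_arr D f \<Longrightarrow> inv\<^bsub>Q\<^esub> (cls f) = cls (inv f)"
  by (meson category.inv_eqI inverse_arrs_Q monoidal_category_def symmetric_monoidal_category_def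
      symmetric_monoidal_quotient)

lemma snake_Q:
  assumes [simp]: "X \<in> Obj D" "Y \<in> Obj D"
    and "\<eta> \<in> Hom D \<one> (X \<otimes> Y)" and "\<epsilon> \<in> Hom D (Y \<otimes> X) \<one>"
  shows "snake Q X Y (cls \<eta>) (cls \<epsilon>) = cls (snake D X Y \<eta> \<epsilon>)"
    and "cosnake Q X Y (cls \<eta>) (cls \<epsilon>) = cls (cosnake D X Y \<eta> \<epsilon>)"
  using assms(3,4) by (simp_all add: snake_def cosnake_def inv_Q)

lemma monoidal_dual_Q:
  assumes [simp]: "X \<in> Obj D" "Y \<in> Obj D"
    and "\<eta> \<in> Hom D \<one> (X \<otimes> Y)" and "\<epsilon> \<in> Hom D (Y \<otimes> X) \<one>"
    and "E (snake D X Y \<eta> \<epsilon>) (Ident D X)" and "E (cosnake D X Y \<eta> \<epsilon>) (Ident D Y)"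
  shows "monoidal_dual Q X Y"
  unfolding monoidal_dual_def
proof (intro exI conjI)
  show "snake Q X Y (cls \<eta>) (cls \<epsilon>) = Ident Q X" "cosnake Q X Y (cls \<eta>) (cls \<epsilon>) = Ident Q Y"
    using assms by (simp_all add: snake_Q cls_eqI)
qed (use assms in simp_all)

end

section \<open>Duals of atemporal learners\<close>

context symmetric_monoidal_category
begin

text \<open>Naturality of the symmetry moves all symmetries to the middle of the snake. There they surround an
  associator, and the composite permutes the factors of \<open>Y \<otimes> (X \<otimes> Y)\<close> trivially. It is the inverse associator
  by the two expressions of \<open>exch Y Y X\<close> that the hexagon gives.\<close>

lemma cosnake_eq_snake:
  assumes [simp]: "X \<in> Obj C" "Y \<in> Obj C"
    and \<eta>: "\<eta> \<in> Hom C \<one> (X \<otimes> Y)" and \<epsilon>: "\<epsilon> \<in> Hom C (Y \<otimes> X) \<one>"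
  shows "cosnake C X Y \<eta> \<epsilon> = snake C Y X (\<s> X Y \<cdot> \<eta>) (\<epsilon> \<cdot> \<s> X Y)"
proof -
  note [simp] = \<eta>[unfolded Hom_iff] \<epsilon>[unfolded Hom_iff]
  have r: "\<r> Y = \<l> Y \<cdot> \<s> Y \<one>" by (simp add: Symmetry_Unit)
  have "inv (\<r> Y) = inv (\<l> Y \<cdot> \<s> Y \<one>)" by (simp only: r)
  then have l: "inv (\<l> Y) = \<s> Y \<one> \<cdot> inv (\<r> Y)" by simp
  have mid: "(\<s> X Y \<rhd> Y) \<cdot> \<s> Y (X \<otimes> Y) \<cdot> \<a> Y X Y \<cdot> \<s> Y (Y \<otimes> X) \<cdot> (Y \<lhd> \<s> X Y) = inv (\<a> Y X Y)"
  proof -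
    have 1: "\<a> Y X Y \<cdot> \<s> Y (Y \<otimes> X) \<cdot> (Y \<lhd> \<s> X Y) = (Y \<lhd> \<s> Y X) \<cdot> exch Y Y X \<cdot> (Y \<lhd> \<s> X Y)"
      by (simp add: exch_Symmetry[of Y Y X])
    have 2: "(\<s> X Y \<rhd> Y) \<cdot> \<s> Y (X \<otimes> Y) \<cdot> (Y \<lhd> \<s> Y X) = \<s> Y (Y \<otimes> X)"
      by (simp add: sym_nat)
    have "(\<s> X Y \<rhd> Y) \<cdot> \<s> Y (X \<otimes> Y) \<cdot> \<a> Y X Y \<cdot> \<s> Y (Y \<otimes> X) \<cdot> (Y \<lhd> \<s> X Y) =
       ((\<s> X Y \<rhd> Y) \<cdot> \<s> Y (X \<otimes> Y) \<cdot> (Y \<lhd> \<s> Y X)) \<cdot> exch Y Y X \<cdot> (Y \<lhd> \<s> X Y)"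
      by (simp add: 1)
    also have "\<dots> = \<s> Y (Y \<otimes> X) \<cdot> exch Y Y X \<cdot> (Y \<lhd> \<s> X Y)"
      unfolding 2 by simp
    also have "\<dots> = inv (\<a> Y X Y)"
      by (simp add: exch_Symmetry'[of Y Y X])
    finally show ?thesis .
  qed
  have "snake C Y X (\<s> X Y \<cdot> \<eta>) (\<epsilon> \<cdot> \<s> X Y) =
    \<l> Y \<cdot> \<s> Y \<one> \<cdot> (Y \<lhd> \<epsilon>) \<cdot> (Y \<lhd> \<s> X Y) \<cdot> \<a> Y X Y \<cdot> (\<s> X Y \<rhd> Y) \<cdot> (\<eta> \<rhd> Y) \<cdot> \<s> Y \<one> \<cdot> inv (\<r> Y)"
    unfolding snake_def r l by simp
  also have "\<dots> = \<l> Y \<cdot> (\<epsilon> \<rhd> Y) \<cdot> ((\<s> X Y \<rhd> Y) \<cdot> \<s> Y (X \<otimes> Y) \<cdot> \<a> Y X Y \<cdot> \<s> Y (Y \<otimes> X) \<cdot> (Y \<lhd> \<s> X Y))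
      \<cdot> (Y \<lhd> \<eta>) \<cdot> inv (\<r> Y)"
    by (simp add: sym_nat)
  also have "\<dots> = cosnake C X Y \<eta> \<epsilon>"
    unfolding mid by (simp add: cosnake_def)
  finally show ?thesis ..
qed

lemma learner_cup_in:
  assumes "X \<in> Ob"
  shows "learner_cup C X \<in> Hom (Learn C) (\<one>, \<one>) (learner_tensor_obj C X (learner_dual X))"
  using assms by (auto simp: learner_cup_def learner_dual_def learner_tensor_obj_def param_map_def intro!: learner_in)

lemma learner_cap_in:
  assumes "X \<in> Ob"
  shows "learner_cap C X \<in> Hom (Learn C) (learner_tensor_obj C (learner_dual X) X) (\<one>, \<one>)"
  using assms by (auto simp: learner_cap_def learner_dual_def learner_tensor_obj_def param_map_def intro!: learner_in)

text \<open>The symmetry \<open>A \<otimes> A' \<rightarrow> A' \<otimes> A\<close> composed with the cup can be slid to the parameter \<open>A \<otimes> A'\<close>.\<close>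

lemma learner_cup_dual:
  assumes "X \<in> Ob"
  shows "learner_cup C (learner_dual X) = \<s>\<^bsub>Learn C\<^esub> X (learner_dual X) \<cdot>\<^bsub>Learn C\<^esub> learner_cup C X"
proof -
  obtain A A' where X [simp]: "X = (A, A')" by (cases X)
  from assms have [simp]: "A \<in> Obj C" "A' \<in> Obj C" by auto
  let ?Z = "A \<otimes> A'" and ?Z' = "A' \<otimes> A"
  have cup: "param_map ?Z \<one> \<one> ?Z (inv (\<l> ?Z) \<cdot> \<r> ?Z)" "param_map \<one> ?Z ?Z \<one> (inv (\<r> ?Z) \<cdot> \<l> ?Z)"
    by (simp_all add: param_map_def)
  have "learner_comp C (learner_iota C (\<s> A A') (\<s> A' A)) (learner_cup C X) =
      learner \<one> \<one> ?Z' ?Z' ?Z \<one> ((\<one> \<lhd> \<s> A A') \<cdot> inv (\<l> ?Z) \<cdot> \<r> ?Z) ((inv (\<r> ?Z) \<cdot> \<l> ?Z) \<cdot> (\<one> \<lhd> \<s> A' A))"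
    unfolding learner_cup_def X prod.case by (rule learner_comp_iota_left[OF cup]) simp_all
  also have "\<dots> = learner_cup C (learner_dual X)"
    unfolding learner_cup_def learner_dual_def X prod.case
    by (rule learner_eqI[of _ _ _ _ _ _ _ _ _ _ _ _ "\<s> A A'" "Ident C \<one>"])
      (simp_all add: param_map_def unitor_nat unitor_natural_inv Comp_rewrite[OF unitor_natural_inv(1)] Comp_rewrite[OF unitor_natural_inv(2)])
  finally show ?thesis by (simp add: learner_dual_def)
qed

text \<open>As for the cup, with the symmetry slid to the target parameter \<open>A' \<otimes> A\<close>.\<close>

lemma learner_cap_dual:
  assumes "X \<in> Ob"
  shows "learner_cap C (learner_dual X) = learner_cap C X \<cdot>\<^bsub>Learn C\<^esub> \<s>\<^bsub>Learn C\<^esub> X (learner_dual X)"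
proof -
  obtain A A' where X [simp]: "X = (A, A')" by (cases X)
  from assms have [simp]: "A \<in> Obj C" "A' \<in> Obj C" by auto
  let ?Z = "A \<otimes> A'" and ?Z' = "A' \<otimes> A"
  have cap: "param_map \<one> ?Z' ?Z' \<one> (inv (\<r> ?Z') \<cdot> \<l> ?Z')" "param_map ?Z' \<one> \<one> ?Z' (inv (\<l> ?Z') \<cdot> \<r> ?Z')"
    by (simp_all add: param_map_def)
  have "learner_comp C (learner_cap C X) (learner_iota C (\<s> A A') (\<s> A' A)) =
      learner ?Z ?Z \<one> \<one> \<one> ?Z' ((inv (\<r> ?Z') \<cdot> \<l> ?Z') \<cdot> (\<one> \<lhd> \<s> A A')) ((\<one> \<lhd> \<s> A' A) \<cdot> inv (\<l> ?Z') \<cdot> \<r> ?Z')"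
    unfolding learner_cap_def X prod.case by (rule learner_comp_iota_right[OF cap]) simp_all
  also have "\<dots> = learner_cap C (learner_dual X)"
    unfolding learner_cap_def learner_dual_def X prod.case
    by (rule learner_eqI[of _ _ _ _ _ _ _ _ _ _ _ _ "Ident C \<one>" "\<s> A' A"])
      (simp_all add: param_map_def unitor_nat unitor_natural_inv Comp_rewrite[OF unitor_natural_inv(1)] Comp_rewrite[OF unitor_natural_inv(2)])
  finally show ?thesis by (simp add: learner_dual_def)
qed

text \<open>The dual of the dual is the object itself, so the twisted cup and cap of \<open>X\<close> are those of \<open>X\<^sup>*\<close>.\<close>

lemma learner_cosnake_eq_snake:
  assumes X: "X \<in> Ob"
  shows "cosnake (Learn C) X (learner_dual X) (learner_cup C X) (learner_cap C X) =
    snake (Learn C) (learner_dual X) (learner_dual (learner_dual X))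
      (learner_cup C (learner_dual X)) (learner_cap C (learner_dual X))"
proof -
  interpret L: symmetric_monoidal_category "Learn C" by (rule symmetric_monoidal_Learn)
  have "learner_dual X \<in> Ob" "learner_dual (learner_dual X) = X" using X by (auto simp: learner_dual_def)
  then show ?thesis
    using X learner_cup_in[OF X] learner_cap_in[OF X]
    by (subst L.cosnake_eq_snake) (simp_all add: learner_cup_dual learner_cap_dual)
qed

lemma monoidal_congruence_atemporal: "monoidal_congruence (Learn C) (atemporal_eq C)"
proof -
  interpret L: symmetric_monoidal_category "Learn C" by (rule symmetric_monoidal_Learn)
  show ?thesis
  proof
    fix \<phi> \<psi> assume "atemporal_eq C \<phi> \<psi>"
    then show "\<phi> \<in> Arr (Learn C) \<and> \<psi> \<in> Arr (Learn C) \<and> Dom (Learn C) \<phi> = Dom (Learn C) \<psi> \<and>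
      Cod (Learn C) \<phi> = Cod (Learn C) \<psi>"
    proof (induction rule: atemporal_eq.induct)
      case (snake X)
      then have X: "X \<in> Ob" and "learner_dual X \<in> Ob" by (auto simp: learner_dual_def)
      then have "snake (Learn C) X (learner_dual X) (learner_cup C X) (learner_cap C X) \<in> Hom (Learn C) X X"
        using learner_cup_in[OF X] learner_cap_in[OF X] by (intro L.snake_in) simp_all
      then show ?case using L.Ident_in[of X] X by simp
    next
      case (comp \<phi> \<phi>' \<psi> \<psi>')
      then show ?case using L.Comp_simps by (metis (full_types))
    next
      case (tensor \<phi> \<phi>' \<psi> \<psi>')
      then show ?case using L.TensorArr_simps by (metis (full_types))
    qed simp_all
  qed (blast intro: atemporal_eq.refl atemporal_eq.sym atemporal_eq.trans atemporal_eq.comp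
      atemporal_eq.tensor)+
qed

theorem compact_closed_Atemp: "compact_closed_category (Atemp C)"
proof -
  interpret E: monoidal_congruence "Learn C" "atemporal_eq C" by (rule monoidal_congruence_atemporal)
  interpret A: symmetric_monoidal_category "Atemp C"
    unfolding Atemp_def by (rule E.symmetric_monoidal_quotient)
  show ?thesis
  proof
    fix X assume "X \<in> Obj (Atemp C)"
    then have X: "X \<in> Ob" by (simp add: Atemp_def)
    then have Y: "learner_dual X \<in> Ob" by (auto simp: learner_dual_def)
    have "atemporal_eq C (snake (Learn C) X (learner_dual X) (learner_cup C X) (learner_cap C X)) (Ident (Learn C) X)"
      "atemporal_eq C (cosnake (Learn C) X (learner_dual X) (learner_cup C X) (learner_cap C X))
        (Ident (Learn C) (learner_dual X))"
      unfolding learner_cosnake_eq_snake[OF X] using X Y by (auto intro: atemporal_eq.snake simp del: Learn_simps(5))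
    then have "monoidal_dual (Atemp C) X (learner_dual X)"
      unfolding Atemp_def using X Y learner_cup_in[OF X] learner_cap_in[OF X]
      by (intro E.monoidal_dual_Q) simp_all
    then show "\<exists>Y \<in> Obj (Atemp C). monoidal_dual (Atemp C) X Y"
      using Y by (intro bexI[of _ "learner_dual X"]) (simp_all add: Atemp_def)
  qed
qed

end

theorem proposition2p8:
  fixes C :: "('o, 'm) smc"
  assumes "symmetric_monoidal_category C"
  shows "compact_closed_category (Atemp C)"
  by (rule symmetric_monoidal_category.compact_closed_Atemp[OF assms])

end
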